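(* Let $f_1,\dots,f_N:\mathbb{R}^d\times\Delta\to\mathbb{R}$, the compact convex set $\mathbb{X}\subset\mathbb{R}^d$, $c\in\mathbb{R}^d$ and $\varepsilon_1,\dots,\varepsilon_N\in(0,1)$ be the data of the multiple chance-constrained program (MCP), and consider its scenario program MSP with sample sizes $K_1,\dots,K_N$ and $K=\sum_{i=1}^N K_i$. Assume: (Convexity) for every $i\in\{1,\dots,N\}$ and for $\Pr$-almost every $\delta\in\Delta$, $f_i(\cdot,\delta)$ is convex on $\mathbb{R}^d$; (Existence and uniqueness) the MCP admits at least one feasible point, and if there are multiple optimal points, a unique one is selected by a tie-break rule (e.g. the lexicographic order on $\mathbb{R}^d$); the same tie-break rule is used for the scenario programs; (Independence) all random samples $\delta^{(i,\kappa_i)}$, $i\in\{1,\dots,N\}$, $\kappa_i\in\{1,\dots,K_i\}$, together with the uncertainty $\delta$ itself form a set of independent and identically distributed random variables; (Feasibility) for any number of samples $K_1,\dots,K_N$ the MSP admits a feasible solution almost surely (any $\Pr$-null set on which this fails being removed from $\Delta$); (Sample size) $K_1,\dots,K_N\ge d$. Then for each $i\in\{1,\dots,N\}$, with $\rho_i$ the support rank of chance constraint $i$, $$\Pr\nolimits^{K}\bigl[V_i(\omega^{(1)},\dots,\omega^{(N)})>\varepsilon_i\bigr]\le \mathrm{B}(\varepsilon_i;\rho_i-1,K_i),$$ where $\mathrm{B}(\varepsilon;n,K):=\sum_{j=0}^{n}\binom{K}{j}\varepsilon^{j}(1-\varepsilon)^{K-j}$.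
   Context: Setting. $\delta$ is a random variable with probability measure $\Pr$ and support set $\Delta$. The set $\mathbb{X}\subset\mathbb{R}^d$ is compact and convex. The multiple chance-constrained program (MCP) is $$\min_{x\in\mathbb{X}} c^{\mathrm T}x\quad\text{s.t.}\quad \Pr[f_i(x,\delta)\le 0]\ge 1-\varepsilon_i\quad\text{for all } i\in\{1,\dots,N\}.$$ All sets whose probability is taken are assumed measurable. Scenario program. For each $i$, the multi-sample is $\omega^{(i)}=\{\delta^{(i,1)},\dots,\delta^{(i,K_i)}\}$, and $\omega=\{\omega^{(1)},\dots,\omega^{(N)}\}\in\Delta^K$ is distributed according to the product measure $\Pr^K$, $K=\sum_i K_i$. The program MSP$[\omega^{(1)},\dots,\omega^{(N)}]$ is $$\min_{x\in\mathbb{X}} c^{\mathrm T}x\quad\text{s.t.}\quad f_i(x,\delta^{(i,\kappa_i)})\le 0\quad\text{for all }\kappa_i\in\{1,\dots,K_i\},\ i\in\{1,\dots,N\}.$$ Its unique optimal point (after tie-break) is the scenario solution $x^\star(\omega^{(1)},\dots,\omega^{(N)})$. Violation probability. $V_i(\omega^{(1)},\dots,\omega^{(N)}):=\Pr[f_i(x^\star(\omega^{(1)},\dots,\omega^{(N)}),\delta)>0]$, the probability being over $\delta$ with the samples held fixed; it is a random variable on $(\Delta^K,\Pr^K)$. Support rank. For $x\in\mathbb{R}^d$, $\delta\in\Delta$ let $F_i(x,\delta):=\{\xi\in\mathbb{R}^d : f_i(x+\xi,\delta)=f_i(x,\delta)\}$. Let $\mathcal{L}_i$ be the collection of all linear subspaces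 $L\subset\mathbb{R}^d$ with $L\subset F_i(x,\delta)$ for all $x\in\mathbb{R}^d$ and all $\delta\in\Delta$ (any $\Pr$-null set of $\delta$ that adversely influences the result may be removed from $\Delta$). $\mathcal{L}_i$ has a unique maximal element $L_i$ with respect to inclusion (the unconstrained subspace), and the support rank is $\rho_i:=d-\dim L_i$.
   Formalization: The tie-break rule is taken to be lexicographic minimisation of finitely many convex functions on R^d that jointly separate points (this includes the lexicographic order); for an arbitrary tie-break rule the bound can fail. *)

theory Defs
  imports "HOL-Probability.Probability"
begin

text \<open>
  The uncertainty is an element of a probability space \<open>M\<close>; its support set is \<open>space M\<close>. The
  constraint functions \<open>f i\<close> and the numbers \<open>K i\<close>, \<open>\<epsilon> i\<close> are indexed by \<open>i \<in> {1..N}\<close>, and values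
  at other indices are irrelevant. A multi-sample \<open>\<omega>\<close> maps the pair \<open>(i, k)\<close> to the \<open>k\<close>-th sample
  of constraint \<open>i\<close>.
\<close>

definition sample_index :: "nat \<Rightarrow> (nat \<Rightarrow> nat) \<Rightarrow> (nat \<times> nat) set" where
  "sample_index N K = (SIGMA i:{1..N}. {1..K i})"

text \<open>
  The product measure expresses that all samples are independent copies of the uncertainty. The
  uncertainty itself is integrated out separately in \<open>violation_prob\<close>, hence is independent of
  the samples.
\<close>

definition sample_measure ::
  "'b measure \<Rightarrow> nat \<Rightarrow> (nat \<Rightarrow> nat) \<Rightarrow> (nat \<times> nat \<Rightarrow> 'b) measure" where
  "sample_measure M N K = PiM (sample_index N K) (\<lambda>_. M)"

definition mcp_feasible ::
  "'b measure \<Rightarrow> (real ^ 'n) set \<Rightarrow> (nat \<Rightarrow> real ^ 'n \<Rightarrow> 'b \<Rightarrow> real) \<Rightarrow> nat \<Rightarrow> (nat \<Rightarrow> real)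
    \<Rightarrow> (real ^ 'n) set" where
  "mcp_feasible M X f N \<epsilon> =
    {x \<in> X. \<forall>i\<in>{1..N}. measure M {\<delta> \<in> space M. f i x \<delta> \<le> 0} \<ge> 1 - \<epsilon> i}"

definition msp_feasible ::
  "(real ^ 'n) set \<Rightarrow> (nat \<Rightarrow> real ^ 'n \<Rightarrow> 'b \<Rightarrow> real) \<Rightarrow> nat \<Rightarrow> (nat \<Rightarrow> nat)
    \<Rightarrow> (nat \<times> nat \<Rightarrow> 'b) \<Rightarrow> (real ^ 'n) set" where
  "msp_feasible X f N K \<omega> = {x \<in> X. \<forall>i\<in>{1..N}. \<forall>k\<in>{1..K i}. f i x (\<omega> (i, k)) \<le> 0}"

definition optimal_points :: "real ^ 'n \<Rightarrow> (real ^ 'n) set \<Rightarrow> (real ^ 'n) set" where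
  "optimal_points c S = {x \<in> S. \<forall>y\<in>S. c \<bullet> x \<le> c \<bullet> y}"

text \<open>
  A tie-break rule \<open>tb\<close> is a total order on \<open>\<real>\<^sup>d\<close>, where \<open>tb x y\<close> means that \<open>x\<close> is preferred to \<open>y\<close>
  (or equal to it); the least optimal point is selected. An arbitrary selection rule could
  make a nonconvex choice among the optimal points, for which the violation bound fails. The
  admissible orders compare finitely many convex criteria lexicographically, and together the
  criteria separate points. Taking the coordinates as criteria yields the lexicographic order
  on \<open>\<real>\<^sup>d\<close>; minimal Euclidean norm, then coordinates, is another instance.
\<close>

definition tie_break_rule :: "(real ^ 'n \<Rightarrow> real ^ 'n \<Rightarrow> bool) \<Rightarrow> bool" where
  "tie_break_rule tb \<longleftrightarrow>
    (\<exists>gs. (\<forall>g\<in>set gs. convex_on UNIV g) \<and> inj (\<lambda>x. map (\<lambda>g. g x) gs) \<and>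
      (\<forall>x y. tb x y \<longleftrightarrow> lexordp_eq (map (\<lambda>g. g x) gs) (map (\<lambda>g. g y) gs)))"

definition selected ::
  "(real ^ 'n \<Rightarrow> real ^ 'n \<Rightarrow> bool) \<Rightarrow> (real ^ 'n) set \<Rightarrow> real ^ 'n" where
  "selected tb S = (THE x. x \<in> S \<and> (\<forall>y\<in>S. tb x y))"

lemma tie_break_rule_lexicographic:
  fixes ns :: "'n::finite list"
  assumes "set ns = UNIV"
  shows "tie_break_rule
    (\<lambda>x y :: real ^ 'n. lexordp_eq (map (\<lambda>j. x $ j) ns) (map (\<lambda>j. y $ j) ns))"
  unfolding tie_break_rule_def
proof (intro exI[of _ "map (\<lambda>j x. x $ j) ns"] conjI ballI allI)
  show "convex_on UNIV g" if "g \<in> set (map (\<lambda>j x :: real ^ 'n. x $ j) ns)" for g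
    using that by (auto simp: convex_on_def)
  show "inj (\<lambda>x :: real ^ 'n. map (\<lambda>g. g x) (map (\<lambda>j x. x $ j) ns))"
    using assms by (auto simp: inj_def vec_eq_iff)
qed (simp_all add: comp_def)

lemma ex_lexicographic_minimum:
  fixes S :: "'a::t2_space set" and gs :: "('a \<Rightarrow> real) list"
  assumes "\<forall>g\<in>set gs. continuous_on S g" "compact S" "S \<noteq> {}"
  shows "\<exists>x\<in>S. \<forall>y\<in>S. lexordp_eq (map (\<lambda>g. g x) gs) (map (\<lambda>g. g y) gs)"
  using assms
proof (induction gs arbitrary: S)
  case Nil
  then show ?case by auto
next
  case (Cons g gs)
  have g: "continuous_on S g" using Cons.prems by simp
  obtain z where z: "z \<in> S" "\<And>y. y \<in> S \<Longrightarrow> g z \<le> g y"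
    using continuous_attains_inf[OF Cons.prems(2,3) g] by auto
  define T where "T = S \<inter> g -` {g z}"
  have "closedin (top_of_set S) T"
    unfolding T_def by (rule continuous_closedin_preimage[OF g]) simp
  then have T: "compact T" using Cons.prems(2) closedin_compact by blast
  have "T \<noteq> {}" "\<forall>h\<in>set gs. continuous_on T h"
    using z(1) Cons.prems(1) unfolding T_def
    by (auto intro: continuous_on_subset)
  with Cons.IH[of T] T obtain x where
    x: "x \<in> T" "\<And>y. y \<in> T \<Longrightarrow> lexordp_eq (map (\<lambda>g. g x) gs) (map (\<lambda>g. g y) gs)"
    by auto
  have "lexordp_eq (map (\<lambda>g. g x) (g # gs)) (map (\<lambda>g. g y) (g # gs))" if "y \<in> S" for y
  proof (cases "g y = g z")
    case True
    then have "y \<in> T" "g x = g z" using that x(1) by (auto simp: T_def)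
    then show ?thesis using True x(2) by simp
  next
    case False
    then have "g x < g y" using z(2)[OF that] x(1) by (auto simp: T_def)
    then show ?thesis by simp
  qed
  moreover have "x \<in> S" using x(1) by (simp add: T_def)
  ultimately show ?case by blast
qed

lemma tie_break_rule_unique_selection:
  assumes "tie_break_rule tb" "compact S" "S \<noteq> {}"
  shows "\<exists>!x. x \<in> S \<and> (\<forall>y\<in>S. tb x y)"
proof -
  from assms(1) obtain gs where gs: "\<forall>g\<in>set gs. convex_on UNIV g"
    "inj (\<lambda>x. map (\<lambda>g. g x) gs)"
    "\<And>x y. tb x y \<longleftrightarrow> lexordp_eq (map (\<lambda>g. g x) gs) (map (\<lambda>g. g y) gs)"
    unfolding tie_break_rule_def by blast
  have "\<forall>g\<in>set gs. continuous_on S g"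
    using gs(1) convex_on_continuous[OF open_UNIV] continuous_on_subset by blast
  from ex_lexicographic_minimum[OF this assms(2,3)]
  obtain x where x: "x \<in> S" "\<forall>y\<in>S. tb x y" unfolding gs(3) by blast
  show ?thesis
  proof (rule ex1I[of _ x])
    show "x \<in> S \<and> (\<forall>y\<in>S. tb x y)" using x by blast
    fix y assume "y \<in> S \<and> (\<forall>z\<in>S. tb y z)"
    then have "tb x y" "tb y x" using x by blast+
    then have "map (\<lambda>g. g x) gs = map (\<lambda>g. g y) gs"
      unfolding gs(3) by (rule lexordp_eq_antisym)
    then show "y = x" using injD[OF gs(2)] by metis
  qed
qed

definition scenario_solution ::
  "(real ^ 'n) set \<Rightarrow> real ^ 'n \<Rightarrow> (real ^ 'n \<Rightarrow> real ^ 'n \<Rightarrow> bool)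
    \<Rightarrow> (nat \<Rightarrow> real ^ 'n \<Rightarrow> 'b \<Rightarrow> real) \<Rightarrow> nat \<Rightarrow> (nat \<Rightarrow> nat)
    \<Rightarrow> (nat \<times> nat \<Rightarrow> 'b) \<Rightarrow> real ^ 'n" where
  "scenario_solution X c tb f N K \<omega> = selected tb (optimal_points c (msp_feasible X f N K \<omega>))"

definition violation_prob ::
  "'b measure \<Rightarrow> (real ^ 'n) set \<Rightarrow> real ^ 'n \<Rightarrow> (real ^ 'n \<Rightarrow> real ^ 'n \<Rightarrow> bool)
    \<Rightarrow> (nat \<Rightarrow> real ^ 'n \<Rightarrow> 'b \<Rightarrow> real) \<Rightarrow> nat \<Rightarrow> (nat \<Rightarrow> nat)
    \<Rightarrow> nat \<Rightarrow> (nat \<times> nat \<Rightarrow> 'b) \<Rightarrow> real" where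
  "violation_prob M X c tb f N K i \<omega> =
    measure M {\<delta> \<in> space M. f i (scenario_solution X c tb f N K \<omega>) \<delta> > 0}"

text \<open>
  The argument \<open>g\<close> below is a single constraint function \<open>f i\<close>. The almost-everywhere quantifier
  accounts for the convention that a null set of uncertainties may be removed.
\<close>

definition invariance_set :: "(real ^ 'n \<Rightarrow> 'b \<Rightarrow> real) \<Rightarrow> real ^ 'n \<Rightarrow> 'b \<Rightarrow> (real ^ 'n) set" where
  "invariance_set g x \<delta> = {\<xi>. g (x + \<xi>) \<delta> = g x \<delta>}"

definition invariant_subspaces ::
  "'b measure \<Rightarrow> (real ^ 'n \<Rightarrow> 'b \<Rightarrow> real) \<Rightarrow> (real ^ 'n) set set" where
  "invariant_subspaces M g = {L. subspace L \<and> (AE \<delta> in M. \<forall>x. L \<subseteq> invariance_set g x \<delta>)}"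

definition unconstrained_subspace ::
  "'b measure \<Rightarrow> (real ^ 'n \<Rightarrow> 'b \<Rightarrow> real) \<Rightarrow> (real ^ 'n) set" where
  "unconstrained_subspace M g =
    (THE L. L \<in> invariant_subspaces M g \<and> (\<forall>L'\<in>invariant_subspaces M g. L \<subseteq> L' \<longrightarrow> L' = L))"

definition support_rank :: "'b measure \<Rightarrow> (real ^ 'n \<Rightarrow> 'b \<Rightarrow> real) \<Rightarrow> nat" where
  "support_rank M g = CARD('n) - dim (unconstrained_subspace M g)"

lemma invariant_subspaces_sum:
  assumes "L \<in> invariant_subspaces M g" "L' \<in> invariant_subspaces M g"
  shows "{a + b | a b. a \<in> L \<and> b \<in> L'} \<in> invariant_subspaces M g"
proof -
  have "AE \<delta> in M. \<forall>x. L \<subseteq> invariance_set g x \<delta>" "AE \<delta> in M. \<forall>x. L' \<subseteq> invariance_set g x \<delta>"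
    using assms by (auto simp: invariant_subspaces_def)
  then have "AE \<delta> in M. \<forall>x. {a + b | a b. a \<in> L \<and> b \<in> L'} \<subseteq> invariance_set g x \<delta>"
  proof eventually_elim
    case (elim \<delta>)
    have "g (x + (a + b)) \<delta> = g x \<delta>" if "a \<in> L" "b \<in> L'" for x a b
    proof -
      have "g (x + a + b) \<delta> = g (x + a) \<delta>" "g (x + a) \<delta> = g x \<delta>"
        using elim that unfolding invariance_set_def by blast+
      then show ?thesis by (simp add: add.assoc)
    qed
    then show ?case unfolding invariance_set_def by blast
  qed
  then show ?thesis
    using assms subspace_sums unfolding invariant_subspaces_def by blast
qed

lemma unconstrained_subspace_unique:
  "\<exists>!L. L \<in> invariant_subspaces M g \<and> (\<forall>L'\<in>invariant_subspaces M g. L \<subseteq> L' \<longrightarrow> L' = L)"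
proof -
  let ?S = "invariant_subspaces M g"
  have zero: "{0} \<in> ?S"
    by (auto simp: invariant_subspaces_def invariance_set_def)
  have "\<forall>L. L \<in> ?S \<longrightarrow> dim L < CARD('a) + 1"
    using dim_subset_UNIV_cart[where 'n='a] by (simp add: less_Suc_eq_le)
  from ex_has_greatest_nat[where P="\<lambda>L. L \<in> ?S" and f=dim, OF zero this]
  obtain L where L: "L \<in> ?S" "\<And>L'. L' \<in> ?S \<Longrightarrow> dim L' \<le> dim L" by blast
  have max: "L' = L" if "L' \<in> ?S" "L \<subseteq> L'" for L'
    using subspace_dim_equal[of L L'] that L by (simp add: invariant_subspaces_def)
  have uniq: "L' = L" if L': "L' \<in> ?S" "\<forall>L''\<in>?S. L' \<subseteq> L'' \<longrightarrow> L'' = L'" for L'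
  proof -
    let ?T = "{a + b | a b. a \<in> L \<and> b \<in> L'}"
    have T: "?T \<in> ?S" by (rule invariant_subspaces_sum[OF L(1) L'(1)])
    have "0 \<in> L" "0 \<in> L'"
      using L(1) L'(1) by (auto simp: invariant_subspaces_def subspace_0)
    then have "L \<subseteq> ?T" "L' \<subseteq> ?T" by force+
    then have "?T = L" "?T = L'" using max[OF T] L'(2)[rule_format, OF T] by auto
    then show ?thesis by simp
  qed
  show ?thesis
  proof (rule ex1I[of _ L])
    show "L \<in> ?S \<and> (\<forall>L'\<in>?S. L \<subseteq> L' \<longrightarrow> L' = L)"
      by (intro conjI ballI impI L(1) max)
  qed (rule uniq, erule conjunct1, erule conjunct2)
qed

text \<open>
  The upper limit \<open>n\<close> is an integer, since the bound uses \<open>n = support rank - 1\<close>, which is \<open>-1\<close>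
  (an empty sum) for rank \<open>0\<close>. Terms with \<open>j > K\<close> vanish because of the binomial coefficient.
\<close>

definition binomial_tail :: "real \<Rightarrow> int \<Rightarrow> nat \<Rightarrow> real" where
  "binomial_tail \<epsilon> n K =
    (\<Sum>j\<in>{j. int j \<le> n}. real (K choose j) * \<epsilon> ^ j * (1 - \<epsilon>) ^ (K - j))"

end

theory Submission
  imports Defs
begin

text \<open>
  Conditioning on the samples of the other constraints leaves a single constraint \<open>f\<close> over a
  random compact convex set.

  First, a generic problem is solved exactly. Suppose that the objective is strictly convex and
  that no sample is tight at the solution of a subprogram that omits it. Then the samples tight at
  the solution form the unique minimal subset with the same solution, and by Radon's theorem modulo
  the unconstrained subspace there are at most \<open>r\<close> of them, \<open>r\<close> being the support rank. Padding
  this subset with the samples of smallest label singles out exactly one \<open>r\<close>-subset of every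
  sample, and whether a subset is singled out can be tested on the remaining samples one at a time.
  If \<open>v\<close> is the probability that a fresh sample fails the test for \<open>r\<close> random samples, this
  gives \<open>(n + r choose r) E (1 - v)\<^sup>n = 1\<close> for all \<open>n\<close>. These moments determine the law of \<open>v\<close>, and the
  tail of this law is the binomial tail.

  Second, relaxing \<open>f x \<delta> \<le> 0\<close> to \<open>f x \<delta> \<le> \<eta> u\<close> with an independent uniform label \<open>u\<close> makes
  every problem generic, and its solution converges to the original one as \<open>\<eta> \<rightarrow> 0\<close>.

  Third, a lexicographic objective is a limit of strictly convex ones: the last two criteria \<open>g, h\<close>
  are merged into \<open>g + \<tau> h\<close>, and \<open>\<tau> \<rightarrow> 0\<close>. The event of a large violation is contained in the
  limit inferior of its approximations, so the bound carries over in both limits.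
\<close>

section \<open>The beta distribution of the violation probability\<close>

text \<open>The moment identity is a count. Exactly one of the \<open>n + r choose r\<close> subsets
  of size \<open>r\<close> is singled out, all with the same probability, and the \<open>n\<close>
  samples outside must pass a test that depends only on those inside; this gives the factor
  \<open>(1 - v)^n\<close>. Equality is essential, since inequalities between moments would not fix
  the law of \<open>v\<close>. This is the reason for padding: the active set alone may have fewer
  than \<open>r\<close> members, and its size is random. All moments are used even for one fixed
  \<open>K\<close>, so feasibility has to be available for every sample size. Two obstacles shape
  the rest. The objective and \<open>X\<close> are not invariant under the unconstrained subspace,
  so Radon's theorem is applied in the quotient and its point has to be lifted back into
  \<open>X\<close>. And the limiting lexicographic selections are not shown to be measurable in the
  sample, so their events are bounded through measurable covers. The other constraints act only
  through the compact convex set, which is why their ranks do not enter the bound.\<close>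

lemma binomial_tail_Suc:
  "binomial_tail \<epsilon> (int (Suc r) - 1) K
    = binomial_tail \<epsilon> (int r - 1) K + real (K choose r) * \<epsilon> ^ r * (1 - \<epsilon>) ^ (K - r)"
proof -
  have "{j. int j \<le> int (Suc r) - 1} = insert r {j. int j \<le> int r - 1}" by auto
  moreover have "finite {j. int j \<le> int r - 1}"
    by (rule finite_subset[of _ "{..r}"]) auto
  ultimately show ?thesis by (simp add: binomial_tail_def)
qed

lemma binomial_tail_zero [simp]: "binomial_tail \<epsilon> (int 0 - 1) K = 0"
  by (simp add: binomial_tail_def)

lemma binomial_tail_nonneg: "0 \<le> \<epsilon> \<Longrightarrow> \<epsilon> \<le> 1 \<Longrightarrow> 0 \<le> binomial_tail \<epsilon> n K"
  unfolding binomial_tail_def by (intro sum_nonneg) auto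

lemma binomial_tail_at_0: "binomial_tail 0 (int (Suc r) - 1) K = 1"
proof (induction r)
  case (Suc r)
  then show ?case by (subst binomial_tail_Suc) simp
qed (simp only: binomial_tail_Suc binomial_tail_zero, simp)

lemma binomial_tail_at_1: "r \<le> K \<Longrightarrow> binomial_tail 1 (int r - 1) K = 0"
proof (induction r)
  case (Suc r)
  then show ?case by (subst binomial_tail_Suc) simp
qed (simp only: binomial_tail_zero)

text \<open>The derivatives of consecutive terms telescope: by
  \<open>(K choose r) * (K - r) = Suc r * (K choose Suc r)\<close> only one product survives. This
  is the classical link between the binomial tail and the incomplete beta integral.\<close>

lemma DERIV_binomial_tail:
  "r \<le> K \<Longrightarrow> ((\<lambda>\<epsilon>. binomial_tail \<epsilon> (int r - 1) K) has_real_derivative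
    - (real (r * (K choose r)) * x ^ (r - 1) * (1 - x) ^ (K - r))) (at x)"
proof (induction r)
  case (Suc r)
  have "((\<lambda>\<epsilon>. real (K choose r) * \<epsilon> ^ r * (1 - \<epsilon>) ^ (K - r)) has_real_derivative
      real (K choose r) * (real r * x ^ (r - 1)) * (1 - x) ^ (K - r)
      - real (K choose r) * x ^ r * (real (K - r) * (1 - x) ^ (K - r - 1))) (at x)"
    by (auto intro!: derivative_eq_intros simp: algebra_simps)
  from DERIV_add[OF Suc.IH this]
  have D: "((\<lambda>\<epsilon>. binomial_tail \<epsilon> (int (Suc r) - 1) K) has_real_derivative
      - (real ((K choose r) * (K - r)) * x ^ r * (1 - x) ^ (K - Suc r))) (at x)"
    using Suc.prems unfolding binomial_tail_Suc by (simp add: algebra_simps)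
  have "(K choose r) * (K - r) = Suc r * (K choose Suc r)"
    using Suc.prems binomial_absorb_comp[of K r] Suc_times_binomial_eq[of "K - 1" r]
    by (cases K) (auto simp: mult.commute)
  then show ?case using D by (simp add: mult.assoc)
qed (simp only: binomial_tail_zero, simp)

text \<open>The density of Beta(r,1), the law of the maximum of \<open>r\<close> independent uniform
  variables, without the cutoff to the unit interval; identically zero for
  \<open>r = 0\<close>.\<close>

definition beta_density :: "nat \<Rightarrow> real \<Rightarrow> real" where
  "beta_density r x = real r * x ^ (r - 1)"

text \<open>Fundamental theorem of calculus for minus the tail, which vanishes at 1 because
  \<open>r \<le> K\<close>. With \<open>a = 0\<close> it yields the moments of the density for
  positive \<open>r\<close>, with \<open>a = \<epsilon>\<close> the final bound.\<close>

lemma beta_density_tail: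
  assumes "r \<le> K" "0 \<le> a" "a \<le> 1"
  shows "has_bochner_integral lborel
      (\<lambda>x. real (K choose r) * beta_density r x * (1 - x) ^ (K - r) * indicator {a..1} x)
      (binomial_tail a (int r - 1) K)"
proof -
  let ?g = "\<lambda>x. real (K choose r) * beta_density r x * (1 - x) ^ (K - r)"
  have "has_bochner_integral lborel (\<lambda>x. ?g x * indicator {a..1} x)
      (- binomial_tail 1 (int r - 1) K - - binomial_tail a (int r - 1) K)"
  proof (rule has_bochner_integral_FTC_Icc_nonneg)
    show "?g \<in> borel_measurable borel" by (simp add: beta_density_def)
    show "DERIV (\<lambda>x. - binomial_tail x (int r - 1) K) x :> ?g x" for x
      using DERIV_minus[OF DERIV_binomial_tail[OF assms(1), of x]]
      by (simp add: beta_density_def mult_ac)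
    show "0 \<le> ?g x" if "x \<in> {a..1}" for x
      using that assms by (auto simp: beta_density_def)
  qed (rule assms)
  then show ?thesis using assms by (simp add: binomial_tail_at_1)
qed

text \<open>
  The moments determine the distribution of \<open>v\<close>: it has density \<open>r x\<^sup>r\<^sup>-\<^sup>1\<close> on the unit
  interval.
\<close>

lemma moments_tail:
  assumes Q: "prob_space Q" and v: "v \<in> borel_measurable Q"
    and v01: "\<And>\<omega>. \<omega> \<in> space Q \<Longrightarrow> 0 \<le> v \<omega> \<and> v \<omega> \<le> 1"
    and mom: "\<And>n. (\<integral>\<omega>. (1 - v \<omega>) ^ n \<partial>Q) = 1 / real ((n + r) choose r)"
    and r: "0 < r" "r \<le> K" and \<epsilon>: "0 < \<epsilon>" "\<epsilon> < 1"
  shows "real (K choose r) * (\<integral>\<omega>. indicator {\<epsilon><..} (v \<omega>) * (1 - v \<omega>) ^ (K - r) \<partial>Q)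
    = binomial_tail \<epsilon> (int r - 1) K"
proof -
  interpret Q: prob_space Q by (rule Q)
  define D where "D = (\<lambda>x. beta_density r x * indicator {0..1} x)"
  have D_nonneg: "0 \<le> D x" for x by (auto simp: D_def beta_density_def indicator_def)
  have momD: "has_bochner_integral lborel (\<lambda>x. (1 - x) ^ n * D x) (1 / real ((n + r) choose r))" for n
  proof -
    have "has_bochner_integral lborel (\<lambda>x. real ((n + r) choose r) * ((1 - x) ^ n * D x)) 1"
      using beta_density_tail[of r "n + r" 0] r binomial_tail_at_0[of "r - 1" "n + r"]
      by (simp add: D_def mult_ac)
    from has_bochner_integral_mult_right[OF this, of "1 / real ((n + r) choose r)"]
    show ?thesis by simp
  qed
  have D_meas [measurable]: "D \<in> borel_measurable borel"
    by (simp add: D_def beta_density_def)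
  have intD: "integrable lborel D" "(\<integral>x. D x \<partial>lborel) = 1"
    using momD[of 0] by (auto simp: has_bochner_integral_iff)
  have bd: "integrable Q (\<lambda>\<omega>. g (v \<omega>))" "integrable lborel (\<lambda>x. g x * D x)"
    if g: "g \<in> borel_measurable borel" "\<And>x. x \<in> {0..1} \<Longrightarrow> \<bar>g x\<bar> \<le> B" for g :: "real \<Rightarrow> real" and B
  proof -
    show "integrable Q (\<lambda>\<omega>. g (v \<omega>))"
      using g v v01 by (intro Q.integrable_const_bound[of _ B]) auto
    show "integrable lborel (\<lambda>x. g x * D x)"
    proof (rule Bochner_Integration.integrable_bound)
      show "integrable lborel (\<lambda>x. B * D x)" using intD by simp
      show "AE x in lborel. norm (g x * D x) \<le> norm (B * D x)"
      proof (rule AE_I2)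
        fix x :: real
        show "norm (g x * D x) \<le> norm (B * D x)"
          using g(2)[of x] by (cases "x \<in> {0..1}") (auto simp: D_def abs_mult intro!: mult_right_mono)
      qed
    qed (use g in measurable)
  qed
  \<comment> \<open>Equality of moments extends to continuous \<open>g\<close> by uniform polynomial
    approximation on the unit interval. The polynomial approximates the reflected function
    \<open>g (1 - y)\<close>, since the known moments are those of \<open>1 - v\<close>.\<close>
  have cont: "(\<integral>\<omega>. g (v \<omega>) \<partial>Q) = (\<integral>x. g x * D x \<partial>lborel)"
    if g: "continuous_on UNIV g" for g :: "real \<Rightarrow> real"
  proof -
    have gm: "g \<in> borel_measurable borel" using g by (rule borel_measurable_continuous_onI)
    have "bounded (g ` {0..1})"
      by (intro compact_imp_bounded compact_continuous_image continuous_on_subset[OF g]) auto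
    then obtain B where B: "\<And>x. x \<in> {0..1} \<Longrightarrow> \<bar>g x\<bar> \<le> B" unfolding bounded_iff by fastforce
    have "\<bar>(\<integral>\<omega>. g (v \<omega>) \<partial>Q) - (\<integral>x. g x * D x \<partial>lborel)\<bar> \<le> e" if "0 < e" for e
    proof -
      have "continuous_on {0..1} (\<lambda>y. g (1 - y))"
        by (rule continuous_on_compose2[OF g]) (auto intro!: continuous_intros)
      then obtain p where p: "real_polynomial_function p"
        "\<And>y. y \<in> {0..1} \<Longrightarrow> \<bar>g (1 - y) - p y\<bar> < e / 2"
        using Stone_Weierstrass_real_polynomial_function[of "{0..1::real}" "\<lambda>y. g (1 - y)" "e / 2"] \<open>0 < e\<close>
        by auto
      obtain a n where pa: "p = (\<lambda>x. \<Sum>i\<le>n. a i * x ^ i)"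
        using p(1) unfolding real_polynomial_function_iff_sum by blast
      have pg: "\<bar>g x - p (1 - x)\<bar> \<le> e / 2" if "x \<in> {0..1}" for x
        using p(2)[of "1 - x"] that by auto
      have pm: "(\<lambda>x. p (1 - x)) \<in> borel_measurable borel" unfolding pa by measurable
      have pB: "\<bar>p (1 - x)\<bar> \<le> B + e / 2" if "x \<in> {0..1}" for x
        using pg[OF that] B[OF that] by linarith
      have mQ: "integrable Q (\<lambda>\<omega>. (1 - v \<omega>) ^ i)" for i
        by (rule bd(1)[of "\<lambda>x. (1 - x) ^ i" 1]) (auto simp: power_le_one)
      have "(\<integral>\<omega>. p (1 - v \<omega>) \<partial>Q) = (\<Sum>i\<le>n. a i * (1 / real ((i + r) choose r)))"
        unfolding pa using mQ by (simp add: mom)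
      moreover have "(\<integral>x. p (1 - x) * D x \<partial>lborel) = (\<Sum>i\<le>n. a i * (1 / real ((i + r) choose r)))"
      proof -
        have "has_bochner_integral lborel (\<lambda>x. \<Sum>i\<le>n. a i * ((1 - x) ^ i * D x))
            (\<Sum>i\<le>n. a i * (1 / real ((i + r) choose r)))"
          by (intro has_bochner_integral_sum has_bochner_integral_mult_right momD)
        then show ?thesis
          by (simp add: pa sum_distrib_right mult.assoc has_bochner_integral_iff)
      qed
      moreover have "\<bar>(\<integral>\<omega>. g (v \<omega>) \<partial>Q) - (\<integral>\<omega>. p (1 - v \<omega>) \<partial>Q)\<bar> \<le> e / 2"
      proof -
        have "(\<integral>\<omega>. g (v \<omega>) \<partial>Q) - (\<integral>\<omega>. p (1 - v \<omega>) \<partial>Q) = (\<integral>\<omega>. g (v \<omega>) - p (1 - v \<omega>) \<partial>Q)"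
          by (intro Bochner_Integration.integral_diff[symmetric] bd(1)[OF gm B] bd(1)[OF pm pB])
        moreover have "\<bar>\<integral>\<omega>. g (v \<omega>) - p (1 - v \<omega>) \<partial>Q\<bar> \<le> (\<integral>\<omega>. e / 2 \<partial>Q)"
        proof (intro order_trans[OF integral_abs_bound integral_mono] integrable_abs)
          show "integrable Q (\<lambda>\<omega>. g (v \<omega>) - p (1 - v \<omega>))"
            by (intro Bochner_Integration.integrable_diff bd(1)[OF gm B] bd(1)[OF pm pB])
        qed (use v01 pg in auto)
        ultimately show ?thesis by (simp add: Q.prob_space)
      qed
      moreover have "\<bar>(\<integral>x. g x * D x \<partial>lborel) - (\<integral>x. p (1 - x) * D x \<partial>lborel)\<bar> \<le> e / 2"
      proof -
        have "(\<integral>x. g x * D x \<partial>lborel) - (\<integral>x. p (1 - x) * D x \<partial>lborel)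
            = (\<integral>x. g x * D x - p (1 - x) * D x \<partial>lborel)"
          by (intro Bochner_Integration.integral_diff[symmetric] bd(2)[OF gm B] bd(2)[OF pm pB])
        moreover have "\<bar>\<integral>x. g x * D x - p (1 - x) * D x \<partial>lborel\<bar> \<le> (\<integral>x. e / 2 * D x \<partial>lborel)"
        proof (rule integral_abs_bound_integral)
          show "integrable lborel (\<lambda>x. g x * D x - p (1 - x) * D x)"
            by (intro Bochner_Integration.integrable_diff bd(2)[OF gm B] bd(2)[OF pm pB])
          show "\<bar>g x * D x - p (1 - x) * D x\<bar> \<le> e / 2 * D x" for x
          proof (cases "x \<in> {0..1}")
            case True
            have "\<bar>g x - p (1 - x)\<bar> * D x \<le> e / 2 * D x"
              by (rule mult_right_mono[OF pg[OF True] D_nonneg])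
            then show ?thesis
              using D_nonneg[of x] by (simp add: left_diff_distrib[symmetric] abs_mult)
          qed (simp add: D_def)
        qed (use intD in simp)
        ultimately show ?thesis using intD by simp
      qed
      ultimately show ?thesis by linarith
    qed
    then show ?thesis by (metis abs_le_zero_iff dense_ge eq_iff_diff_eq_0)
  qed
  define k where "k = K - r"
  \<comment> \<open>The indicator is discontinuous, so it is replaced by ramps of slope
    \<open>n\<close> that vanish up to \<epsilon>. Dominated convergence on both sides then carries
    the equality from \<open>\<psi>\<close> over to \<open>\<phi>\<close>.\<close>
  define \<phi> where "\<phi> = (\<lambda>x. indicator {\<epsilon><..} x * (1 - x) ^ k :: real)"
  define \<psi> where "\<psi> = (\<lambda>n x. min 1 (max 0 (real n * (x - \<epsilon>))) * (1 - x) ^ k)"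
  have \<psi>c: "continuous_on UNIV (\<psi> n)" for n
    unfolding \<psi>_def by (intro continuous_intros)
  have lim: "(\<lambda>n. \<psi> n x) \<longlonglongrightarrow> \<phi> x" for x
  proof (cases "\<epsilon> < x")
    case True
    obtain n0 where "1 / (x - \<epsilon>) < real n0" using reals_Archimedean2 by blast
    then have n0: "1 < real n0 * (x - \<epsilon>)" using True by (simp add: field_simps)
    have "min 1 (max 0 (real n * (x - \<epsilon>))) = 1" if "n \<ge> n0" for n
    proof -
      have "real n0 * (x - \<epsilon>) \<le> real n * (x - \<epsilon>)" using that True by (intro mult_right_mono) auto
      then show ?thesis using n0 by simp
    qed
    then have "eventually (\<lambda>n. \<psi> n x = \<phi> x) sequentially"
      using True unfolding \<psi>_def \<phi>_def by (auto simp: eventually_sequentially)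
    then show ?thesis by (rule tendsto_eventually)
  next
    case False
    have "max 0 (real n * (x - \<epsilon>)) = 0" for n
      using False by (simp add: mult_nonneg_nonpos)
    then show ?thesis using False by (simp add: \<psi>_def \<phi>_def)
  qed
  have \<psi>b: "\<bar>\<psi> n x\<bar> \<le> 1" if "x \<in> {0..1}" for n x
  proof -
    have "\<bar>\<psi> n x\<bar> \<le> 1 * 1"
      using that unfolding \<psi>_def abs_mult by (intro mult_mono) (auto simp: power_le_one)
    then show ?thesis by simp
  qed
  have \<psi>m: "\<psi> n \<in> borel_measurable borel" for n
    using \<psi>c by (rule borel_measurable_continuous_onI)
  have \<phi>m: "\<phi> \<in> borel_measurable borel" unfolding \<phi>_def by simp
  have "(\<lambda>n. \<integral>\<omega>. \<psi> n (v \<omega>) \<partial>Q) \<longlonglongrightarrow> (\<integral>\<omega>. \<phi> (v \<omega>) \<partial>Q)"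
  proof (rule integral_dominated_convergence[where w="\<lambda>_. 1"])
    show "(\<lambda>\<omega>. \<psi> n (v \<omega>)) \<in> borel_measurable Q" for n using \<psi>m v by measurable
    show "(\<lambda>\<omega>. \<phi> (v \<omega>)) \<in> borel_measurable Q" using \<phi>m v by measurable
    show "AE \<omega> in Q. norm (\<psi> n (v \<omega>)) \<le> 1" for n using v01 \<psi>b by auto
  qed (use lim in auto)
  moreover have "(\<lambda>n. \<integral>x. \<psi> n x * D x \<partial>lborel) \<longlonglongrightarrow> (\<integral>x. \<phi> x * D x \<partial>lborel)"
  proof (rule integral_dominated_convergence[where w=D])
    show "(\<lambda>x. \<psi> n x * D x) \<in> borel_measurable lborel" for n using \<psi>m by measurable
    show "(\<lambda>x. \<phi> x * D x) \<in> borel_measurable lborel" using \<phi>m by measurable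
    show "AE x in lborel. norm (\<psi> n x * D x) \<le> D x" for n
    proof (rule AE_I2)
      fix x :: real
      show "norm (\<psi> n x * D x) \<le> D x"
        using \<psi>b[of x n] D_nonneg[of x]
        by (cases "x \<in> {0..1}") (auto simp: D_def abs_mult beta_density_def intro!: mult_left_le_one_le)
    qed
    show "AE x in lborel. (\<lambda>n. \<psi> n x * D x) \<longlonglongrightarrow> \<phi> x * D x"
      by (intro AE_I2 tendsto_intros lim)
  qed (use intD in auto)
  ultimately have "(\<integral>\<omega>. \<phi> (v \<omega>) \<partial>Q) = (\<integral>x. \<phi> x * D x \<partial>lborel)"
    using cont[OF \<psi>c] LIMSEQ_unique by auto
  moreover have "real (K choose r) * (\<integral>x. \<phi> x * D x \<partial>lborel) = binomial_tail \<epsilon> (int r - 1) K"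
  proof -
    have "has_bochner_integral lborel (\<lambda>x. real (K choose r) * (\<phi> x * D x)) (binomial_tail \<epsilon> (int r - 1) K)"
    proof (subst has_bochner_integral_cong_AE)
      show "has_bochner_integral lborel
          (\<lambda>x. real (K choose r) * beta_density r x * (1 - x) ^ (K - r) * indicator {\<epsilon>..1} x)
          (binomial_tail \<epsilon> (int r - 1) K)"
        using beta_density_tail r \<epsilon> by auto
      \<comment> \<open>The strict inequality in the event and the closed interval of
        \<open>beta_density_tail\<close> differ only at this point.\<close>
      have "AE x in lborel. x \<noteq> \<epsilon>" by (rule AE_lborel_singleton)
      then show "AE x in lborel. real (K choose r) * (\<phi> x * D x)
          = real (K choose r) * beta_density r x * (1 - x) ^ (K - r) * indicator {\<epsilon>..1} x"
        by eventually_elim (use \<epsilon> in \<open>auto simp: \<phi>_def D_def k_def indicator_def\<close>)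
    qed (use \<phi>m in \<open>auto simp: beta_density_def\<close>)
    then show ?thesis by (auto simp: has_bochner_integral_iff)
  qed
  ultimately show ?thesis unfolding \<phi>_def k_def by simp
qed

section \<open>Regular violation structures\<close>

lemma prob_space_PiM_const: "prob_space Z \<Longrightarrow> prob_space (PiM I (\<lambda>_. Z))"
  by (rule prob_space_PiM)

lemma product_sigma_finite_const: "prob_space Z \<Longrightarrow> product_sigma_finite (\<lambda>_. Z)"
  by (intro product_sigma_finite.intro prob_space_imp_sigma_finite)

text \<open>All that is kept of the optimization problem: a test of one further sample against a
  finite set of samples, such that almost surely exactly one \<open>r\<close>-subset lets all others
  pass. The test sees only the set of sample values, so index sets of equal size are
  interchangeable. Index sets of every size are provided because moments of all orders are
  needed.\<close>

locale violation_structure = Z: prob_space Z for Z :: "'z measure" +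
  fixes viol :: "'z set \<Rightarrow> 'z \<Rightarrow> bool" and I :: "nat \<Rightarrow> 'i set" and r :: nat
  assumes finite_I [simp]: "finite (I m)" and card_I [simp]: "card (I m) = m"
    and viol_measurable: "finite T \<Longrightarrow>
      {p \<in> space (PiM T (\<lambda>_::'i. Z) \<Otimes>\<^sub>M Z). viol (fst p ` T) (snd p)} \<in> sets (PiM T (\<lambda>_. Z) \<Otimes>\<^sub>M Z)"
    and unique_unviolated: "r \<le> m \<Longrightarrow>
      AE \<omega> in PiM (I m) (\<lambda>_. Z). \<exists>!T. T \<subseteq> I m \<and> card T = r \<and> (\<forall>j\<in>I m - T. \<not> viol (\<omega> ` T) (\<omega> j))"
begin

sublocale P: prob_space "PiM J (\<lambda>_. Z)" for J :: "'i set"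
  by (rule prob_space_PiM_const[OF Z.prob_space_axioms])

sublocale prod: product_sigma_finite "\<lambda>_::'i. Z"
  by (rule product_sigma_finite_const[OF Z.prob_space_axioms])

definition unviolated :: "'i set \<Rightarrow> 'i set \<Rightarrow> ('i \<Rightarrow> 'z) \<Rightarrow> bool" where
  "unviolated J T \<omega> \<longleftrightarrow> (\<forall>j\<in>J - T. \<not> viol (\<omega> ` T) (\<omega> j))"

definition vprob :: "'z set \<Rightarrow> real" where
  "vprob A = measure Z {z \<in> space Z. viol A z}"

lemma vprob_bounds: "0 \<le> vprob A" "vprob A \<le> 1"
  by (simp_all add: vprob_def)

lemma viol_section:
  assumes "finite T" "x \<in> space (PiM T (\<lambda>_::'i. Z))"
  shows "{z \<in> space Z. viol (x ` T) z} \<in> sets Z"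
proof -
  have "{z \<in> space Z. viol (x ` T) z}
      = Pair x -` {p \<in> space (PiM T (\<lambda>_::'i. Z) \<Otimes>\<^sub>M Z). viol (fst p ` T) (snd p)}"
    using assms by (auto simp: space_pair_measure)
  then show ?thesis using sets_Pair1[OF viol_measurable[OF assms(1)]] by simp
qed

lemma vprob_measurable [measurable]:
  assumes "finite T"
  shows "(\<lambda>\<omega>. vprob (\<omega> ` T)) \<in> borel_measurable (PiM T (\<lambda>_::'i. Z))"
proof -
  let ?V = "{p \<in> space (PiM T (\<lambda>_::'i. Z) \<Otimes>\<^sub>M Z). viol (fst p ` T) (snd p)}"
  have "(\<lambda>\<omega>. measure Z (Pair \<omega> -` ?V)) \<in> borel_measurable (PiM T (\<lambda>_::'i. Z))"
    unfolding measure_def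
    using Z.measurable_emeasure_Pair[OF viol_measurable[OF assms]] by measurable
  moreover have "Pair \<omega> -` ?V = {z \<in> space Z. viol (\<omega> ` T) z}" if "\<omega> \<in> space (PiM T (\<lambda>_. Z))" for \<omega>
    using that by (auto simp: space_pair_measure)
  ultimately show ?thesis unfolding vprob_def by (simp cong: measurable_cong)
qed

lemma restrict_image_measurable:
  fixes T J :: "'i set"
  assumes "T \<subseteq> J" "finite T"
    and "(\<lambda>\<omega>. g (\<omega> ` T)) \<in> measurable (PiM T (\<lambda>_. Z)) N"
  shows "(\<lambda>\<omega>. g (\<omega> ` T)) \<in> measurable (PiM J (\<lambda>_::'i. Z)) N"
proof -
  have "(\<lambda>\<omega>. g (restrict \<omega> T ` T)) \<in> measurable (PiM J (\<lambda>_::'i. Z)) N"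
    using measurable_compose[OF measurable_restrict_subset[OF assms(1)] assms(3)] by simp
  then show ?thesis by (simp cong: image_cong)
qed

lemma unviolated_measurable [measurable]:
  assumes "T \<subseteq> J" "finite J"
  shows "Measurable.pred (PiM J (\<lambda>_::'i. Z)) (unviolated J T)"
proof -
  have T: "finite T" using assms finite_subset by blast
  have "Measurable.pred (PiM J (\<lambda>_::'i. Z)) (\<lambda>\<omega>. viol (\<omega> ` T) (\<omega> j))" if "j \<in> J - T" for j
  proof -
    have V: "Measurable.pred (PiM T (\<lambda>_::'i. Z) \<Otimes>\<^sub>M Z) (\<lambda>p. viol (fst p ` T) (snd p))"
      using viol_measurable[OF T] by (simp add: pred_def)
    have "(\<lambda>\<omega>. (restrict \<omega> T, \<omega> j)) \<in> measurable (PiM J (\<lambda>_::'i. Z)) (PiM T (\<lambda>_::'i. Z) \<Otimes>\<^sub>M Z)"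
      using that assms by (intro measurable_Pair measurable_restrict_subset measurable_component_singleton) auto
    from measurable_compose[OF this V] show ?thesis by (simp cong: image_cong)
  qed
  then show ?thesis unfolding unviolated_def using assms
    by (intro pred_intros_finite pred_intros_logic) auto
qed

text \<open>Fubini over the samples inside and outside \<open>T\<close>: given those inside, each
  one outside passes independently with probability \<open>1 - vprob\<close>. The weight
  \<open>g\<close> is constant for the moments and an indicator for the tail.\<close>

lemma nn_integral_unviolated:
  assumes J: "finite J" "T \<subseteq> J" and g: "g \<in> borel_measurable borel"
  shows "(\<integral>\<^sup>+\<omega>. g (vprob (\<omega> ` T)) * indicator {\<omega>. unviolated J T \<omega>} \<omega> \<partial>PiM J (\<lambda>_. Z))
    = (\<integral>\<^sup>+\<omega>. g (vprob (\<omega> ` T)) * ennreal ((1 - vprob (\<omega> ` T)) ^ (card J - card T)) \<partial>PiM T (\<lambda>_. Z))"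
proof -
  have T: "finite T" using J finite_subset by blast
  let ?R = "J - T"
  have JT: "T \<union> ?R = J" using J by auto
  have gm: "(\<lambda>\<omega>. g (vprob (\<omega> ` T))) \<in> borel_measurable (PiM J (\<lambda>_::'i. Z))"
    using measurable_compose[OF vprob_measurable[OF T] g]
    by (rule restrict_image_measurable[OF J(2) T, where g="\<lambda>A. g (vprob A)"])
  have um: "{\<omega> \<in> space (PiM J (\<lambda>_::'i. Z)). unviolated J T \<omega>} \<in> sets (PiM J (\<lambda>_::'i. Z))"
    using unviolated_measurable[OF J(2,1)] by (simp add: pred_def)
  have fm: "(\<lambda>\<omega>. g (vprob (\<omega> ` T)) * indicator {\<omega> \<in> space (PiM J (\<lambda>_::'i. Z)). unviolated J T \<omega>} \<omega>)
      \<in> borel_measurable (PiM (T \<union> ?R) (\<lambda>_::'i. Z))"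
    unfolding JT using gm um by measurable
  have "(\<integral>\<^sup>+\<omega>. g (vprob (\<omega> ` T)) * indicator {\<omega>. unviolated J T \<omega>} \<omega> \<partial>PiM J (\<lambda>_. Z))
      = (\<integral>\<^sup>+\<omega>. g (vprob (\<omega> ` T)) * indicator {\<omega> \<in> space (PiM J (\<lambda>_::'i. Z)). unviolated J T \<omega>} \<omega>
          \<partial>PiM (T \<union> ?R) (\<lambda>_. Z))"
    unfolding JT by (intro nn_integral_cong) (auto simp: indicator_def)
  also have "\<dots> = (\<integral>\<^sup>+x. \<integral>\<^sup>+y. g (vprob (merge T ?R (x, y) ` T))
      * indicator {\<omega> \<in> space (PiM J (\<lambda>_::'i. Z)). unviolated J T \<omega>} (merge T ?R (x, y))
      \<partial>PiM ?R (\<lambda>_. Z) \<partial>PiM T (\<lambda>_. Z))"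
    by (rule prod.product_nn_integral_fold[OF _ T _ fm]) (use J in auto)
  also have "\<dots> = (\<integral>\<^sup>+x. g (vprob (x ` T)) * ennreal ((1 - vprob (x ` T)) ^ (card J - card T)) \<partial>PiM T (\<lambda>_. Z))"
  proof (rule nn_integral_cong)
    fix x assume x: "x \<in> space (PiM T (\<lambda>_::'i. Z))"
    let ?N = "{z \<in> space Z. \<not> viol (x ` T) z}"
    have N: "?N \<in> sets Z"
      using sets.Diff[OF sets.top viol_section[OF T x]] by (auto simp: set_diff_eq elim: back_subst[of "\<lambda>A. A \<in> sets Z"])
    have mT: "merge T ?R (x, y) ` T = x ` T" for y
      by (rule image_cong) auto
    have "(\<integral>\<^sup>+y. g (vprob (merge T ?R (x, y) ` T))
      * indicator {\<omega> \<in> space (PiM J (\<lambda>_::'i. Z)). unviolated J T \<omega>} (merge T ?R (x, y)) \<partial>PiM ?R (\<lambda>_. Z))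
      = (\<integral>\<^sup>+y. g (vprob (x ` T)) * indicator (Pi\<^sub>E ?R (\<lambda>_. ?N)) y \<partial>PiM ?R (\<lambda>_. Z))"
    proof (rule nn_integral_cong)
      fix y assume y: "y \<in> space (PiM ?R (\<lambda>_::'i. Z))"
      have "merge T ?R (x, y) \<in> space (PiM J (\<lambda>_::'i. Z))"
        using x y J by (auto simp: space_PiM PiE_def Pi_def extensional_def merge_def)
      moreover have "unviolated J T (merge T ?R (x, y)) \<longleftrightarrow> y \<in> Pi\<^sub>E ?R (\<lambda>_. ?N)"
        using y unfolding unviolated_def mT by (auto simp: space_PiM PiE_def Pi_def)
      ultimately show "g (vprob (merge T ?R (x, y) ` T))
          * indicator {\<omega> \<in> space (PiM J (\<lambda>_::'i. Z)). unviolated J T \<omega>} (merge T ?R (x, y))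
          = g (vprob (x ` T)) * indicator (Pi\<^sub>E ?R (\<lambda>_. ?N)) y"
        unfolding mT by (simp add: indicator_def)
    qed
    also have "\<dots> = g (vprob (x ` T)) * emeasure (PiM ?R (\<lambda>_. Z)) (Pi\<^sub>E ?R (\<lambda>_. ?N))"
      using J N by (intro nn_integral_cmult_indicator sets_PiM_I_finite) auto
    also have "emeasure (PiM ?R (\<lambda>_. Z)) (Pi\<^sub>E ?R (\<lambda>_. ?N)) = ennreal ((1 - vprob (x ` T)) ^ (card J - card T))"
    proof -
      have "emeasure Z ?N = ennreal (1 - vprob (x ` T))"
        using Z.prob_neg[OF viol_section[OF T x]] by (simp add: Z.emeasure_eq_measure vprob_def)
      then show ?thesis
        using J N vprob_bounds[of "x ` T"]
        by (subst prod.emeasure_PiM) (auto simp: card_Diff_subset T ennreal_power)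
    qed
    finally show "(\<integral>\<^sup>+y. g (vprob (merge T ?R (x, y) ` T))
      * indicator {\<omega> \<in> space (PiM J (\<lambda>_::'i. Z)). unviolated J T \<omega>} (merge T ?R (x, y)) \<partial>PiM ?R (\<lambda>_. Z))
      = g (vprob (x ` T)) * ennreal ((1 - vprob (x ` T)) ^ (card J - card T))" .
  qed
  finally show ?thesis .
qed

text \<open>A bijection between the index sets transports the product measure, since all factors are
  equal.\<close>

lemma nn_integral_image_reindex:
  assumes "finite S" "finite T" "card S = card T"
    and g: "(\<lambda>\<omega>. g (\<omega> ` S)) \<in> borel_measurable (PiM S (\<lambda>_::'i. Z))"
  shows "(\<integral>\<^sup>+\<omega>. g (\<omega> ` T) \<partial>PiM T (\<lambda>_. Z)) = (\<integral>\<^sup>+\<omega>. g (\<omega> ` S) \<partial>PiM S (\<lambda>_. Z))"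
proof -
  obtain h where h: "bij_betw h S T" using finite_same_card_bij[OF assms(1-3)] by blast
  let ?t = "\<lambda>\<omega>. \<lambda>n\<in>S. \<omega> (h n)"
  have d: "PiM S (\<lambda>_. Z) = distr (PiM T (\<lambda>_. Z)) (PiM S (\<lambda>_. Z)) ?t"
    using h distr_PiM_reindex[of T "\<lambda>_. Z" h S] Z.prob_space_axioms by (auto simp: bij_betw_def)
  have t: "?t \<in> measurable (PiM T (\<lambda>_. Z)) (PiM S (\<lambda>_. Z))"
    using h by (intro measurable_restrict measurable_component_singleton) (auto simp: bij_betw_def)
  have "(\<integral>\<^sup>+\<omega>. g (\<omega> ` S) \<partial>PiM S (\<lambda>_. Z)) = (\<integral>\<^sup>+\<omega>. g (?t \<omega> ` S) \<partial>PiM T (\<lambda>_. Z))"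
    by (subst d, subst nn_integral_distr[OF t]) (use g in simp_all)
  also have "\<dots> = (\<integral>\<^sup>+\<omega>. g (\<omega> ` T) \<partial>PiM T (\<lambda>_. Z))"
    using h by (intro nn_integral_cong arg_cong[where f=g]) (force simp: bij_betw_def)
  finally show ?thesis ..
qed

lemma nn_integral_unviolated_fixed:
  assumes "T \<subseteq> I m" "card T = r" "g \<in> borel_measurable borel"
  shows "(\<integral>\<^sup>+\<omega>. g (vprob (\<omega> ` T)) * indicator {\<omega>. unviolated (I m) T \<omega>} \<omega> \<partial>PiM (I m) (\<lambda>_. Z))
    = (\<integral>\<^sup>+\<omega>. g (vprob (\<omega> ` I r)) * ennreal ((1 - vprob (\<omega> ` I r)) ^ (m - r)) \<partial>PiM (I r) (\<lambda>_. Z))"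
proof -
  have "finite T" using assms(1) finite_I finite_subset by blast
  moreover have "(\<lambda>\<omega>. g (vprob (\<omega> ` I r)) * ennreal ((1 - vprob (\<omega> ` I r)) ^ (m - r)))
      \<in> borel_measurable (PiM (I r) (\<lambda>_::'i. Z))"
    using vprob_measurable[of "I r"] measurable_compose[OF vprob_measurable[of "I r"] assms(3)] by measurable
  ultimately show ?thesis
    unfolding nn_integral_unviolated[OF finite_I assms(1,3)] card_I assms(2)
    using assms(2)
    by (intro nn_integral_image_reindex[where g="\<lambda>A. g (vprob A) * ennreal ((1 - vprob A) ^ (m - r))"]) auto
qed

text \<open>For \<open>n + r\<close> samples the indicators of \<open>unviolated\<close>, taken over
  the \<open>r\<close>-subsets, sum to 1 almost surely, and they all have the same integral.\<close>

lemma moments: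
  "(\<integral>\<omega>. (1 - vprob (\<omega> ` I r)) ^ n \<partial>PiM (I r) (\<lambda>_. Z)) = 1 / real ((n + r) choose r)"
proof -
  let ?m = "n + r"
  let ?\<T> = "{T. T \<subseteq> I ?m \<and> card T = r}"
  let ?E = "\<integral>\<omega>. (1 - vprob (\<omega> ` I r)) ^ n \<partial>PiM (I r) (\<lambda>_. Z)"
  have fin: "finite ?\<T>" by (rule finite_subset[of _ "Pow (I ?m)"]) auto
  have m: "(\<lambda>\<omega>. (1 - vprob (\<omega> ` I r)) ^ n) \<in> borel_measurable (PiM (I r) (\<lambda>_. Z))"
    using vprob_measurable[of "I r"] by measurable
  have um: "{\<omega> \<in> space (PiM (I ?m) (\<lambda>_::'i. Z)). unviolated (I ?m) T \<omega>} \<in> sets (PiM (I ?m) (\<lambda>_::'i. Z))"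
    if "T \<in> ?\<T>" for T
    using unviolated_measurable[of T "I ?m"] that by (simp add: pred_def)
  have ind: "(\<lambda>\<omega>. indicator {\<omega>. unviolated (I ?m) T \<omega>} \<omega> :: ennreal) \<in> borel_measurable (PiM (I ?m) (\<lambda>_. Z))"
    if "T \<in> ?\<T>" for T
    using borel_measurable_indicator[OF um[OF that]]
    by (rule measurable_cong[THEN iffD1, rotated]) (auto simp: indicator_def)
  have "1 = (\<integral>\<^sup>+\<omega>. 1 \<partial>PiM (I ?m) (\<lambda>_. Z))"
    using P.emeasure_space_1[of "I ?m"] by simp
  also have "\<dots> = (\<integral>\<^sup>+\<omega>. (\<Sum>T\<in>?\<T>. indicator {\<omega>. unviolated (I ?m) T \<omega>} \<omega>) \<partial>PiM (I ?m) (\<lambda>_. Z))"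
  proof (rule nn_integral_cong_AE)
    show "AE \<omega> in PiM (I ?m) (\<lambda>_. Z). (1::ennreal) = (\<Sum>T\<in>?\<T>. indicator {\<omega>. unviolated (I ?m) T \<omega>} \<omega>)"
      using unique_unviolated[OF le_add2[of r n]]
    proof eventually_elim
      case (elim \<omega>)
      then have "\<exists>!T. T \<in> ?\<T> \<and> unviolated (I ?m) T \<omega>"
        by (simp only: unviolated_def mem_Collect_eq conj_assoc)
      then obtain T where T: "T \<in> ?\<T>" "unviolated (I ?m) T \<omega>"
        and T_unique: "\<forall>S. S \<in> ?\<T> \<and> unviolated (I ?m) S \<omega> \<longrightarrow> S = T"
        by (rule ex1E) iprover
      have "(\<Sum>S\<in>?\<T>. indicator {\<omega>. unviolated (I ?m) S \<omega>} \<omega>) = (\<Sum>S\<in>?\<T>. if S = T then 1 else 0::ennreal)"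
      proof (rule sum.cong[OF refl])
        fix S assume "S \<in> ?\<T>"
        with T(2) T_unique have "unviolated (I ?m) S \<omega> \<longleftrightarrow> S = T" by iprover
        then show "indicator {\<omega>. unviolated (I ?m) S \<omega>} \<omega> = (if S = T then 1 else 0::ennreal)"
          by (simp add: indicator_def)
      qed
      then show ?case using T(1) fin by simp
    qed
  qed
  also have "\<dots> = (\<Sum>T\<in>?\<T>. \<integral>\<^sup>+\<omega>. 1 * indicator {\<omega>. unviolated (I ?m) T \<omega>} \<omega> \<partial>PiM (I ?m) (\<lambda>_. Z))"
    using ind by (subst nn_integral_sum) auto
  also have "\<dots> = (\<Sum>T\<in>?\<T>. ennreal ?E)"
  proof (rule sum.cong[OF refl])
    fix T assume "T \<in> ?\<T>"
    then have "(\<integral>\<^sup>+\<omega>. 1 * indicator {\<omega>. unviolated (I ?m) T \<omega>} \<omega> \<partial>PiM (I ?m) (\<lambda>_. Z))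
        = (\<integral>\<^sup>+\<omega>. 1 * ennreal ((1 - vprob (\<omega> ` I r)) ^ n) \<partial>PiM (I r) (\<lambda>_. Z))"
      using nn_integral_unviolated_fixed[of T ?m "\<lambda>_. 1"] by simp
    also have "\<dots> = ennreal ?E"
    proof -
      have "integrable (PiM (I r) (\<lambda>_. Z)) (\<lambda>\<omega>. (1 - vprob (\<omega> ` I r)) ^ n)"
        using m by (intro P.integrable_const_bound[where B = 1]) (auto simp: vprob_bounds power_le_one)
      then show ?thesis
        by (simp add: nn_integral_eq_integral vprob_bounds)
    qed
    finally show "(\<integral>\<^sup>+\<omega>. 1 * indicator {\<omega>. unviolated (I ?m) T \<omega>} \<omega> \<partial>PiM (I ?m) (\<lambda>_. Z)) = ennreal ?E" .
  qed
  also have "\<dots> = ennreal (real (?m choose r) * ?E)"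
    by (simp add: n_subsets ennreal_mult' ennreal_of_nat_eq_real_of_nat)
  finally have "real (?m choose r) * ?E = 1"
    by (metis ennreal_eq_1)
  then show ?thesis by (simp add: field_simps)
qed

text \<open>The singled-out subset is quantified and not chosen, so the event is a finite union of
  pieces whose measurability is immediate.\<close>

definition bad_event :: "nat \<Rightarrow> real \<Rightarrow> ('i \<Rightarrow> 'z) set" where
  "bad_event K \<epsilon> = {\<omega> \<in> space (PiM (I K) (\<lambda>_. Z)).
    \<exists>T. T \<subseteq> I K \<and> card T = r \<and> unviolated (I K) T \<omega> \<and> \<epsilon> < vprob (\<omega> ` T)}"

text \<open>A union bound over the \<open>r\<close>-subsets, which loses nothing because the
  singled-out subset is almost surely unique. The common measure \<open>A\<close> of the pieces is
  the integral that \<open>moments_tail\<close> evaluates.\<close>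

lemma bad_event_bound:
  assumes K: "r \<le> K" and \<epsilon>: "0 < \<epsilon>" "\<epsilon> < 1"
  shows "bad_event K \<epsilon> \<in> sets (PiM (I K) (\<lambda>_. Z))"
    and "measure (PiM (I K) (\<lambda>_. Z)) (bad_event K \<epsilon>) \<le> binomial_tail \<epsilon> (int r - 1) K"
proof -
  let ?P = "PiM (I K) (\<lambda>_. Z)"
  let ?\<T> = "{T. T \<subseteq> I K \<and> card T = r}"
  have fin: "finite ?\<T>" by (rule finite_subset[of _ "Pow (I K)"]) auto
  define B where "B T = {\<omega> \<in> space ?P. unviolated (I K) T \<omega> \<and> \<epsilon> < vprob (\<omega> ` T)}" for T
  have eq: "bad_event K \<epsilon> = (\<Union>T\<in>?\<T>. B T)"
    unfolding bad_event_def B_def by blast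
  have B: "B T \<in> sets ?P" if "T \<in> ?\<T>" for T
  proof -
    have T: "T \<subseteq> I K" "finite T" using that finite_I finite_subset[of T "I K"] by auto
    have "(\<lambda>\<omega>. vprob (\<omega> ` T)) \<in> borel_measurable ?P"
      by (rule restrict_image_measurable[OF T vprob_measurable[OF T(2)]])
    with unviolated_measurable[OF T(1) finite_I] show ?thesis
      unfolding B_def by measurable
  qed
  show "bad_event K \<epsilon> \<in> sets ?P" unfolding eq using fin B by blast
  define A where "A = (\<integral>\<omega>. indicator {\<epsilon><..} (vprob (\<omega> ` I r)) * (1 - vprob (\<omega> ` I r)) ^ (K - r) \<partial>PiM (I r) (\<lambda>_. Z))"
  have mBT: "measure ?P (B T) = A" if T: "T \<in> ?\<T>" for T
  proof -
    have "emeasure ?P (B T) = (\<integral>\<^sup>+\<omega>. indicator (B T) \<omega> \<partial>?P)"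
      using B[OF T] by simp
    also have "\<dots> = (\<integral>\<^sup>+\<omega>. indicator {\<epsilon><..} (vprob (\<omega> ` T)) * indicator {\<omega>. unviolated (I K) T \<omega>} \<omega> \<partial>?P)"
      by (intro nn_integral_cong) (auto simp: B_def indicator_def)
    also have "\<dots> = (\<integral>\<^sup>+\<omega>. indicator {\<epsilon><..} (vprob (\<omega> ` I r)) * ennreal ((1 - vprob (\<omega> ` I r)) ^ (K - r)) \<partial>PiM (I r) (\<lambda>_. Z))"
      using T by (intro nn_integral_unviolated_fixed) auto
    also have "\<dots> = (\<integral>\<^sup>+\<omega>. ennreal (indicator {\<epsilon><..} (vprob (\<omega> ` I r)) * (1 - vprob (\<omega> ` I r)) ^ (K - r)) \<partial>PiM (I r) (\<lambda>_. Z))"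
      by (intro nn_integral_cong) (auto simp: indicator_def)
    also have "\<dots> = ennreal A" unfolding A_def
    proof (rule nn_integral_eq_integral)
      show "integrable (PiM (I r) (\<lambda>_. Z)) (\<lambda>\<omega>. indicator {\<epsilon><..} (vprob (\<omega> ` I r)) * (1 - vprob (\<omega> ` I r)) ^ (K - r))"
        using vprob_measurable[of "I r"]
        by (intro P.integrable_const_bound[where B = 1]) (auto simp: vprob_bounds power_le_one indicator_def)
    qed (auto simp: vprob_bounds)
    finally show ?thesis
      by (simp add: measure_def A_def vprob_bounds integral_nonneg_AE)
  qed
  have "measure ?P (bad_event K \<epsilon>) \<le> (\<Sum>T\<in>?\<T>. measure ?P (B T))"
    unfolding eq using fin B by (intro P.finite_measure_subadditive_finite) auto
  also have "\<dots> = real (K choose r) * A"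
    using mBT by (simp add: n_subsets)
  also have "\<dots> \<le> binomial_tail \<epsilon> (int r - 1) K"
  proof (cases "r = 0")
    \<comment> \<open>For \<open>r = 0\<close> the law has no density but is a point mass at 0: the
      first moment already forces \<open>vprob\<close> to vanish almost surely.\<close>
    case True
    let ?v = "\<lambda>\<omega>. vprob (\<omega> ` I r)"
    have int: "integrable (PiM (I r) (\<lambda>_. Z)) ?v"
      using vprob_measurable[of "I r"] by (intro P.integrable_const_bound[where B = 1]) (auto simp: vprob_bounds)
    have "(\<integral>\<omega>. 1 - ?v \<omega> \<partial>PiM (I r) (\<lambda>_. Z)) = 1" using moments[where n = 1] True by simp
    then have "(\<integral>\<omega>. ?v \<omega> \<partial>PiM (I r) (\<lambda>_. Z)) = 0" using int by (simp add: P.prob_space)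
    then have "AE \<omega> in PiM (I r) (\<lambda>_. Z). ?v \<omega> = 0"
      using int integral_nonneg_eq_0_iff_AE[OF int] by (auto simp: vprob_bounds)
    then have "A = (\<integral>\<omega>. 0 \<partial>PiM (I r) (\<lambda>_. Z))" unfolding A_def
      using vprob_measurable[of "I r"] \<epsilon> by (intro integral_cong_AE) (auto simp: indicator_def)
    then show ?thesis using True binomial_tail_zero[of \<epsilon> K] by simp
  next
    case False
    then show ?thesis unfolding A_def
      using K \<epsilon> vprob_measurable[of "I r"] moments
      by (intro eq_refl[OF moments_tail] P.prob_space_axioms) (auto simp: vprob_bounds)
  qed
  finally show "measure ?P (bad_event K \<epsilon>) \<le> binomial_tail \<epsilon> (int r - 1) K" .
qed

end

section \<open>Genericity and active constraints\<close>

definition strictly_convex :: "('a::real_vector \<Rightarrow> real) \<Rightarrow> bool" where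
  "strictly_convex h \<longleftrightarrow>
    (\<forall>x y t. x \<noteq> y \<longrightarrow> 0 < t \<longrightarrow> t < 1 \<longrightarrow>
      h ((1 - t) *\<^sub>R x + t *\<^sub>R y) < (1 - t) * h x + t * h y)"

lemma strictly_convexD:
  "strictly_convex h \<Longrightarrow> x \<noteq> y \<Longrightarrow> 0 < t \<Longrightarrow> t < 1 \<Longrightarrow>
    h ((1 - t) *\<^sub>R x + t *\<^sub>R y) < (1 - t) * h x + t * h y"
  by (simp add: strictly_convex_def)

definition argmin_on :: "('a \<Rightarrow> real) \<Rightarrow> 'a set \<Rightarrow> 'a" where
  "argmin_on h F = (THE x. x \<in> F \<and> (\<forall>y\<in>F. h x \<le> h y))"

definition feasible_set :: "'a set \<Rightarrow> ('a \<Rightarrow> 'z \<Rightarrow> real) \<Rightarrow> 'z set \<Rightarrow> 'a set" where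
  "feasible_set X G A = {x \<in> X. \<forall>z\<in>A. G x z \<le> 0}"

lemma feasible_set_antimono: "A \<subseteq> B \<Longrightarrow> feasible_set X G B \<subseteq> feasible_set X G A"
  by (auto simp: feasible_set_def)

lemma strictly_convex_imp_convex:
  fixes h :: "'a::real_vector \<Rightarrow> real"
  assumes "strictly_convex h"
  shows "convex_on UNIV h"
proof (rule convex_onI)
  fix t :: real and x y assume "0 < t" "t < 1"
  with assms show "h ((1 - t) *\<^sub>R x + t *\<^sub>R y) \<le> (1 - t) * h x + t * h y"
    by (cases "x = y") (auto simp: strictly_convex_def algebra_simps intro: less_imp_le simp flip: scaleR_left.add)
qed simp

lemma strictly_convex_add_scaled:
  fixes g h :: "'a::real_vector \<Rightarrow> real"
  assumes g: "convex_on UNIV g" and h: "strictly_convex h" and s: "0 < s"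
  shows "strictly_convex (\<lambda>x. g x + s * h x)"
  unfolding strictly_convex_def
proof (intro allI impI)
  fix x y :: 'a and t :: real assume a: "x \<noteq> y" "0 < t" "t < 1"
  have "s * h ((1 - t) *\<^sub>R x + t *\<^sub>R y) < s * ((1 - t) * h x + t * h y)"
    using h a s by (simp add: strictly_convex_def)
  moreover have "g ((1 - t) *\<^sub>R x + t *\<^sub>R y) \<le> (1 - t) * g x + t * g y"
    using convex_onD[OF g, of t x y] a by simp
  ultimately show "g ((1 - t) *\<^sub>R x + t *\<^sub>R y) + s * h ((1 - t) *\<^sub>R x + t *\<^sub>R y)
      < (1 - t) * (g x + s * h x) + t * (g y + s * h y)"
    by (simp add: algebra_simps)
qed

lemma strictly_convex_norm_square:
  "strictly_convex (\<lambda>x :: 'a::real_inner. x \<bullet> x)"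
  unfolding strictly_convex_def
proof (intro allI impI)
  fix x y :: 'a and t :: real assume a: "x \<noteq> y" "0 < t" "t < 1"
  have "(1 - t) * (x \<bullet> x) + t * (y \<bullet> y) - ((1 - t) *\<^sub>R x + t *\<^sub>R y) \<bullet> ((1 - t) *\<^sub>R x + t *\<^sub>R y)
      = t * (1 - t) * ((x - y) \<bullet> (x - y))"
    by (simp add: inner_diff inner_add inner_commute algebra_simps)
  moreover have "0 < t * (1 - t) * ((x - y) \<bullet> (x - y))"
    using a by simp
  ultimately show "((1 - t) *\<^sub>R x + t *\<^sub>R y) \<bullet> ((1 - t) *\<^sub>R x + t *\<^sub>R y)
      < (1 - t) * (x \<bullet> x) + t * (y \<bullet> y)"
    by linarith
qed

lemma convex_on_UNIV_continuous:
  fixes h :: "'a::euclidean_space \<Rightarrow> real"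
  assumes "convex_on UNIV h"
  shows "continuous_on S h"
  using convex_on_continuous[OF open_UNIV assms] continuous_on_subset by blast

lemma convex_sublevel:
  assumes "convex_on UNIV f"
  shows "convex {x. f x \<le> (a::real)}"
proof (rule convexI)
  fix x y and s t :: real
  assume "x \<in> {x. f x \<le> a}" "y \<in> {x. f x \<le> a}" "0 \<le> s" "0 \<le> t" "s + t = 1"
  then show "s *\<^sub>R x + t *\<^sub>R y \<in> {x. f x \<le> a}"
    using convex_lower[OF assms, of x y s t] by auto
qed

lemma strictly_convex_argmin_unique:
  assumes "strictly_convex h" "convex F" "x \<in> F" "y \<in> F" "\<And>w. w \<in> F \<Longrightarrow> h x \<le> h w" "x \<noteq> y"
  shows "h x < h y"
proof -
  have m: "(1 - 1/2) *\<^sub>R x + (1/2) *\<^sub>R y \<in> F"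
    using assms(2-4) by (intro convexD) auto
  have "h ((1 - 1/2) *\<^sub>R x + (1/2) *\<^sub>R y) < (1 - 1/2) * h x + (1/2) * h y"
    using strictly_convexD[OF assms(1,6), of "1/2"] by simp
  with assms(5)[OF m] show ?thesis by simp
qed

lemma argmin_on_eqI:
  assumes "strictly_convex h" "convex F" "x \<in> F" "\<And>y. y \<in> F \<Longrightarrow> h x \<le> h y"
  shows "argmin_on h F = x"
  unfolding argmin_on_def
proof (rule the_equality)
  fix y assume y: "y \<in> F \<and> (\<forall>w\<in>F. h y \<le> h w)"
  show "y = x"
    using strictly_convex_argmin_unique[OF assms(1-3) _ assms(4), of y] y assms(3) by force
qed (use assms in auto)

lemma argmin_on:
  fixes h :: "'a::euclidean_space \<Rightarrow> real"
  assumes "strictly_convex h" "compact F" "convex F" "F \<noteq> {}"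
  shows "argmin_on h F \<in> F" "\<And>y. y \<in> F \<Longrightarrow> h (argmin_on h F) \<le> h y"
    "\<And>y. y \<in> F \<Longrightarrow> y \<noteq> argmin_on h F \<Longrightarrow> h (argmin_on h F) < h y"
proof -
  obtain x where x: "x \<in> F" "\<And>y. y \<in> F \<Longrightarrow> h x \<le> h y"
    using continuous_attains_inf[OF assms(2,4) convex_on_UNIV_continuous[OF strictly_convex_imp_convex[OF assms(1)]]]
    by auto
  have e: "argmin_on h F = x" by (rule argmin_on_eqI[OF assms(1,3) x])
  show "argmin_on h F \<in> F" "\<And>y. y \<in> F \<Longrightarrow> h (argmin_on h F) \<le> h y"
    using x e by auto
  show "h (argmin_on h F) < h y" if "y \<in> F" "y \<noteq> argmin_on h F" for y
    using strictly_convex_argmin_unique[OF assms(1,3) x(1) that(1) x(2)] that e by simp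
qed

text \<open>Existence by repeatedly adding a remaining element of smallest label. Uniqueness by
  exchange: two different such sets would force two distinct elements to have equal labels.\<close>

lemma ex1_least_subset:
  fixes u :: "'z \<Rightarrow> real"
  assumes "finite C" "inj_on u C" "n \<le> card C"
  shows "\<exists>!S. S \<subseteq> C \<and> card S = n \<and> (\<forall>z\<in>C - S. \<forall>t\<in>S. u t \<le> u z)"
proof (rule ex_ex1I)
  show "\<exists>S. S \<subseteq> C \<and> card S = n \<and> (\<forall>z\<in>C - S. \<forall>t\<in>S. u t \<le> u z)"
    using assms(3)
  proof (induction n)
    case (Suc n)
    then obtain S where S: "S \<subseteq> C" "card S = n" "\<forall>z\<in>C - S. \<forall>t\<in>S. u t \<le> u z" by auto
    have fS: "finite S" using S(1) assms(1) finite_subset by blast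
    have "card (C - S) \<noteq> 0" using S Suc.prems fS by (simp add: card_Diff_subset)
    then have "C - S \<noteq> {}" by force
    then obtain s where s: "s \<in> C - S" "\<forall>z\<in>C - S. u s \<le> u z"
      using ex_min_if_finite[of "u ` (C - S)"] assms(1) by (auto simp: not_less)
    show ?case
      using S s fS by (intro exI[of _ "insert s S"]) auto
  qed (auto intro: exI[of _ "{}"])
next
  fix S S'
  assume a: "S \<subseteq> C \<and> card S = n \<and> (\<forall>z\<in>C - S. \<forall>t\<in>S. u t \<le> u z)"
    and b: "S' \<subseteq> C \<and> card S' = n \<and> (\<forall>z\<in>C - S'. \<forall>t\<in>S'. u t \<le> u z)"
  have f: "finite S" "finite S'" using a b assms(1) finite_subset by blast+
  show "S = S'"
  proof (rule ccontr)
    assume "S \<noteq> S'"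
    then obtain t where t: "t \<in> S - S'"
      using card_subset_eq[of S' S] a b f by auto
    obtain z where z: "z \<in> S' - S"
      using card_subset_eq[of S S'] \<open>S \<noteq> S'\<close> a b f by auto
    have "u t \<le> u z" "u z \<le> u t" using a b t z by auto
    then have "t = z" using assms(2) a b t z by (auto simp: inj_on_def)
    then show False using t z by auto
  qed
qed

section \<open>Convex programs: solutions, genericity and active sets\<close>

locale convex_constraints =
  fixes X :: "'a::euclidean_space set" and h :: "'a \<Rightarrow> real" and G :: "'a \<Rightarrow> 'z \<Rightarrow> real"
    and D :: "'z set" and L :: "'a set"
  assumes compact_X: "compact X" and convex_X: "convex X" and strict_h: "strictly_convex h"
    and convex_G: "\<And>z. z \<in> D \<Longrightarrow> convex_on UNIV (\<lambda>x. G x z)"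
    and subspace_L: "subspace L"
    and invariant_G: "\<And>z x \<xi>. z \<in> D \<Longrightarrow> \<xi> \<in> L \<Longrightarrow> G (x + \<xi>) z = G x z"
begin

abbreviation feas :: "'z set \<Rightarrow> 'a set" where "feas \<equiv> feasible_set X G"
abbreviation sol :: "'z set \<Rightarrow> 'a" where "sol A \<equiv> argmin_on h (feas A)"

lemma continuous_G: "z \<in> D \<Longrightarrow> continuous_on S (\<lambda>x. G x z)"
  by (rule convex_on_UNIV_continuous[OF convex_G])

lemma convex_sublevel_G: "z \<in> D \<Longrightarrow> convex {x. G x z \<le> 0}"
  by (rule convex_sublevel[OF convex_G])

lemma feas_eq: "feas A = X \<inter> (\<Inter>z\<in>A. {x. G x z \<le> 0})"
  by (auto simp: feasible_set_def)

lemma convex_feas: "A \<subseteq> D \<Longrightarrow> convex (feas A)"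
  unfolding feas_eq by (intro convex_Int convex_X convex_INT convex_sublevel_G) auto

lemma compact_feas:
  assumes "A \<subseteq> D"
  shows "compact (feas A)"
  unfolding feas_eq
proof (intro compact_Int_closed compact_X closed_INT ballI)
  fix z assume "z \<in> A"
  then have "continuous_on UNIV (\<lambda>x. G x z)" using assms continuous_G by blast
  then show "closed {x. G x z \<le> 0}" by (intro closed_Collect_le) auto
qed

lemma sol:
  assumes "A \<subseteq> D" "feas A \<noteq> {}"
  shows "sol A \<in> feas A" "\<And>y. y \<in> feas A \<Longrightarrow> h (sol A) \<le> h y"
    "\<And>y. y \<in> feas A \<Longrightarrow> y \<noteq> sol A \<Longrightarrow> h (sol A) < h y"
  using argmin_on[OF strict_h compact_feas convex_feas] assms by auto

lemma sol_eqI: "A \<subseteq> D \<Longrightarrow> x \<in> feas A \<Longrightarrow> (\<And>y. y \<in> feas A \<Longrightarrow> h x \<le> h y) \<Longrightarrow> sol A = x"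
  by (rule argmin_on_eqI[OF strict_h convex_feas])

lemma sol_subset:
  assumes "A \<subseteq> B" "B \<subseteq> D" "sol A \<in> feas B"
  shows "sol B = sol A"
proof (rule sol_eqI)
  fix y assume "y \<in> feas B"
  then have "y \<in> feas A" using feasible_set_antimono[OF assms(1), of X G] by blast
  then show "h (sol A) \<le> h y" using sol(2)[of A] assms(1,2) by blast
qed (use assms in auto)

text \<open>Dropping slack constraints cannot help. If \<open>y\<close> were better for
  \<open>A\<close>, a short step from the solution towards \<open>y\<close> would keep the slack
  constraints satisfied by continuity and those in \<open>A\<close> by convexity, while improving
  the objective.\<close>

lemma sol_active:
  assumes B: "finite B" "B \<subseteq> D" "feas B \<noteq> {}" and A: "{z \<in> B. G (sol B) z = 0} \<subseteq> A" "A \<subseteq> B"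
  shows "sol A = sol B"
proof (rule sol_eqI)
  show "A \<subseteq> D" using A B by blast
  let ?x = "sol B"
  show xA: "?x \<in> feas A" using sol(1)[OF B(2,3)] feasible_set_antimono[OF A(2), of X G] by blast
  fix y assume y: "y \<in> feas A"
  show "h ?x \<le> h y"
  proof (rule ccontr)
    assume less: "\<not> h ?x \<le> h y"
    define w where "w t = (1 - t) *\<^sub>R ?x + t *\<^sub>R y" for t :: real
    have slack: "\<forall>\<^sub>F t in at_right 0. G (w t) z \<le> 0" if z: "z \<in> B" for z
    proof (cases "z \<in> A")
      case True
      have "G (w t) z \<le> 0" if "0 < t" "t < 1" for t
        using convexD[OF convex_sublevel_G[of z], of ?x y "1 - t" t] that True y xA B z
        by (auto simp: w_def feasible_set_def)
      then show ?thesis by (auto simp: eventually_at_right_field intro!: exI[of _ 1])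
    next
      case False
      have xB: "G ?x z \<le> 0" using sol(1)[OF B(2,3)] z by (auto simp: feasible_set_def)
      have zD: "z \<in> D" using z B by blast
      have neg: "G (w 0) z < 0" using xB False A z by (force simp: w_def)
      have "continuous_on UNIV (\<lambda>t. G (w t) z)"
        unfolding w_def
        by (rule continuous_on_compose2[OF continuous_G[OF zD, of UNIV]]) (auto intro!: continuous_intros)
      then have "((\<lambda>t. G (w t) z) \<longlongrightarrow> G (w 0) z) (at_right 0)"
        by (auto simp: continuous_on_def intro: tendsto_within_subset)
      from order_tendstoD(2)[OF this neg] show ?thesis by (rule eventually_mono) simp
    qed
    have "\<forall>\<^sub>F t in at_right 0. \<forall>z\<in>B. G (w t) z \<le> 0"
      using B(1) slack by (simp add: eventually_ball_finite_distrib)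
    moreover have "\<forall>\<^sub>F t in at_right (0::real). 0 < t \<and> t < 1"
      by (auto simp: eventually_at_right_field intro!: exI[of _ 1])
    ultimately have "\<forall>\<^sub>F t in at_right 0. (\<forall>z\<in>B. G (w t) z \<le> 0) \<and> 0 < t \<and> t < 1"
      by eventually_elim auto
    then obtain t where t: "\<forall>z\<in>B. G (w t) z \<le> 0" "0 < t" "t < 1"
      using eventually_happens[of _ "at_right (0::real)"] trivial_limit_at_right_real by blast
    have "w t \<in> X" unfolding w_def
      using t xA y by (intro convexD[OF convex_X]) (auto simp: feasible_set_def)
    then have "w t \<in> feas B" using t by (auto simp: feasible_set_def)
    then have "h ?x \<le> h (w t)" by (rule sol(2)[OF B(2,3)])
    also have "\<dots> \<le> (1 - t) * h ?x + t * h y"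
      using convex_onD[OF strictly_convex_imp_convex[OF strict_h], of t ?x y] t by (simp add: w_def)
    finally have "t * h ?x \<le> t * h y" by (simp add: algebra_simps)
    then show False using less t by simp
  qed
qed

definition generic :: "'z set \<Rightarrow> bool" where
  "generic B \<longleftrightarrow> finite B \<and> B \<subseteq> D \<and> feas B \<noteq> {} \<and> (\<forall>T\<subseteq>B. \<forall>z\<in>B - T. G (sol T) z \<noteq> 0)"

text \<open>Genericity says that a constraint omitted by \<open>T\<close> is not tight at
  \<open>sol T\<close>; the converse is \<open>sol_active\<close>. Hence the active set is the least
  subset with the same solution.\<close>

lemma generic_sol_eq_iff:
  assumes "generic B" "T \<subseteq> B"
  shows "sol T = sol B \<longleftrightarrow> {z \<in> B. G (sol B) z = 0} \<subseteq> T"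
proof
  assume eq: "sol T = sol B"
  have "G (sol T) z \<noteq> 0" if "z \<in> B - T" for z
    using assms that unfolding generic_def by blast
  then show "{z \<in> B. G (sol B) z = 0} \<subseteq> T" unfolding eq by blast
next
  assume "{z \<in> B. G (sol B) z = 0} \<subseteq> T"
  then show "sol T = sol B" using sol_active[of B T] assms by (simp add: generic_def)
qed

text \<open>
  If the active set were too large, a Radon point of the solutions without one active constraint,
  taken modulo the invariant subspace, would be feasible with a smaller objective.
\<close>

lemma card_active:
  assumes gen: "generic B"
  shows "card {z \<in> B. G (sol B) z = 0} \<le> DIM('a) - dim L"
proof (rule ccontr)
  define S where "S = {z \<in> B. G (sol B) z = 0}"
  assume "\<not> card {z \<in> B. G (sol B) z = 0} \<le> DIM('a) - dim L"
  then have big: "DIM('a) - dim L + 1 \<le> card S" unfolding S_def by simp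
  have SB: "S \<subseteq> B" and finS: "finite S" and SD: "S \<subseteq> D"
    using gen unfolding S_def generic_def by (auto intro: finite_subset)
  have feas_sub: "feas T \<noteq> {}" if "T \<subseteq> B" for T
    using gen feasible_set_antimono[OF that, of X G] unfolding generic_def by blast
  let ?x = "sol S"
  have solS: "?x = sol B" using generic_sol_eq_iff[OF gen SB] by (simp add: S_def)
  have x0: "G ?x z = 0" if "z \<in> S" for z using that solS by (simp add: S_def)
  \<comment> \<open>Omitting the single constraint \<open>t\<close> strictly improves the objective,
    and the new solution violates \<open>t\<close> but no other member of \<open>S\<close>.\<close>
  define y where "y t = sol (S - {t})" for t
  have y_feas: "y t \<in> X" "\<And>s. s \<in> S \<Longrightarrow> s \<noteq> t \<Longrightarrow> G (y t) s \<le> 0" for t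
    using sol(1)[of "S - {t}"] feas_sub[of "S - {t}"] SB SD unfolding y_def
    by (auto simp: feasible_set_def)
  have xS: "?x \<in> feas S" using sol(1)[OF SD feas_sub[OF SB]] .
  have hy: "h (y t) < h ?x" and Gy: "0 < G (y t) t" if t: "t \<in> S" for t
  proof -
    have nz: "G (y t) t \<noteq> 0" using gen t SB unfolding generic_def y_def by blast
    then have "?x \<noteq> y t" using x0[OF t] by auto
    moreover have "?x \<in> feas (S - {t})" using xS by (auto simp: feasible_set_def)
    ultimately show less: "h (y t) < h ?x"
      using sol(3)[of "S - {t}" ?x] feas_sub[of "S - {t}"] SB SD unfolding y_def by blast
    show "0 < G (y t) t"
    proof (rule ccontr)
      assume "\<not> 0 < G (y t) t"
      then have "y t \<in> feas S" using y_feas(2)[of _ t] y_feas(1)[of t] by (force simp: feasible_set_def)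
      then show False using sol(2)[OF SD feas_sub[OF SB], of "y t"] less by simp
    qed
  qed
  \<comment> \<open>The orthogonal complement of \<open>L\<close> stands for the quotient. The
    projection \<open>p\<close> onto it preserves all constraint values, though it may lead out of
    \<open>X\<close>.\<close>
  define W where "W = {v :: 'a. v \<in> UNIV \<and> (\<forall>l\<in>L. orthogonal l v)}"
  have dimW: "dim W + dim L = DIM('a)"
    using dim_subspace_orthogonal_to_vectors[OF subspace_L subspace_UNIV] by (simp add: W_def)
  have "\<exists>p. p \<in> W \<and> v - p \<in> L" for v
  proof -
    obtain l p where "l \<in> span L" "\<And>w. w \<in> span L \<Longrightarrow> orthogonal p w" "v = l + p"
      using orthogonal_subspace_decomp_exists[of L v] by blast
    then have "p \<in> W" "v - p \<in> L"
      using subspace_L by (auto simp: W_def orthogonal_commute span_eq_iff[THEN iffD2])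
    then show ?thesis by blast
  qed
  then obtain p where p: "\<And>v. p v \<in> W" "\<And>v. v - p v \<in> L" by metis
  have Gp: "G (p v) z = G v z" if "z \<in> D" for v z
    using invariant_G[OF that p(2)[of v], of "p v"] by simp
  \<comment> \<open>The constraint values survive the projection and tell the points apart:
    \<open>y s\<close> violates \<open>s\<close>, while \<open>y t\<close> satisfies it.\<close>
  have injp: "inj_on (\<lambda>t. p (y t)) S"
  proof (rule inj_onI, rule ccontr)
    fix s t assume st: "s \<in> S" "t \<in> S" "p (y s) = p (y t)" "s \<noteq> t"
    have "G (y s) s = G (y t) s" using st(3) Gp[of s] st(1) SD by (metis subsetD)
    then show False using y_feas(2)[OF st(1,4)] Gy[OF st(1)] by simp
  qed
  have p0: "p ?x \<notin> (\<lambda>t. p (y t)) ` S"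
  proof
    assume "p ?x \<in> (\<lambda>t. p (y t)) ` S"
    then obtain t where t: "t \<in> S" "p ?x = p (y t)" by blast
    then have "G ?x t = G (y t) t" using Gp SD by (metis subsetD)
    then show False using Gy[OF t(1)] x0[OF t(1)] by simp
  qed
  \<comment> \<open>There are \<open>card S + 1\<close> points in a space of dimension
    \<open>dim W\<close>, at least two more than the dimension, as Radon's theorem requires.\<close>
  define C where "C = insert (p ?x) ((\<lambda>t. p (y t)) ` S)"
  have finC: "finite C" using finS by (simp add: C_def)
  have "card C = card S + 1" using p0 finS card_image[OF injp] by (simp add: C_def)
  moreover have "dim C \<le> dim W" using p by (intro dim_subset) (auto simp: C_def)
  ultimately have "dim C + 2 \<le> card C" using big dimW by linarith
  then have "affine_dependent C" by (rule affine_dependent_biggerset_general[OF finC])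
  from Radon_partition[OF finC this] obtain M P where MP: "M \<inter> P = {}" "M \<union> P = C" "(convex hull M) \<inter> (convex hull P) \<noteq> {}"
    by (elim exE conjE) (rule that)
  \<comment> \<open>\<open>M\<close> is the Radon part without the projected solution, so it
    consists of projections of strictly better points. The common point \<open>q\<close> satisfies
    each \<open>s\<close> in \<open>S\<close>: if \<open>y s\<close> projects into \<open>M\<close>,
    all of \<open>P\<close> satisfies \<open>s\<close>, and otherwise all of \<open>M\<close>
    does.\<close>
  have no: False if MP: "M \<inter> P = {}" "M \<union> P = C" "q \<in> convex hull M" "q \<in> convex hull P" "p ?x \<in> P" for M P q
  proof -
    define J where "J = {t \<in> S. p (y t) \<in> M}"
    have MS: "\<exists>t\<in>S. v = p (y t)" if "v \<in> M" for v
    proof -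
      have "v \<in> C" "v \<noteq> p ?x" using that MP(1,2,5) by auto
      then show ?thesis by (auto simp: C_def)
    qed
    have MJ: "\<exists>t\<in>J. v = p (y t)" if "v \<in> M" for v
      using MS[OF that] that by (auto simp: J_def)
    have PJ: "v = p ?x \<or> (\<exists>t\<in>S - J. v = p (y t))" if "v \<in> P" for v
    proof -
      have "v \<in> C" "v \<notin> M" using that MP(1,2) by auto
      then show ?thesis by (auto simp: C_def J_def)
    qed
    \<comment> \<open>Points that agree modulo \<open>L\<close> with a point of \<open>X\<close> of
      smaller objective. Since this set is convex, it contains \<open>q\<close>, which can therefore
      be lifted to such a point of \<open>X\<close> with the same constraint values.\<close>
    define Q where "Q = {v. \<exists>v'\<in>X. h v' < h ?x \<and> v' - v \<in> L}"
    have "convex Q"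
    proof (rule convexI)
      fix a b and s t :: real assume "a \<in> Q" "b \<in> Q" and st: "0 \<le> s" "0 \<le> t" "s + t = 1"
      then obtain a' b' where ab: "a' \<in> X" "h a' < h ?x" "a' - a \<in> L" "b' \<in> X" "h b' < h ?x" "b' - b \<in> L"
        unfolding Q_def by blast
      show "s *\<^sub>R a + t *\<^sub>R b \<in> Q" unfolding Q_def
      proof (intro CollectI bexI conjI)
        show "s *\<^sub>R a' + t *\<^sub>R b' \<in> X" using ab st by (intro convexD[OF convex_X])
        have "h (s *\<^sub>R a' + t *\<^sub>R b') \<le> s * h a' + t * h b'"
          using strictly_convex_imp_convex[OF strict_h] st by (auto simp: convex_on_def)
        also have "\<dots> < h ?x" using ab(2,5) st convex_bound_lt by blast
        finally show "h (s *\<^sub>R a' + t *\<^sub>R b') < h ?x" .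
        have "s *\<^sub>R a' + t *\<^sub>R b' - (s *\<^sub>R a + t *\<^sub>R b) = s *\<^sub>R (a' - a) + t *\<^sub>R (b' - b)"
          by (simp add: algebra_simps)
        also have "\<dots> \<in> L" using ab by (intro subspace_add subspace_scale subspace_L)
        finally show "s *\<^sub>R a' + t *\<^sub>R b' - (s *\<^sub>R a + t *\<^sub>R b) \<in> L" .
      qed
    qed
    moreover have "M \<subseteq> Q"
    proof
      fix v assume "v \<in> M"
      then obtain t where "t \<in> S" "v = p (y t)" using MS by auto
      then show "v \<in> Q" using y_feas(1)[of t] hy[of t] p(2)[of "y t"] by (auto simp: Q_def)
    qed
    ultimately have "q \<in> Q" using MP(3) hull_minimal[of M Q convex] by auto
    then obtain q' where q': "q' \<in> X" "h q' < h ?x" "q' - q \<in> L" unfolding Q_def by blast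
    have "G q s \<le> 0" if s: "s \<in> S" for s
    proof -
      have sD: "s \<in> D" using s SD by auto
      have cs: "convex {x. G x s \<le> 0}" using sD by (rule convex_sublevel_G)
      show ?thesis
      proof (cases "s \<in> J")
        case True
        have "P \<subseteq> {x. G x s \<le> 0}"
        proof
          fix v assume "v \<in> P"
          then consider "v = p ?x" | t where "t \<in> S - J" "v = p (y t)" using PJ[of v] by auto
          then show "v \<in> {x. G x s \<le> 0}"
          proof cases
            case 1
            then show ?thesis using x0[OF s] Gp[OF sD] by simp
          next
            case (2 t)
            then have "s \<noteq> t" using True by auto
            then show ?thesis using y_feas(2)[OF s, of t] Gp[OF sD] 2 by simp
          qed
        qed
        then show ?thesis using MP(4) hull_minimal[of P "{x. G x s \<le> 0}" convex] cs by auto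
      next
        case False
        have "M \<subseteq> {x. G x s \<le> 0}"
        proof
          fix v assume "v \<in> M"
          then obtain t where t: "t \<in> J" "v = p (y t)" using MJ by auto
          then have "s \<noteq> t" using False by auto
          then show "v \<in> {x. G x s \<le> 0}" using y_feas(2)[OF s, of t] Gp[OF sD] t by simp
        qed
        then show ?thesis using MP(3) hull_minimal[of M "{x. G x s \<le> 0}" convex] cs by auto
      qed
    qed
    moreover have "G q' s = G q s" if "s \<in> S" for s
      using invariant_G[OF _ q'(3), of s q] that SD by auto
    ultimately have "q' \<in> feas S" using q'(1) by (auto simp: feasible_set_def)
    then show False using sol(2)[OF SD feas_sub[OF SB], of q'] q'(2) by simp
  qed
  obtain q where q: "q \<in> convex hull M" "q \<in> convex hull P" using MP(3) by auto
  have "p ?x \<in> M \<union> P" unfolding MP(2) by (simp add: C_def)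
  then show False
  proof
    assume "p ?x \<in> P"
    then show False using no[OF MP(1,2) q] by simp
  next
    assume "p ?x \<in> M"
    moreover have "P \<inter> M = {}" "P \<union> M = C" using MP(1,2) by auto
    ultimately show False using no[OF _ _ q(2,1)] by simp
  qed
qed

text \<open>
  Slack members of \<open>A\<close> only pad the active set to a prescribed cardinality; a padded set is
  selected by having the smallest labels \<open>u\<close>.
\<close>

definition padded_viol :: "('z \<Rightarrow> real) \<Rightarrow> 'z set \<Rightarrow> 'z \<Rightarrow> bool" where
  "padded_viol u A z \<longleftrightarrow> 0 < G (sol A) z \<or> (\<exists>t\<in>A. G (sol A) t < 0 \<and> u z < u t)"

text \<open>If all remaining samples pass, \<open>sol A = sol B\<close>, so the active set lies in
  \<open>A\<close>; the label condition then makes the rest of \<open>A\<close> the slack samples of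
  smallest label. By \<open>card_active\<close> there is room for the active set, and
  \<open>ex1_least_subset\<close> supplies the padding.\<close>

lemma ex1_unviolated:
  assumes gen: "generic B" and u: "inj_on u B" and B: "DIM('a) - dim L \<le> card B"
  shows "\<exists>!A. A \<subseteq> B \<and> card A = DIM('a) - dim L \<and> (\<forall>z\<in>B - A. \<not> padded_viol u A z)"
proof -
  let ?r = "DIM('a) - dim L"
  define S where "S = {z \<in> B. G (sol B) z = 0}"
  have BD: "B \<subseteq> D" "finite B" "feas B \<noteq> {}" using gen by (auto simp: generic_def)
  have SB: "S \<subseteq> B" by (auto simp: S_def)
  then have fS: "finite S" using BD finite_subset by blast
  have cS: "card S \<le> ?r" using card_active[OF gen] by (simp add: S_def)
  have Gneg: "G (sol B) z < 0" if "z \<in> B - S" for z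
    using sol(1)[OF BD(1,3)] that by (force simp: S_def feasible_set_def)
  have key: "(\<forall>z\<in>B - A. \<not> padded_viol u A z) \<longleftrightarrow>
      S \<subseteq> A \<and> (\<forall>z\<in>(B - S) - (A - S). \<forall>t\<in>A - S. u t \<le> u z)" if A: "A \<subseteq> B" for A
  proof
    have AD: "A \<subseteq> D" "feas A \<noteq> {}" using A BD feasible_set_antimono[OF A, of X G] by blast+
    assume v: "\<forall>z\<in>B - A. \<not> padded_viol u A z"
    then have "G (sol A) z \<le> 0" if "z \<in> B" for z
      using that sol(1)[OF AD] by (cases "z \<in> A") (force simp: padded_viol_def feasible_set_def)+
    then have "sol A \<in> feas B" using sol(1)[OF AD] by (auto simp: feasible_set_def)
    then have eq: "sol A = sol B" using sol_subset[OF A BD(1)] by simp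
    then have SA: "S \<subseteq> A" using generic_sol_eq_iff[OF gen A] by (simp add: S_def)
    moreover have "u t \<le> u z" if "z \<in> (B - S) - (A - S)" "t \<in> A - S" for z t
      using v Gneg[of t] that A eq SA unfolding padded_viol_def by force
    ultimately show "S \<subseteq> A \<and> (\<forall>z\<in>(B - S) - (A - S). \<forall>t\<in>A - S. u t \<le> u z)" by blast
  next
    assume a: "S \<subseteq> A \<and> (\<forall>z\<in>(B - S) - (A - S). \<forall>t\<in>A - S. u t \<le> u z)"
    then have eq: "sol A = sol B" using generic_sol_eq_iff[OF gen A] by (simp add: S_def)
    show "\<forall>z\<in>B - A. \<not> padded_viol u A z"
    proof
      fix z assume z: "z \<in> B - A"
      have "G (sol B) z \<le> 0" using sol(1)[OF BD(1,3)] z by (auto simp: feasible_set_def)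
      moreover have "u t \<le> u z" if "t \<in> A" "G (sol B) t < 0" for t
      proof -
        have "t \<in> A - S" "z \<in> (B - S) - (A - S)" using that z a by (auto simp: S_def)
        then show ?thesis using a by blast
      qed
      ultimately show "\<not> padded_viol u A z" unfolding padded_viol_def eq by (metis not_less)
    qed
  qed
  have "inj_on u (B - S)" using u by (rule inj_on_subset) auto
  moreover have "?r - card S \<le> card (B - S)" using B fS SB by (simp add: card_Diff_subset)
  ultimately have "\<exists>!R. R \<subseteq> B - S \<and> card R = ?r - card S \<and> (\<forall>z\<in>(B - S) - R. \<forall>t\<in>R. u t \<le> u z)"
    using BD(2) by (intro ex1_least_subset) auto
  then obtain R where R: "R \<subseteq> B - S" "card R = ?r - card S" "\<forall>z\<in>(B - S) - R. \<forall>t\<in>R. u t \<le> u z"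
    and R_unique: "\<And>R'. R' \<subseteq> B - S \<Longrightarrow> card R' = ?r - card S \<Longrightarrow> (\<forall>z\<in>(B - S) - R'. \<forall>t\<in>R'. u t \<le> u z) \<Longrightarrow> R' = R"
    by (elim ex1E) metis
  have fR: "finite R" using R(1) BD(2) finite_subset by blast
  show ?thesis
  proof (rule ex1I[of _ "S \<union> R"])
    have "S \<union> R - S = R" using R(1) by blast
    then have "\<forall>z\<in>B - (S \<union> R). \<not> padded_viol u (S \<union> R) z"
      using key[of "S \<union> R"] SB R by auto
    moreover have "card (S \<union> R) = ?r"
      using R cS fS fR by (subst card_Un_disjoint) auto
    ultimately show "S \<union> R \<subseteq> B \<and> card (S \<union> R) = ?r \<and> (\<forall>z\<in>B - (S \<union> R). \<not> padded_viol u (S \<union> R) z)"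
      using SB R by blast
  next
    fix A assume A: "A \<subseteq> B \<and> card A = ?r \<and> (\<forall>z\<in>B - A. \<not> padded_viol u A z)"
    then have k: "S \<subseteq> A" "\<forall>z\<in>(B - S) - (A - S). \<forall>t\<in>A - S. u t \<le> u z" using key[of A] by auto
    then have "A - S = R" using A fS by (intro R_unique) (auto simp: card_Diff_subset)
    then show "A = S \<union> R" using k(1) by blast
  qed
qed

lemma unviolated_sol_eq:
  assumes gen: "generic B" and A: "A \<subseteq> B" "\<forall>z\<in>B - A. \<not> padded_viol u A z"
  shows "sol A = sol B"
proof -
  have AD: "A \<subseteq> D" "B \<subseteq> D" "feas A \<noteq> {}"
    using A(1) gen feasible_set_antimono[OF A(1), of X G] unfolding generic_def by blast+
  have "G (sol A) z \<le> 0" if "z \<in> B" for z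
    using that A(2) sol(1)[OF AD(1,3)] by (cases "z \<in> A") (force simp: padded_viol_def feasible_set_def)+
  then have "sol A \<in> feas B" using sol(1)[OF AD(1,3)] by (auto simp: feasible_set_def)
  then show ?thesis using sol_subset[OF A(1) AD(2)] by simp
qed

end

section \<open>Measurability of constrained minimizers\<close>

text \<open>Simple functions approximating \<open>x\<close> take finitely many values, so the
  composition is measurable for each of them; continuity in the first argument passes to the
  limit.\<close>

lemma borel_measurable_caratheodory:
  fixes g :: "'a::{metric_space, second_countable_topology} \<Rightarrow> 'w \<Rightarrow> real"
  assumes x: "x \<in> borel_measurable N" and g: "\<And>q. g q \<in> borel_measurable N"
    and c: "\<And>w. w \<in> space N \<Longrightarrow> continuous_on UNIV (\<lambda>q. g q w)"
  shows "(\<lambda>w. g (x w) w) \<in> borel_measurable N"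
proof -
  obtain F where F: "\<And>i. simple_function N (F i)" "\<And>w. w \<in> space N \<Longrightarrow> (\<lambda>i. F i w) \<longlonglongrightarrow> x w"
    using borel_measurable_implies_sequence_metric[OF x] by blast
  show ?thesis
  proof (rule borel_measurable_LIMSEQ_metric)
    show "(\<lambda>i. g (F i w) w) \<longlonglongrightarrow> g (x w) w" if "w \<in> space N" for w
      using c[OF that] F(2)[OF that] continuous_on_tendsto_compose[of UNIV "\<lambda>q. g q w"] by auto
    show "(\<lambda>w. g (F i w) w) \<in> borel_measurable N" for i
    proof (rule measurable_compose_countable'[where f=g and g="F i" and I="F i ` space N"])
      show "countable (F i ` space N)"
        using F(1)[of i] by (auto simp: simple_function_def countable_finite)
      show "F i \<in> measurable N (count_space (F i ` space N))"
        using F(1)[of i] measurable_simple_function by (auto simp: measurable_def simple_function_def)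
    qed (rule g)
  qed
qed

text \<open>The uncountable existential over \<open>C\<close> becomes one over a countable dense
  subset, with tolerance \<open>1 / real (Suc n)\<close> for every \<open>n\<close>: by compactness
  the approximate solutions have a cluster point, which is an exact one.\<close>

lemma sets_ex_sublevel:
  fixes g :: "'j \<Rightarrow> 'a::{metric_space, second_countable_topology} \<Rightarrow> 'w \<Rightarrow> real"
  assumes C: "compact C" and T: "finite T" and g: "\<And>j q. j \<in> T \<Longrightarrow> g j q \<in> borel_measurable N"
    and c: "\<And>j w. j \<in> T \<Longrightarrow> w \<in> space N \<Longrightarrow> continuous_on UNIV (\<lambda>q. g j q w)"
  shows "{w \<in> space N. \<exists>q\<in>C. \<forall>j\<in>T. g j q w \<le> 0} \<in> sets N"
proof -
  obtain C0 where C0: "countable C0" "C0 \<subseteq> C" "C \<subseteq> closure C0"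
    using separable[of C] by blast
  have "{w \<in> space N. \<exists>q\<in>C. \<forall>j\<in>T. g j q w \<le> 0}
      = {w \<in> space N. \<forall>n::nat. \<exists>q\<in>C0. \<forall>j\<in>T. g j q w < 1 / real (Suc n)}"
  proof (intro Collect_cong conj_cong refl iffI allI)
    fix w and n :: nat
    assume w: "w \<in> space N" and "\<exists>q\<in>C. \<forall>j\<in>T. g j q w \<le> 0"
    then obtain q where q: "q \<in> C" "\<forall>j\<in>T. g j q w \<le> 0" by blast
    have "open (\<Inter>j\<in>T. {q. g j q w < 1 / real (Suc n)})"
      using T c w by (intro open_INT ballI open_Collect_less) auto
    moreover have "q \<in> (\<Inter>j\<in>T. {q. g j q w < 1 / real (Suc n)})"
    proof (intro INT_I CollectI)
      fix j assume "j \<in> T"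
      then have "g j q w \<le> 0" using q by blast
      also have "0 < 1 / real (Suc n)" by simp
      finally show "g j q w < 1 / real (Suc n)" .
    qed
    ultimately have "(\<Inter>j\<in>T. {q. g j q w < 1 / real (Suc n)}) \<inter> C0 \<noteq> {}"
      using q(1) C0(3) open_Int_closure_eq_empty by blast
    then show "\<exists>q\<in>C0. \<forall>j\<in>T. g j q w < 1 / real (Suc n)" by blast
  next
    fix w assume w: "w \<in> space N" and "\<forall>n::nat. \<exists>q\<in>C0. \<forall>j\<in>T. g j q w < 1 / real (Suc n)"
    then obtain q where q: "\<And>n. q n \<in> C0" "\<And>n j. j \<in> T \<Longrightarrow> g j (q n) w < 1 / real (Suc n)" by metis
    obtain l s where l: "l \<in> C" "strict_mono (s :: nat \<Rightarrow> nat)" "(q \<circ> s) \<longlonglongrightarrow> l"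
      using C q(1) C0(2) unfolding compact_eq_seq_compact_metric seq_compact_def by (metis subsetD)
    have "g j l w \<le> 0" if j: "j \<in> T" for j
    proof (rule LIMSEQ_le)
      show "(\<lambda>n. g j ((q \<circ> s) n) w) \<longlonglongrightarrow> g j l w"
        using continuous_on_tendsto_compose[OF c[OF j w] l(3)] by simp
      show "(\<lambda>n. 1 / real (Suc (s n))) \<longlonglongrightarrow> 0"
        using LIMSEQ_subseq_LIMSEQ[OF LIMSEQ_Suc[OF lim_1_over_n] l(2)] by (simp add: comp_def)
      show "\<exists>n0. \<forall>n\<ge>n0. g j ((q \<circ> s) n) w \<le> 1 / real (Suc (s n))"
        using q(2)[OF j] by (auto intro: less_imp_le)
    qed
    then show "\<exists>q\<in>C. \<forall>j\<in>T. g j q w \<le> 0" using l(1) by blast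
  qed
  also have "\<dots> \<in> sets N"
  proof -
    have "(\<lambda>w. g j q w) \<in> borel_measurable N" if "j \<in> T" for j q using g[OF that] .
    then have "Measurable.pred N (\<lambda>w. \<forall>j\<in>T. g j q w < 1 / real (Suc n))" for q n
      using T by (intro pred_intros_finite) auto
    then have "Measurable.pred N (\<lambda>w. \<forall>n::nat. \<exists>q\<in>C0. \<forall>j\<in>T. g j q w < 1 / real (Suc n))"
      using C0(1) by (intro pred_intros_countable pred_intros_countable_bounded) auto
    then show ?thesis by (simp add: pred_def)
  qed
  finally show ?thesis .
qed

lemma borel_measurable_argmin_on:
  fixes X :: "'a::euclidean_space set" and g :: "'j \<Rightarrow> 'a \<Rightarrow> 'w \<Rightarrow> real"
  assumes X: "compact X" "convex X" and h: "strictly_convex h" and T: "finite T"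
    and g: "\<And>j q. j \<in> T \<Longrightarrow> g j q \<in> borel_measurable N"
    and cv: "\<And>j w. j \<in> T \<Longrightarrow> w \<in> space N \<Longrightarrow> convex_on UNIV (\<lambda>q. g j q w)"
  shows "(\<lambda>w. argmin_on h {q \<in> X. \<forall>j\<in>T. g j q w \<le> 0}) \<in> borel_measurable N"
proof (rule borel_measurableI)
  define F where "F w = {q \<in> X. \<forall>j\<in>T. g j q w \<le> 0}" for w
  define s where "s w = argmin_on h (F w)" for w
  fix S :: "'a set" assume S: "open S"
  have c: "continuous_on UNIV (\<lambda>q. g j q w)" if "j \<in> T" "w \<in> space N" for j w
    using convex_on_UNIV_continuous[OF cv[OF that]] .
  have hc: "continuous_on UNIV h"
    by (rule convex_on_UNIV_continuous[OF strictly_convex_imp_convex[OF h]])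
  define E where "E C = {w \<in> space N. \<exists>q\<in>C. \<forall>j\<in>T. g j q w \<le> 0}" for C
  have E: "E C \<in> sets N" if "compact C" for C
    unfolding E_def by (rule sets_ex_sublevel[OF that T g c])
  have Fw: "compact (F w)" "convex (F w)" if w: "w \<in> space N" for w
  proof -
    have Feq: "F w = X \<inter> (\<Inter>j\<in>T. {q. g j q w \<le> 0})" by (auto simp: F_def)
    show "compact (F w)" unfolding Feq
      using c w by (intro compact_Int_closed X closed_INT ballI closed_Collect_le) auto
    show "convex (F w)" unfolding Feq
      using cv w by (intro convex_Int X convex_INT convex_sublevel) auto
  qed
  define X' where "X' a = X \<inter> {q. h q \<le> a}" for a
  have X': "compact (X' a)" "compact (X' a - S)" for a
  proof -
    show "compact (X' a)" unfolding X'_def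
      using hc by (intro compact_Int_closed X closed_Collect_le) auto
    then show "compact (X' a - S)" using S by (rule compact_diff)
  qed
  \<comment> \<open>On the feasible event the minimizer avoids the open set \<open>S\<close> iff
    each rational sublevel set of \<open>h\<close> that meets the feasible set also meets it outside
    \<open>S\<close>. Removing an open set keeps \<open>X' a - S\<close> compact, so both conditions
    are covered by \<open>E\<close>.\<close>
  have "s -` (- S) \<inter> E X = E X \<inter> (\<Inter>a\<in>\<rat>. (space N - E (X' a)) \<union> E (X' a - S))"
  proof (intro set_eqI iffI)
    fix w assume w: "w \<in> s -` (- S) \<inter> E X"
    then have wN: "w \<in> space N" and ne: "F w \<noteq> {}" by (auto simp: E_def F_def)
    note m = argmin_on[OF h Fw[OF wN] ne, folded s_def]
    have "w \<in> E (X' a - S)" if wa: "w \<in> E (X' a)" for a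
    proof -
      obtain q where "q \<in> F w" "h q \<le> a" using wa by (auto simp: E_def F_def X'_def)
      then have "h (s w) \<le> a" using m(2) by force
      then show ?thesis using m(1) w wN by (auto simp: E_def F_def X'_def)
    qed
    then show "w \<in> E X \<inter> (\<Inter>a\<in>\<rat>. (space N - E (X' a)) \<union> E (X' a - S))" using w wN by blast
  next
    fix w assume w: "w \<in> E X \<inter> (\<Inter>a\<in>\<rat>. (space N - E (X' a)) \<union> E (X' a - S))"
    then have wN: "w \<in> space N" and ne: "F w \<noteq> {}" by (auto simp: E_def F_def)
    note m = argmin_on[OF h Fw[OF wN] ne, folded s_def]
    have ex: "\<exists>q\<in>F w - S. h q \<le> a" if a: "a \<in> \<rat>" "h (s w) < a" for a
    proof -
      have "w \<in> E (X' a)" using m(1) wN a by (auto simp: E_def F_def X'_def)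
      then have "w \<in> E (X' a - S)" using w a by blast
      then show ?thesis by (auto simp: E_def F_def X'_def)
    qed
    obtain a0 where "a0 \<in> \<rat>" "h (s w) < a0" using Rats_dense_in_real[of "h (s w)" "h (s w) + 1"] by auto
    then have "F w - S \<noteq> {}" using ex by blast
    moreover have "compact (F w - S)" using Fw(1)[OF wN] S by (rule compact_diff)
    ultimately obtain q where q: "q \<in> F w - S" "\<And>y. y \<in> F w - S \<Longrightarrow> h q \<le> h y"
      using continuous_attains_inf[of "F w - S" h] continuous_on_subset[OF hc] by auto
    have "h q \<le> h (s w)"
    proof (rule ccontr)
      assume "\<not> h q \<le> h (s w)"
      then obtain a where "a \<in> \<rat>" "h (s w) < a" "a < h q" using Rats_dense_in_real by (metis not_le)
      then show False using ex q(2) by fastforce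
    qed
    then have "q = s w" using m(3)[of q] q(1) by force
    then show "w \<in> s -` (- S) \<inter> E X" using q(1) w by auto
  qed
  also have "\<dots> \<in> sets N"
    using E X' X(1) countable_rat Rats_0 by (intro sets.Int sets.countable_INT') auto
  finally have 1: "s -` (- S) \<inter> E X \<in> sets N" .
  \<comment> \<open>On the infeasible event the value is the fixed but unspecified point
    \<open>argmin_on h {}\<close>.\<close>
  have 2: "s -` (- S) \<inter> (space N - E X) \<in> sets N"
  proof -
    have "s w = argmin_on h {}" if "w \<in> space N - E X" for w
      using that unfolding s_def by (intro arg_cong[where f="argmin_on h"]) (auto simp: F_def E_def)
    then have "s -` (- S) \<inter> (space N - E X) = (if argmin_on h {} \<in> S then {} else space N - E X)"
      by auto
    then show ?thesis using E X(1) by auto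
  qed
  have "s -` S \<inter> space N = space N - ((s -` (- S) \<inter> E X) \<union> (s -` (- S) \<inter> (space N - E X)))"
    by (auto simp: E_def)
  then have "s -` S \<inter> space N \<in> sets N" using 1 2 by auto
  then show "(\<lambda>w. argmin_on h {q \<in> X. \<forall>j\<in>T. g j q w \<le> 0}) -` S \<inter> space N \<in> sets N"
    by (simp add: s_def[abs_def] F_def)
qed

section \<open>Convex programs with generic constraints\<close>

lemma distr_PiM_restrict:
  assumes "prob_space Z" "R \<subseteq> J"
  shows "distr (PiM J (\<lambda>_. Z)) (PiM R (\<lambda>_. Z)) (\<lambda>\<omega>. restrict \<omega> R) = PiM R (\<lambda>_. Z)"
proof -
  have "(\<lambda>n. n) \<in> R \<rightarrow> J" using assms(2) by auto
  then show ?thesis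
    using distr_PiM_reindex[of J "\<lambda>_. Z" "\<lambda>n. n" R] assms(1) by (simp add: inj_on_def)
qed

text \<open>Component \<open>j\<close> is independent of those in \<open>T\<close>, so Fubini
  applies over \<open>insert j T\<close>; the result is pulled back along the restriction from
  \<open>J\<close>.\<close>

lemma AE_PiM_indep_component:
  fixes Z :: "'z measure" and J :: "'i set"
  assumes Z: "prob_space Z" and J: "finite J" "T \<subseteq> J" "j \<in> J - T"
    and Q: "{p \<in> space (PiM T (\<lambda>_. Z) \<Otimes>\<^sub>M Z). Q (fst p) (snd p)} \<in> sets (PiM T (\<lambda>_. Z) \<Otimes>\<^sub>M Z)"
    and AE: "\<And>x. x \<in> space (PiM T (\<lambda>_. Z)) \<Longrightarrow> AE z in Z. Q x z"
  shows "AE \<omega> in PiM J (\<lambda>_. Z). Q (restrict \<omega> T) (\<omega> j)"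
proof -
  interpret Z: prob_space Z by (rule Z)
  interpret prod: product_sigma_finite "\<lambda>_::'i. Z" by (rule product_sigma_finite_const[OF Z])
  have T: "finite T" using J finite_subset by blast
  define R where "R = insert j T"
  have RJ: "R \<subseteq> J" using J by (auto simp: R_def)
  have Rm: "(\<lambda>\<omega>. (restrict \<omega> T, \<omega> j)) \<in> measurable (PiM R (\<lambda>_. Z)) (PiM T (\<lambda>_. Z) \<Otimes>\<^sub>M Z)"
    by (intro measurable_Pair measurable_restrict_subset measurable_component_singleton) (auto simp: R_def)
  have QR: "{\<omega> \<in> space (PiM R (\<lambda>_. Z)). Q (restrict \<omega> T) (\<omega> j)} \<in> sets (PiM R (\<lambda>_. Z))"
  proof -
    have "Measurable.pred (PiM T (\<lambda>_. Z) \<Otimes>\<^sub>M Z) (\<lambda>p. Q (fst p) (snd p))" using Q by (simp add: pred_def)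
    from measurable_compose[OF Rm this] show ?thesis by (simp add: pred_def)
  qed
  let ?N = "space (PiM R (\<lambda>_. Z)) - {\<omega> \<in> space (PiM R (\<lambda>_. Z)). Q (restrict \<omega> T) (\<omega> j)}"
  have N: "?N \<in> sets (PiM R (\<lambda>_. Z))" using QR by auto
  have "emeasure (PiM R (\<lambda>_. Z)) ?N = (\<integral>\<^sup>+\<omega>. indicator ?N \<omega> \<partial>PiM R (\<lambda>_. Z))"
    using N by simp
  also have "\<dots> = (\<integral>\<^sup>+x. \<integral>\<^sup>+y. indicator ?N (x(j := y)) \<partial>Z \<partial>PiM T (\<lambda>_. Z))"
    unfolding R_def using J N R_def
    by (intro prod.product_nn_integral_insert[OF T]) auto
  also have "\<dots> = (\<integral>\<^sup>+x. 0 \<partial>PiM T (\<lambda>_. Z))"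
  proof (rule nn_integral_cong)
    fix x assume x: "x \<in> space (PiM T (\<lambda>_. Z))"
    have rx: "restrict (x(j := y)) T = x" for y
      using x J by (auto simp: space_PiM PiE_def extensional_def fun_eq_iff)
    have "AE y in Z. indicator ?N (x(j := y)) = (0::ennreal)"
      using AE[OF x] by eventually_elim (auto simp: indicator_def rx)
    then show "(\<integral>\<^sup>+y. indicator ?N (x(j := y)) \<partial>Z) = 0"
      using nn_integral_cong_AE[of "\<lambda>y. indicator ?N (x(j := y))" "\<lambda>_. 0" Z] by simp
  qed
  finally have "AE \<omega> in PiM R (\<lambda>_. Z). Q (restrict \<omega> T) (\<omega> j)"
    using N by (intro AE_I[of _ _ ?N]) auto
  then have "AE \<omega> in distr (PiM J (\<lambda>_. Z)) (PiM R (\<lambda>_. Z)) (\<lambda>\<omega>. \<lambda>n\<in>R. \<omega> n). Q (restrict \<omega> T) (\<omega> j)"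
    by (subst distr_PiM_restrict[OF Z RJ])
  from AE_distrD[OF measurable_restrict_subset[OF RJ] this]
  have "AE \<omega> in PiM J (\<lambda>_. Z). Q (restrict (restrict \<omega> R) T) (restrict \<omega> R j)" .
  moreover have "T \<inter> R = T" "R \<inter> T = T" "j \<in> R" by (auto simp: R_def)
  ultimately show ?thesis by simp
qed

text \<open>A bound on the outer measure, so that events can be handled before, or without, a proof
  of their measurability.\<close>

definition outer_measure_le :: "'w measure \<Rightarrow> 'w set \<Rightarrow> real \<Rightarrow> bool" where
  "outer_measure_le P E b \<longleftrightarrow> (\<exists>A\<in>sets P. E \<subseteq> A \<and> measure P A \<le> b)"

lemma (in prob_space) outer_measure_le_AE:
  assumes "outer_measure_le M E b" "AE \<omega> in M. \<omega> \<in> E' \<longrightarrow> \<omega> \<in> E" "E' \<subseteq> space M"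
  shows "outer_measure_le M E' b"
proof -
  obtain A where A: "A \<in> sets M" "E \<subseteq> A" "measure M A \<le> b"
    using assms(1) by (auto simp: outer_measure_le_def)
  obtain N where N: "{\<omega> \<in> space M. \<not> (\<omega> \<in> E' \<longrightarrow> \<omega> \<in> E)} \<subseteq> N" "N \<in> null_sets M"
    using assms(2) unfolding eventually_ae_filter by blast
  have "measure M (A \<union> N) \<le> b"
    using A N(2) by (simp add: measure_Un_null_set)
  moreover have "E' \<subseteq> A \<union> N" using A(2) N(1) assms(3) by blast
  ultimately show ?thesis using A(1) N(2) unfolding outer_measure_le_def by (intro bexI[of _ "A \<union> N"]) auto
qed

text \<open>Fatou's lemma for sets: the parts of \<open>B\<close> on which membership holds from
  index \<open>n\<close> onwards increase to \<open>B\<close>.\<close>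

lemma (in prob_space) eventually_measure_gt:
  fixes A :: "nat \<Rightarrow> 'a set"
  assumes "\<And>n. A n \<in> sets M" "B \<in> sets M" "\<And>x. x \<in> B \<Longrightarrow> \<forall>\<^sub>F n in sequentially. x \<in> A n"
    and "e < measure M B"
  shows "\<forall>\<^sub>F n in sequentially. e < measure M (A n)"
proof -
  define C where "C n = B \<inter> (\<Inter>k\<in>{n..}. A k)" for n
  have C: "C n \<in> sets M" for n
    unfolding C_def using assms(1,2) by (intro sets.Int sets.countable_INT') auto
  have "incseq C" unfolding C_def incseq_def by auto
  moreover have "(\<Union>n. C n) = B"
    using assms(3) unfolding C_def eventually_sequentially by force
  ultimately have "(\<lambda>n. measure M (C n)) \<longlonglongrightarrow> measure M B"
    using finite_Lim_measure_incseq[of C] C by auto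
  then have "\<forall>\<^sub>F n in sequentially. e < measure M (C n)"
    by (rule order_tendstoD(1)[OF _ assms(4)])
  then show ?thesis
  proof (rule eventually_mono)
    fix n assume "e < measure M (C n)"
    also have "measure M (C n) \<le> measure M (A n)"
      using assms(1) by (intro finite_measure_mono) (auto simp: C_def)
    finally show "e < measure M (A n)" .
  qed
qed

text \<open>The limit inferior of the covers is a measurable cover of the limiting event, and a
  measure above \<open>b\<close> would eventually be shared by the covers themselves.\<close>

lemma (in prob_space) outer_measure_le_liminf:
  fixes E :: "nat \<Rightarrow> 'a set"
  assumes "\<And>n. outer_measure_le M (E n) b"
    and "\<And>\<omega>. \<omega> \<in> E' \<Longrightarrow> \<forall>\<^sub>F n in sequentially. \<omega> \<in> E n"
  shows "outer_measure_le M E' b"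
proof -
  obtain A where A: "\<And>n. A n \<in> sets M" "\<And>n. E n \<subseteq> A n" "\<And>n. measure M (A n) \<le> b"
    using assms(1) unfolding outer_measure_le_def by metis
  define B where "B = (\<Union>n. \<Inter>k\<in>{n..}. A k)"
  have B: "B \<in> sets M" unfolding B_def
    using A(1) by (intro sets.countable_UN' sets.countable_INT') auto
  have "measure M B \<le> b"
  proof (rule ccontr)
    assume "\<not> measure M B \<le> b"
    then have "\<forall>\<^sub>F n in sequentially. b < measure M (A n)"
      using A(1) B by (intro eventually_measure_gt[of A B]) (auto simp: B_def eventually_sequentially)
    then show False using A(3) by (auto simp: eventually_sequentially not_less[symmetric])
  qed
  moreover have "E' \<subseteq> B"
  proof
    fix \<omega> assume "\<omega> \<in> E'"
    then obtain n where "\<And>k. k \<ge> n \<Longrightarrow> \<omega> \<in> E k"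
      using assms(2) unfolding eventually_sequentially by auto
    then show "\<omega> \<in> B" using A(2) unfolding B_def by (intro UN_I[of n]) auto
  qed
  ultimately show ?thesis using B unfolding outer_measure_le_def by blast
qed

locale generic_scenario = Z: prob_space Z +
  convex_constraints X h G "space Z" L
  for Z :: "'z measure" and X :: "'a::euclidean_space set" and h G L +
  fixes u :: "'z \<Rightarrow> real" and I :: "nat \<Rightarrow> 'i set"
  assumes finite_I [simp]: "finite (I m)" and card_I [simp]: "card (I m) = m"
    and u_measurable [measurable]: "u \<in> borel_measurable Z"
    and G_measurable [measurable]: "G x \<in> borel_measurable Z"
    and u_neq: "AE z in Z. u z \<noteq> c"
    and G_neq: "AE z in Z. G x z \<noteq> 0"
    and feasible: "AE \<omega> in PiM (I m) (\<lambda>_. Z). feas (\<omega> ` I m) \<noteq> {}"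
begin

lemma sol_measurable:
  assumes "finite T"
  shows "(\<lambda>\<omega>. sol (\<omega> ` T)) \<in> borel_measurable (PiM T (\<lambda>_::'i. Z))"
proof -
  have "(\<lambda>\<omega>. argmin_on h {q \<in> X. \<forall>j\<in>T. G q (\<omega> j) \<le> 0}) \<in> borel_measurable (PiM T (\<lambda>_::'i. Z))"
    using measurable_space[OF measurable_component_singleton[of _ T "\<lambda>_. Z"]]
    by (intro borel_measurable_argmin_on compact_X convex_X strict_h assms convex_G) auto
  then show ?thesis by (simp add: feasible_set_def)
qed

lemma G_sol_measurable:
  assumes "finite T" "f \<in> measurable N (PiM T (\<lambda>_::'i. Z))" "g \<in> measurable N Z"
  shows "(\<lambda>w. G (sol (f w ` T)) (g w)) \<in> borel_measurable N"
proof (rule borel_measurable_caratheodory[where g="\<lambda>q w. G q (g w)" and x="\<lambda>w. sol (f w ` T)"])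
  show "(\<lambda>w. sol (f w ` T)) \<in> borel_measurable N"
    by (rule measurable_compose[OF assms(2) sol_measurable[OF assms(1)]])
  show "(\<lambda>w. G q (g w)) \<in> borel_measurable N" for q
    by (rule measurable_compose[OF assms(3) G_measurable])
  show "continuous_on UNIV (\<lambda>q. G q (g w))" if "w \<in> space N" for w
    using continuous_G measurable_space[OF assms(3) that] by blast
qed

text \<open>The solution for \<open>T\<close> is determined by the samples in \<open>T\<close>,
  hence is a fixed point as seen by a further, independent sample, and \<open>G_neq\<close> applies
  to it. Only finitely many pairs of \<open>T\<close> and \<open>j\<close> occur.\<close>

lemma AE_generic:
  "AE \<omega> in PiM (I m) (\<lambda>_. Z). inj_on (\<lambda>i. u (\<omega> i)) (I m) \<and> generic (\<omega> ` I m)"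
proof -
  let ?P = "PiM (I m) (\<lambda>_::'i. Z)"
  have "AE \<omega> in ?P. u (\<omega> i) \<noteq> u (\<omega> j)" if "i \<in> I m" "j \<in> I m" "i \<noteq> j" for i j
  proof -
    have "AE \<omega> in ?P. u (restrict \<omega> {i} i) \<noteq> u (\<omega> j)"
    proof (rule AE_PiM_indep_component[OF Z.prob_space_axioms finite_I, where Q="\<lambda>x z. u (x i) \<noteq> u z"])
      show "AE z in Z. u (x i) \<noteq> u z" for x using u_neq[of "u (x i)"] by (auto elim: eventually_mono)
      have [measurable]: "(\<lambda>p. fst p i) \<in> measurable (PiM {i} (\<lambda>_::'i. Z) \<Otimes>\<^sub>M Z) Z" by measurable
      show "{p \<in> space (PiM {i} (\<lambda>_. Z) \<Otimes>\<^sub>M Z). u (fst p i) \<noteq> u (snd p)} \<in> sets (PiM {i} (\<lambda>_. Z) \<Otimes>\<^sub>M Z)"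
        by measurable
    qed (use that in auto)
    then show ?thesis by simp
  qed
  then have 1: "AE \<omega> in ?P. \<forall>i\<in>I m. \<forall>j\<in>I m. i \<noteq> j \<longrightarrow> u (\<omega> i) \<noteq> u (\<omega> j)"
    by (intro AE_finite_allI) auto
  have "AE \<omega> in ?P. G (sol (\<omega> ` T)) (\<omega> j) \<noteq> 0" if "T \<subseteq> I m" "j \<in> I m - T" for T j
  proof -
    have T: "finite T" using that(1) finite_I finite_subset by blast
    have "AE \<omega> in ?P. G (sol (restrict \<omega> T ` T)) (\<omega> j) \<noteq> 0"
    proof (rule AE_PiM_indep_component[OF Z.prob_space_axioms finite_I that, where Q="\<lambda>x z. G (sol (x ` T)) z \<noteq> 0"])
      have "(\<lambda>p. G (sol (fst p ` T)) (snd p)) \<in> borel_measurable (PiM T (\<lambda>_::'i. Z) \<Otimes>\<^sub>M Z)"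
        by (rule G_sol_measurable[OF T]) auto
      then show "{p \<in> space (PiM T (\<lambda>_::'i. Z) \<Otimes>\<^sub>M Z). G (sol (fst p ` T)) (snd p) \<noteq> 0} \<in> sets (PiM T (\<lambda>_. Z) \<Otimes>\<^sub>M Z)"
        by measurable
    qed (rule G_neq)
    then show ?thesis by (simp cong: image_cong)
  qed
  then have 2: "AE \<omega> in ?P. \<forall>T\<in>Pow (I m). \<forall>j\<in>I m - T. G (sol (\<omega> ` T)) (\<omega> j) \<noteq> 0"
    by (intro AE_finite_allI) auto
  show ?thesis
    using 1 2 feasible[of m] AE_space
  proof eventually_elim
    case (elim \<omega>)
    have "inj_on (\<lambda>i. u (\<omega> i)) (I m)" using elim(1) by (auto simp: inj_on_def)
    moreover have "\<omega> ` I m \<subseteq> space Z" using elim(4) by (auto simp: space_PiM)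
    moreover have "G (sol A) z \<noteq> 0" if A: "A \<subseteq> \<omega> ` I m" and z: "z \<in> \<omega> ` I m - A" for A z
    proof -
      define T where "T = {i \<in> I m. \<omega> i \<in> A}"
      have "A = \<omega> ` T" using A by (auto simp: T_def)
      moreover obtain j where "j \<in> I m - T" "z = \<omega> j" using z by (auto simp: T_def)
      moreover have "T \<in> Pow (I m)" by (auto simp: T_def)
      ultimately show ?thesis using elim(2) by metis
    qed
    ultimately show ?case using elim(3) unfolding generic_def by simp
  qed
qed

sublocale V: violation_structure Z "padded_viol u" I "DIM('a) - dim L"
proof
  fix T :: "'i set" assume T: "finite T"
  let ?Q = "PiM T (\<lambda>_::'i. Z) \<Otimes>\<^sub>M Z"
  have 1: "(\<lambda>p. G (sol (fst p ` T)) (snd p)) \<in> borel_measurable ?Q"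
    by (rule G_sol_measurable[OF T]) auto
  have "Measurable.pred ?Q (\<lambda>p. G (sol (fst p ` T)) (fst p t) < 0 \<and> u (snd p) < u (fst p t))" if t: "t \<in> T" for t
  proof -
    have [measurable]: "(\<lambda>p. G (sol (fst p ` T)) (fst p t)) \<in> borel_measurable ?Q"
      using t by (intro G_sol_measurable[OF T]) auto
    have [measurable]: "(\<lambda>p. fst p t) \<in> measurable ?Q Z"
      using t by measurable
    show ?thesis by measurable
  qed
  then have "Measurable.pred ?Q (\<lambda>p. \<exists>t\<in>T. G (sol (fst p ` T)) (fst p t) < 0 \<and> u (snd p) < u (fst p t))"
    using T by (intro pred_intros_finite) auto
  with 1 have "Measurable.pred ?Q (\<lambda>p. 0 < G (sol (fst p ` T)) (snd p) \<or>
      (\<exists>t\<in>T. G (sol (fst p ` T)) (fst p t) < 0 \<and> u (snd p) < u (fst p t)))"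
    by (intro pred_intros_logic) auto
  then show "{p \<in> space ?Q. padded_viol u (fst p ` T) (snd p)} \<in> sets ?Q"
    by (simp add: padded_viol_def pred_def)
next
  fix m assume m: "DIM('a) - dim L \<le> m"
  let ?r = "DIM('a) - dim L"
  show "AE \<omega> in PiM (I m) (\<lambda>_. Z). \<exists>!T. T \<subseteq> I m \<and> card T = ?r \<and>
      (\<forall>j\<in>I m - T. \<not> padded_viol u (\<omega> ` T) (\<omega> j))"
    using AE_generic[of m]
  proof eventually_elim
    case (elim \<omega>)
    let ?B = "\<omega> ` I m"
    \<comment> \<open>Distinct labels make the samples distinct, so subsets of indices and subsets
      of sample values correspond, with equal cardinality.\<close>
    have inj: "inj_on \<omega> (I m)" using elim by (auto simp: inj_on_def)
    have u: "inj_on u ?B" using elim by (auto simp: inj_on_def)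
    have card: "card (\<omega> ` T) = card T" if "T \<subseteq> I m" for T
      using card_image inj_on_subset[OF inj that] by blast
    have viol: "(\<forall>j\<in>I m - T. \<not> padded_viol u (\<omega> ` T) (\<omega> j)) \<longleftrightarrow> (\<forall>z\<in>?B - \<omega> ` T. \<not> padded_viol u (\<omega> ` T) z)"
      if "T \<subseteq> I m" for T
    proof -
      have "?B - \<omega> ` T = \<omega> ` (I m - T)" using inj_on_image_set_diff[OF inj _ that, of "I m"] by simp
      then show ?thesis by simp
    qed
    have "\<exists>!A. A \<subseteq> ?B \<and> card A = ?r \<and> (\<forall>z\<in>?B - A. \<not> padded_viol u A z)"
      using elim m card[of "I m"] by (intro ex1_unviolated[OF _ u]) auto
    then obtain A where A: "A \<subseteq> ?B" "card A = ?r" "\<forall>z\<in>?B - A. \<not> padded_viol u A z"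
      and A_unique: "\<And>A'. A' \<subseteq> ?B \<Longrightarrow> card A' = ?r \<Longrightarrow> (\<forall>z\<in>?B - A'. \<not> padded_viol u A' z) \<Longrightarrow> A' = A"
      by (elim ex1E) iprover
    define T where "T = {i \<in> I m. \<omega> i \<in> A}"
    have T: "T \<subseteq> I m" "\<omega> ` T = A" using A(1) by (auto simp: T_def)
    show ?case
    proof (rule ex1I[of _ T])
      show "T \<subseteq> I m \<and> card T = ?r \<and> (\<forall>j\<in>I m - T. \<not> padded_viol u (\<omega> ` T) (\<omega> j))"
        using viol[OF T(1)] T A card[OF T(1)] by auto
      fix T' assume T': "T' \<subseteq> I m \<and> card T' = ?r \<and> (\<forall>j\<in>I m - T'. \<not> padded_viol u (\<omega> ` T') (\<omega> j))"
      then have "\<omega> ` T' = A" using viol[of T'] card[of T'] by (intro A_unique) auto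
      then show "T' = T" using T T' inj_on_image_eq_iff[OF inj, of T' T] by simp
    qed
  qed
qed auto

text \<open>Almost surely the singled-out subset has the solution of the full sample. Since
  violating the constraint implies \<open>padded_viol\<close>, the violation probability is at most
  \<open>vprob\<close> of this subset.\<close>

theorem violation_bound:
  assumes "DIM('a) - dim L \<le> K" "0 < \<epsilon>" "\<epsilon> < 1"
  shows "outer_measure_le (PiM (I K) (\<lambda>_. Z))
    {\<omega> \<in> space (PiM (I K) (\<lambda>_. Z)). \<epsilon> < measure Z {z \<in> space Z. 0 < G (sol (\<omega> ` I K)) z}}
    (binomial_tail \<epsilon> (int (DIM('a) - dim L) - 1) K)"
proof (rule V.P.outer_measure_le_AE)
  show "outer_measure_le (PiM (I K) (\<lambda>_. Z)) (V.bad_event K \<epsilon>) (binomial_tail \<epsilon> (int (DIM('a) - dim L) - 1) K)"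
    using V.bad_event_bound[OF assms] unfolding outer_measure_le_def by blast
  show "AE \<omega> in PiM (I K) (\<lambda>_. Z).
      \<omega> \<in> {\<omega> \<in> space (PiM (I K) (\<lambda>_. Z)). \<epsilon> < measure Z {z \<in> space Z. 0 < G (sol (\<omega> ` I K)) z}} \<longrightarrow>
      \<omega> \<in> V.bad_event K \<epsilon>"
    using V.unique_unviolated[OF assms(1)] AE_generic[of K]
  proof eventually_elim
    case (elim \<omega>)
    then obtain T where T: "T \<subseteq> I K" "card T = DIM('a) - dim L" "\<forall>j\<in>I K - T. \<not> padded_viol u (\<omega> ` T) (\<omega> j)"
      by blast
    have fT: "finite T" using T(1) finite_I finite_subset by blast
    have eq: "sol (\<omega> ` T) = sol (\<omega> ` I K)"
      using T elim by (intro unviolated_sol_eq) auto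
    have le: "measure Z {z \<in> space Z. 0 < G (sol (\<omega> ` I K)) z} \<le> V.vprob (\<omega> ` T)"
      if w: "\<omega> \<in> space (PiM (I K) (\<lambda>_. Z))"
    proof -
      have "restrict \<omega> T \<in> space (PiM T (\<lambda>_. Z))" using w T(1) by (auto simp: space_PiM)
      from V.viol_section[OF fT this] have "{z \<in> space Z. padded_viol u (\<omega> ` T) z} \<in> sets Z"
        by (simp cong: image_cong)
      then show ?thesis
        unfolding V.vprob_def eq[symmetric]
        by (intro Z.finite_measure_mono) (auto simp: padded_viol_def)
    qed
    show ?case
    proof
      assume "\<omega> \<in> {\<omega> \<in> space (PiM (I K) (\<lambda>_. Z)). \<epsilon> < measure Z {z \<in> space Z. 0 < G (sol (\<omega> ` I K)) z}}"
      then have "\<omega> \<in> space (PiM (I K) (\<lambda>_. Z))" "\<epsilon> < V.vprob (\<omega> ` T)"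
        using le by (simp_all add: less_le_trans)
      then show "\<omega> \<in> V.bad_event K \<epsilon>"
        unfolding V.bad_event_def V.unviolated_def
        by (intro CollectI conjI exI[of _ T] T) simp_all
    qed
  qed
qed auto

end

section \<open>Lexicographic selection\<close>

lemma compact_unique_cluster_tendsto:
  fixes x :: "nat \<Rightarrow> 'a::metric_space"
  assumes D: "compact D" "\<And>n. x n \<in> D"
    and cl: "\<And>l s. l \<in> D \<Longrightarrow> strict_mono (s :: nat \<Rightarrow> nat) \<Longrightarrow> (x \<circ> s) \<longlonglongrightarrow> l \<Longrightarrow> l = x0"
  shows "x \<longlonglongrightarrow> x0"
proof (rule ccontr)
  assume "\<not> x \<longlonglongrightarrow> x0"
  then obtain e where e: "0 < e" "\<not> (\<forall>\<^sub>F n in sequentially. dist (x n) x0 < e)"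
    unfolding tendsto_iff by auto
  then have "infinite {n. e \<le> dist (x n) x0}"
    unfolding eventually_cofinite[symmetric] cofinite_eq_sequentially[symmetric]
    by (simp add: eventually_cofinite not_less)
  from infinite_enumerate[OF this]
  obtain r :: "nat \<Rightarrow> nat" where r: "strict_mono r" "\<And>n. e \<le> dist (x (r n)) x0" by auto
  obtain l s where l: "l \<in> D" "strict_mono (s :: nat \<Rightarrow> nat)" "((x \<circ> r) \<circ> s) \<longlonglongrightarrow> l"
    using seq_compactE[OF compact_imp_seq_compact[OF D(1)], of "x \<circ> r"] D(2) by auto
  have "l = x0"
    using cl[OF l(1) strict_mono_o[OF r(1) l(2)]] l(3) by (simp add: comp_assoc)
  then have "\<forall>\<^sub>F n in sequentially. dist (((x \<circ> r) \<circ> s) n) x0 < e"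
    using l(3) e(1) tendstoD by blast
  then show False using r(2) by (auto simp: eventually_sequentially not_less[symmetric])
qed

definition lex_select :: "('a::real_vector \<Rightarrow> real) list \<Rightarrow> 'a set \<Rightarrow> 'a" where
  "lex_select hs F = (THE x. x \<in> F \<and> (\<forall>y\<in>F. lexordp_eq (map (\<lambda>g. g x) hs) (map (\<lambda>g. g y) hs)))"

lemma lex_select_single: "lex_select [h] F = argmin_on h F"
proof -
  have "lexordp_eq [h x] [h y] \<longleftrightarrow> h x \<le> h y" for x y by auto
  then show ?thesis by (simp only: lex_select_def argmin_on_def list.map)
qed

lemma lexordp_eq_pointwise:
  fixes a b :: "'g \<Rightarrow> real"
  shows "(\<And>g. g \<in> set gs \<Longrightarrow> a g \<le> b g) \<Longrightarrow> lexordp_eq (map a gs) (map b gs)"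
  by (induction gs) (auto simp: less_le)

lemma lexordp_eq_append:
  fixes xs ys xs' ys' :: "real list"
  shows "length xs = length ys \<Longrightarrow> lexordp_eq (xs @ xs') (ys @ ys') \<longleftrightarrow>
    (xs \<noteq> ys \<and> lexordp_eq xs ys) \<or> (xs = ys \<and> lexordp_eq xs' ys')"
  by (induction xs ys rule: list_induct2) auto

text \<open>For uniqueness, two minimizers agree in every criterion. Their midpoint is no worse in
  any of them by convexity, hence also minimal, but strictly better in \<open>h\<close>.\<close>

lemma lex_select:
  fixes hs :: "('a::euclidean_space \<Rightarrow> real) list"
  assumes hs: "\<forall>g\<in>set hs. convex_on UNIV g" and h: "strictly_convex h" and hin: "h \<in> set hs"
    and F: "compact F" "convex F" "F \<noteq> {}"
  shows "lex_select hs F \<in> F"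
    and "\<And>y. y \<in> F \<Longrightarrow> lexordp_eq (map (\<lambda>g. g (lex_select hs F)) hs) (map (\<lambda>g. g y) hs)"
    and "\<And>x. x \<in> F \<Longrightarrow> (\<And>y. y \<in> F \<Longrightarrow> lexordp_eq (map (\<lambda>g. g x) hs) (map (\<lambda>g. g y) hs)) \<Longrightarrow> x = lex_select hs F"
proof -
  have "\<forall>g\<in>set hs. continuous_on F g" using hs convex_on_UNIV_continuous by blast
  from ex_lexicographic_minimum[OF this F(1,3)]
  obtain x where x: "x \<in> F" "\<And>y. y \<in> F \<Longrightarrow> lexordp_eq (map (\<lambda>g. g x) hs) (map (\<lambda>g. g y) hs)" by blast
  have uniq: "y = x" if y: "y \<in> F" "\<And>w. w \<in> F \<Longrightarrow> lexordp_eq (map (\<lambda>g. g y) hs) (map (\<lambda>g. g w) hs)" for y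
  proof (rule ccontr)
    assume neq: "y \<noteq> x"
    have "map (\<lambda>g. g x) hs = map (\<lambda>g. g y) hs"
      using x(2)[OF y(1)] y(2)[OF x(1)] by (rule lexordp_eq_antisym)
    then have eq: "g x = g y" if "g \<in> set hs" for g using that by auto
    define m where "m = (1 - 1/2) *\<^sub>R x + (1/2::real) *\<^sub>R y"
    have mF: "m \<in> F" unfolding m_def using x(1) y(1) F(2) by (intro convexD) auto
    have "g m \<le> g x" if g: "g \<in> set hs" for g
      using convex_onD[of UNIV g "1/2" x y] hs g eq[OF g] by (auto simp: m_def)
    then have "lexordp_eq (map (\<lambda>g. g m) hs) (map (\<lambda>g. g x) hs)"
      by (rule lexordp_eq_pointwise)
    then have "map (\<lambda>g. g m) hs = map (\<lambda>g. g x) hs"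
      using x(2)[OF mF] by (rule lexordp_eq_antisym)
    then have "h m = h x" using hin by auto
    moreover have "h m < (1 - 1/2) * h x + (1/2) * h y"
      unfolding m_def using strictly_convexD[OF h, of x y "1/2"] neq by simp
    ultimately show False using eq[OF hin] by simp
  qed
  have sel: "lex_select hs F = x"
    unfolding lex_select_def
  proof (rule the_equality)
    show "x \<in> F \<and> (\<forall>y\<in>F. lexordp_eq (map (\<lambda>g. g x) hs) (map (\<lambda>g. g y) hs))"
      using x by blast
  next
    fix y assume y: "y \<in> F \<and> (\<forall>w\<in>F. lexordp_eq (map (\<lambda>g. g y) hs) (map (\<lambda>g. g w) hs))"
    show "y = x" by (rule uniq) (use y in blast)+
  qed
  show "lex_select hs F \<in> F" using sel x(1) by simp
  show "lexordp_eq (map (\<lambda>g. g (lex_select hs F)) hs) (map (\<lambda>g. g y) hs)" if "y \<in> F" for y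
    using sel x(2)[OF that] by simp
  show "y = lex_select hs F" if "y \<in> F" "\<And>w. w \<in> F \<Longrightarrow> lexordp_eq (map (\<lambda>g. g y) hs) (map (\<lambda>g. g w) hs)" for y
    using uniq[OF that] sel by simp
qed

text \<open>
  Lexicographic minimisation is approached by penalising the last criterion. Merging
  from the end of the list is essential: the earlier criteria are still minimised exactly.
\<close>

lemma lex_select_merge_tendsto:
  fixes hs :: "('a::euclidean_space \<Rightarrow> real) list"
  assumes hs: "\<forall>g\<in>set hs. convex_on UNIV g" and g: "convex_on UNIV g" and h: "strictly_convex h"
    and F: "compact F" "convex F" "F \<noteq> {}"
  shows "(\<lambda>n. lex_select (hs @ [\<lambda>x. g x + 1 / real (Suc n) * h x]) F) \<longlonglongrightarrow> lex_select (hs @ [g, h]) F"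
proof -
  define k where "k n = (\<lambda>x. g x + 1 / real (Suc n) * h x)" for n
  have k: "strictly_convex (k n)" for n
    unfolding k_def by (rule strictly_convex_add_scaled[OF g h]) simp
  define x where "x n = lex_select (hs @ [k n]) F" for n
  define x0 where "x0 = lex_select (hs @ [g, h]) F"
  have hc: "convex_on UNIV h" by (rule strictly_convex_imp_convex[OF h])
  have c1: "\<forall>g'\<in>set (hs @ [g, h]). convex_on UNIV g'" using hs g hc by auto
  have hin: "h \<in> set (hs @ [g, h])" by simp
  note s0 = lex_select[OF c1 h hin F, folded x0_def]
  have c2: "\<forall>g'\<in>set (hs @ [k n]). convex_on UNIV g'" for n
    using hs strictly_convex_imp_convex[OF k] by auto
  have xF: "x n \<in> F"
    and sn: "y \<in> F \<Longrightarrow> lexordp_eq (map (\<lambda>g. g (x n)) hs @ [k n (x n)]) (map (\<lambda>g. g y) hs @ [k n y])" for n y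
    using lex_select(1,2)[OF c2[of n] k[of n] _ F] by (simp_all add: x_def)
  have x0F: "x0 \<in> F" by (rule s0(1))
  have le0: "map (\<lambda>g. g x0) hs \<noteq> map (\<lambda>g. g y) hs \<and> lexordp_eq (map (\<lambda>g. g x0) hs) (map (\<lambda>g. g y) hs) \<or>
      map (\<lambda>g. g x0) hs = map (\<lambda>g. g y) hs \<and> lexordp_eq [g x0, h x0] [g y, h y]" if "y \<in> F" for y
    using s0(2)[OF that] lexordp_eq_append[of "map (\<lambda>g. g x0) hs" "map (\<lambda>g. g y) hs" "[g x0, h x0]" "[g y, h y]"]
    by simp
  have len: "map (\<lambda>g. g (x n)) hs \<noteq> map (\<lambda>g. g x0) hs \<and> lexordp_eq (map (\<lambda>g. g (x n)) hs) (map (\<lambda>g. g x0) hs) \<or>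
      map (\<lambda>g. g (x n)) hs = map (\<lambda>g. g x0) hs \<and> lexordp_eq [k n (x n)] [k n x0]" for n
    using sn[OF x0F, of n] lexordp_eq_append[of "map (\<lambda>g. g (x n)) hs" "map (\<lambda>g. g x0) hs" "[k n (x n)]" "[k n x0]"]
    by simp
  \<comment> \<open>Each point is lexicographically no worse than the other on the common prefix
    \<open>hs\<close>, so these criteria agree exactly and for every \<open>n\<close>.\<close>
  have eq: "map (\<lambda>g. g x0) hs = map (\<lambda>g. g (x n)) hs" for n
    using le0[OF xF[of n]] len[of n] lexordp_eq_antisym by metis
  have k_le: "k n (x n) \<le> k n x0" for n using len[of n] eq[of n] by auto
  have lex2: "g x0 < g (x n) \<or> g x0 = g (x n) \<and> h x0 \<le> h (x n)" for n
    using le0[OF xF[of n]] eq[of n] by auto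
  \<comment> \<open>Given the equal prefix, \<open>g\<close> is minimal at \<open>x0\<close>, so
    \<open>x n\<close> can win the merged comparison only through \<open>h\<close>.\<close>
  have h_le: "h (x n) \<le> h x0" for n
  proof -
    have "g x0 \<le> g (x n)" using lex2[of n] by auto
    then have "1 / real (Suc n) * h (x n) \<le> 1 / real (Suc n) * h x0"
      using k_le[of n] unfolding k_def by linarith
    then show ?thesis by (simp add: divide_le_cancel)
  qed
  obtain B where B: "\<And>y. y \<in> F \<Longrightarrow> \<bar>h y\<bar> \<le> B"
    using compact_imp_bounded[OF compact_continuous_image[OF convex_on_UNIV_continuous[OF hc] F(1)]]
    unfolding bounded_iff by fastforce
  \<comment> \<open>Conversely, the gain in \<open>h\<close> is at most \<open>2 * B\<close> on the
    compact set, so the price paid in \<open>g\<close> vanishes with the penalty factor.\<close>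
  have g_le: "g (x n) \<le> g x0 + 1 / real (Suc n) * (2 * B)" for n
  proof -
    have "h x0 - h (x n) \<le> 2 * B" using B[OF x0F] B[OF xF[of n]] by linarith
    then have "1 / real (Suc n) * (h x0 - h (x n)) \<le> 1 / real (Suc n) * (2 * B)"
      by (intro mult_left_mono) auto
    moreover have "g (x n) \<le> g x0 + 1 / real (Suc n) * (h x0 - h (x n))"
      using k_le[of n] unfolding k_def right_diff_distrib by linarith
    ultimately show ?thesis by linarith
  qed
  have "x \<longlonglongrightarrow> x0"
  proof (rule compact_unique_cluster_tendsto[OF F(1) xF])
    fix l and s :: "nat \<Rightarrow> nat" assume l: "l \<in> F" and s: "strict_mono s" and lim: "(x \<circ> s) \<longlonglongrightarrow> l"
    have limc: "(\<lambda>n. c (x (s n))) \<longlonglongrightarrow> c l" if "convex_on UNIV c" for c :: "'a \<Rightarrow> real"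
      using continuous_on_tendsto_compose[OF convex_on_UNIV_continuous[OF that, of UNIV] lim] by simp
    have "c l = c x0" if c: "c \<in> set hs" for c
    proof -
      have "c (x (s n)) = c x0" for n using eq[of "s n"] c by auto
      then have "(\<lambda>n. c (x (s n))) \<longlonglongrightarrow> c x0" by simp
      then show ?thesis using limc[of c] hs c LIMSEQ_unique by blast
    qed
    then have ml: "map (\<lambda>g. g l) hs = map (\<lambda>g. g x0) hs" by simp
    have hl: "h l \<le> h x0"
      using limc[OF hc] h_le by (intro LIMSEQ_le_const2[of "\<lambda>n. h (x (s n))"]) auto
    have "(\<lambda>n. g x0 + 1 / real (Suc (s n)) * (2 * B)) \<longlonglongrightarrow> g x0 + 0 * (2 * B)"
      using LIMSEQ_subseq_LIMSEQ[OF LIMSEQ_Suc[OF lim_1_over_n] s]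
      by (intro tendsto_intros) (simp add: comp_def)
    then have gl: "g l \<le> g x0"
      using limc[OF g] g_le by (intro LIMSEQ_le[of "\<lambda>n. g (x (s n))"]) auto
    have "lexordp_eq (map (\<lambda>g. g l) (hs @ [g, h])) (map (\<lambda>g. g x0) (hs @ [g, h]))"
      using ml hl gl lexordp_eq_append[of "map (\<lambda>g. g l) hs" "map (\<lambda>g. g x0) hs"] by auto
    from lexordp_eq_trans[OF this s0(2)] show "l = x0" by (rule s0(3)[OF l])
  qed
  then show ?thesis unfolding x_def x0_def k_def .
qed

section \<open>Perturbation and penalisation\<close>

lemma prob_space_unit_interval: "prob_space (restrict_space lborel {0..1::real})"
  by (rule prob_spaceI) (simp add: emeasure_restrict_space space_restrict_space)

lemma (in prob_space) AE_pair_prob: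
  assumes N: "prob_space N" and "{x \<in> space (M \<Otimes>\<^sub>M N). P x} \<in> sets (M \<Otimes>\<^sub>M N)"
    and "\<And>x. x \<in> space M \<Longrightarrow> AE y in N. P (x, y)"
  shows "AE x in M \<Otimes>\<^sub>M N. P x"
proof -
  interpret N: prob_space N by (rule N)
  interpret pair_sigma_finite M N ..
  show ?thesis by (rule AE_pair_measure[OF assms(2)]) (use assms(3) in auto)
qed

lemma convex_on_minus_const: "convex_on UNIV f \<Longrightarrow> convex_on UNIV (\<lambda>x. f x - (c::real))"
  by (simp add: convex_on_def algebra_simps flip: distrib_left distrib_right)

text \<open>Convexity and invariance are required at every point of \<open>space M\<close>; the
  exceptional null set is dealt with before the locale is instantiated.\<close>

locale single_constraint = prob_space M
  for M :: "'b measure" +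
  fixes X :: "'a::euclidean_space set" and f :: "'a \<Rightarrow> 'b \<Rightarrow> real" and L :: "'a set"
    and I :: "nat \<Rightarrow> 'i set"
  assumes compact_X: "compact X" and convex_X: "convex X"
    and f_measurable [measurable]: "f x \<in> borel_measurable M"
    and convex_f: "\<delta> \<in> space M \<Longrightarrow> convex_on UNIV (\<lambda>x. f x \<delta>)"
    and subspace_L: "subspace L"
    and invariant_f: "\<delta> \<in> space M \<Longrightarrow> \<xi> \<in> L \<Longrightarrow> f (x + \<xi>) \<delta> = f x \<delta>"
    and finite_I [simp]: "finite (I m)" and card_I [simp]: "card (I m) = m"
    and feasible: "AE \<omega> in PiM (I m) (\<lambda>_. M). feasible_set X f (\<omega> ` I m) \<noteq> {}"
begin

lemma continuous_f: "\<delta> \<in> space M \<Longrightarrow> continuous_on S (\<lambda>x. f x \<delta>)"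
  by (rule convex_on_UNIV_continuous[OF convex_f])

lemma unperturbed: "strictly_convex h \<Longrightarrow> convex_constraints X h f (space M) L"
  by unfold_locales (auto intro: compact_X convex_X convex_f subspace_L invariant_f)

abbreviation P :: "nat \<Rightarrow> ('i \<Rightarrow> 'b) measure" where "P m \<equiv> PiM (I m) (\<lambda>_. M)"

text \<open>Lower semicontinuity of the violation probability: for each \<delta> a strict violation
  at the limit persists along the sequence.\<close>

lemma eventually_violation_gt:
  assumes "x \<longlonglongrightarrow> x0" "\<epsilon> < measure M {\<delta> \<in> space M. 0 < f x0 \<delta>}"
  shows "\<forall>\<^sub>F n in sequentially. \<epsilon> < measure M {\<delta> \<in> space M. 0 < f (x n) \<delta>}"
proof (rule eventually_measure_gt[OF _ _ _ assms(2)])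
  fix \<delta> assume "\<delta> \<in> {\<delta> \<in> space M. 0 < f x0 \<delta>}"
  then have d: "\<delta> \<in> space M" "0 < f x0 \<delta>" by auto
  have "(\<lambda>n. f (x n) \<delta>) \<longlonglongrightarrow> f x0 \<delta>"
    using continuous_on_tendsto_compose[OF continuous_f[OF d(1), of UNIV] assms(1)] by simp
  from order_tendstoD(1)[OF this d(2)]
  show "\<forall>\<^sub>F n in sequentially. \<delta> \<in> {\<delta> \<in> space M. 0 < f (x n) \<delta>}"
    using d(1) by simp
qed measurable

definition exceed :: "real \<Rightarrow> nat \<Rightarrow> ('a set \<Rightarrow> 'a) \<Rightarrow> ('i \<Rightarrow> 'b) set" where
  "exceed \<epsilon> K s = {\<omega> \<in> space (P K).
    \<epsilon> < measure M {\<delta> \<in> space M. 0 < f (s (feasible_set X f (\<omega> ` I K))) \<delta>}}"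

text \<open>The uniform label has two roles: it makes tightness at a fixed point a null event, and
  it is the label that orders the padding. Being nonnegative it relaxes the constraint, so
  feasibility is inherited.\<close>

definition perturbed :: "nat \<Rightarrow> 'a \<Rightarrow> 'b \<times> real \<Rightarrow> real" where
  "perturbed n x z = f x (fst z) - 1 / real (Suc n) * snd z"

definition labelled :: "('b \<times> real) measure" where
  "labelled = M \<Otimes>\<^sub>M restrict_space lborel {0..1}"

lemma prob_space_labelled: "prob_space labelled"
  unfolding labelled_def
  by (intro prob_space_pair prob_space_unit_interval prob_space_axioms)

lemma space_labelled: "z \<in> space labelled \<longleftrightarrow> fst z \<in> space M \<and> 0 \<le> snd z \<and> snd z \<le> 1"
  by (cases z) (auto simp: labelled_def space_pair_measure space_restrict_space)

lemma fst_labelled [measurable]: "fst \<in> measurable labelled M"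
  by (simp add: labelled_def)

lemma snd_labelled [measurable]: "snd \<in> borel_measurable labelled"
proof -
  have "(\<lambda>x. x) \<in> borel_measurable (restrict_space lborel {0..1::real})"
    by (rule measurable_restrict_space1) simp
  then show ?thesis
    unfolding labelled_def by (rule measurable_compose[OF measurable_snd])
qed

lemma distr_fst_labelled: "distr labelled M fst = M"
  unfolding labelled_def using prob_space.distr_pair_fst[OF prob_space_unit_interval] .

lemma AE_label_neq:
  assumes g: "g \<in> borel_measurable M"
  shows "AE z in labelled. snd z \<noteq> g (fst z)"
  unfolding labelled_def
proof (rule AE_pair_prob[OF prob_space_unit_interval])
  have "{z \<in> space labelled. snd z \<noteq> g (fst z)} \<in> sets labelled"
    using g by measurable
  then show "{z \<in> space (M \<Otimes>\<^sub>M restrict_space lborel {0..1}). snd z \<noteq> g (fst z)}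
      \<in> sets (M \<Otimes>\<^sub>M restrict_space lborel {0..1})"
    by (simp add: labelled_def)
  show "AE y in restrict_space lborel {0..1}. snd (x, y) \<noteq> g (fst (x, y))" for x
    using AE_lborel_singleton[of "g x"] by (subst AE_restrict_space_iff) auto
qed

lemma distr_compose_fst:
  "distr (PiM (I m) (\<lambda>_. labelled)) (P m) (compose (I m) fst) = P m"
  by (subst distr_PiM_finite_prob_space')
    (auto simp: distr_fst_labelled prob_space_labelled prob_space_axioms)

lemma measurable_compose_fst: "compose (I m) fst \<in> measurable (PiM (I m) (\<lambda>_. labelled)) (P m)"
  unfolding compose_def by measurable

lemma compose_fst_image: "compose (I m) fst \<omega> ` I m = fst ` \<omega> ` I m"
  by (auto simp: compose_def image_image)

lemma feasible_perturbed_superset: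
  "B \<subseteq> space labelled \<Longrightarrow> feasible_set X f (fst ` B) \<subseteq> feasible_set X (perturbed n) B"
proof
  fix x assume B: "B \<subseteq> space labelled" and x: "x \<in> feasible_set X f (fst ` B)"
  have "perturbed n x z \<le> 0" if "z \<in> B" for z
  proof -
    have "f x (fst z) \<le> 0" using x that by (auto simp: feasible_set_def)
    moreover have "0 \<le> snd z" using B that space_labelled by blast
    then have "0 \<le> 1 / real (Suc n) * snd z" by simp
    ultimately show ?thesis unfolding perturbed_def by linarith
  qed
  then show "x \<in> feasible_set X (perturbed n) B" using x by (auto simp: feasible_set_def)
qed

lemma generic_perturbed:
  assumes h: "strictly_convex h"
  shows "generic_scenario labelled X h (perturbed n) L snd I"
proof -
  interpret Z: prob_space labelled by (rule prob_space_labelled)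
  show ?thesis
  proof
    show "convex_on UNIV (\<lambda>x. perturbed n x z)" if "z \<in> space labelled" for z
      using that convex_f unfolding perturbed_def space_labelled by (intro convex_on_minus_const) auto
    show "perturbed n (x + \<xi>) z = perturbed n x z" if "z \<in> space labelled" "\<xi> \<in> L" for z x \<xi>
      using that invariant_f by (simp add: perturbed_def space_labelled)
    show pm: "perturbed n x \<in> borel_measurable labelled" for x
      unfolding perturbed_def by measurable
    show "AE z in labelled. snd z \<noteq> c" for c
      using AE_label_neq[of "\<lambda>_. c"] by simp
    \<comment> \<open>Tightness at \<open>x\<close> means that the label equals
      \<open>real (Suc n) * f x \<delta>\<close>, a single value once \<delta> is fixed.\<close>
    show "AE z in labelled. perturbed n x z \<noteq> 0" for x
      using AE_label_neq[of "\<lambda>\<delta>. real (Suc n) * f x \<delta>"]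
      by (rule eventually_mono) (auto simp: perturbed_def field_simps)
    show "AE \<omega> in PiM (I m) (\<lambda>_. labelled). feasible_set X (perturbed n) (\<omega> ` I m) \<noteq> {}" for m
    proof -
      have "AE \<omega> in PiM (I m) (\<lambda>_. labelled). feasible_set X f (compose (I m) fst \<omega> ` I m) \<noteq> {}"
        by (rule AE_distrD[OF measurable_compose_fst]) (simp only: distr_compose_fst feasible)
      then show ?thesis using AE_space
      proof eventually_elim
        case (elim \<omega>)
        then have "\<omega> ` I m \<subseteq> space labelled" by (auto simp: space_PiM)
        from feasible_perturbed_superset[OF this] elim(1) show ?case
          unfolding compose_fst_image by blast
      qed
    qed
  qed (auto intro: compact_X convex_X subspace_L h)
qed

text \<open>The perturbed programs are relaxations, so their minima do not exceed the original one.
  Any cluster point of their solutions is feasible in the limit, hence optimal, and the optimum is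
  unique.\<close>

lemma perturbed_argmin_tendsto:
  assumes h: "strictly_convex h" and B: "finite B" "B \<subseteq> space labelled"
    and ne: "feasible_set X f (fst ` B) \<noteq> {}"
  shows "(\<lambda>n. argmin_on h (feasible_set X (perturbed n) B)) \<longlonglongrightarrow> argmin_on h (feasible_set X f (fst ` B))"
proof (rule compact_unique_cluster_tendsto[OF compact_X])
  interpret U: convex_constraints X h f "space M" L by (rule unperturbed[OF h])
  define x0 where "x0 = U.sol (fst ` B)"
  define x where "x n = argmin_on h (feasible_set X (perturbed n) B)" for n
  have fB: "fst ` B \<subseteq> space M" using B(2) space_labelled by blast
  note x0 = U.sol[OF fB ne, folded x0_def]
  have xn: "x n \<in> feasible_set X (perturbed n) B" "h (x n) \<le> h x0" for n
  proof -
    interpret G: generic_scenario labelled X h "perturbed n" L snd I by (rule generic_perturbed[OF h])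
    have x0n: "x0 \<in> feasible_set X (perturbed n) B"
      using x0(1) feasible_perturbed_superset[OF B(2)] by blast
    then have "G.feas B \<noteq> {}" by blast
    from G.sol(1,2)[OF B(2) this] x0n show "x n \<in> feasible_set X (perturbed n) B" "h (x n) \<le> h x0"
      unfolding x_def by auto
  qed
  show "argmin_on h (feasible_set X (perturbed n) B) \<in> X" for n
    using xn(1)[of n] unfolding x_def by (auto simp: feasible_set_def)
  fix l and s :: "nat \<Rightarrow> nat"
  assume l: "l \<in> X" and s: "strict_mono s"
    and "((\<lambda>n. argmin_on h (feasible_set X (perturbed n) B)) \<circ> s) \<longlonglongrightarrow> l"
  then have lim: "(\<lambda>n. x (s n)) \<longlonglongrightarrow> l" by (simp add: x_def comp_def)
  have "f l (fst z) \<le> 0" if z: "z \<in> B" for z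
  proof -
    have zM: "fst z \<in> space M" using z fB by blast
    have "(\<lambda>n. f (x (s n)) (fst z)) \<longlonglongrightarrow> f l (fst z)"
      using continuous_on_tendsto_compose[OF continuous_f[OF zM, of UNIV] lim] by simp
    moreover have "(\<lambda>n. 1 / real (Suc (s n)) * snd z) \<longlonglongrightarrow> 0 * snd z"
      using LIMSEQ_subseq_LIMSEQ[OF LIMSEQ_Suc[OF lim_1_over_n] s]
      by (intro tendsto_intros) (simp add: comp_def)
    moreover have "f (x (s n)) (fst z) \<le> 1 / real (Suc (s n)) * snd z" for n
      using xn(1)[of "s n"] z by (auto simp: feasible_set_def perturbed_def)
    ultimately show ?thesis by (auto intro: LIMSEQ_le)
  qed
  then have lf: "l \<in> feasible_set X f (fst ` B)" using l by (auto simp: feasible_set_def)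
  have "(\<lambda>n. h (x (s n))) \<longlonglongrightarrow> h l"
    using continuous_on_tendsto_compose[OF convex_on_UNIV_continuous[OF strictly_convex_imp_convex[OF h], of UNIV] lim] by simp
  then have "h l \<le> h x0" using xn(2) by (intro LIMSEQ_le_const2) auto
  then show "l = argmin_on h (feasible_set X f (fst ` B))"
    using x0(3)[OF lf] unfolding x0_def by force
qed

context
  fixes K :: nat and \<epsilon> :: real
  assumes K: "DIM('a) - dim L \<le> K" and \<epsilon>: "0 < \<epsilon>" "\<epsilon> < 1"
begin

text \<open>Needed to bring the bound back from labelled samples along the map that forgets the
  labels.\<close>

lemma exceed_argmin_measurable:
  assumes h: "strictly_convex h"
  shows "exceed \<epsilon> K (argmin_on h) \<in> sets (P K)"
proof -
  have s: "(\<lambda>\<omega>. argmin_on h (feasible_set X f (\<omega> ` I K))) \<in> borel_measurable (P K)"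
  proof -
    have "(\<lambda>\<omega>. argmin_on h {q \<in> X. \<forall>j\<in>I K. f q (\<omega> j) \<le> 0}) \<in> borel_measurable (P K)"
      using measurable_space[OF measurable_component_singleton[of _ "I K" "\<lambda>_. M"]]
      by (intro borel_measurable_argmin_on compact_X convex_X h convex_f) auto
    then show ?thesis by (simp add: feasible_set_def)
  qed
  let ?V = "{p \<in> space (P K \<Otimes>\<^sub>M M). 0 < f (argmin_on h (feasible_set X f (fst p ` I K))) (snd p)}"
  have "(\<lambda>p. f (argmin_on h (feasible_set X f (fst p ` I K))) (snd p)) \<in> borel_measurable (P K \<Otimes>\<^sub>M M)"
  proof (rule borel_measurable_caratheodory[where g="\<lambda>q p. f q (snd p)"
        and x="\<lambda>p. argmin_on h (feasible_set X f (fst p ` I K))"])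
    show "(\<lambda>p. argmin_on h (feasible_set X f (fst p ` I K))) \<in> borel_measurable (P K \<Otimes>\<^sub>M M)"
      by (rule measurable_compose[OF measurable_fst s])
    show "continuous_on UNIV (\<lambda>q. f q (snd p))" if "p \<in> space (P K \<Otimes>\<^sub>M M)" for p
      using that continuous_f by (auto simp: space_pair_measure)
  qed measurable
  then have V: "?V \<in> sets (P K \<Otimes>\<^sub>M M)" by measurable
  have "(\<lambda>\<omega>. measure M (Pair \<omega> -` ?V)) \<in> borel_measurable (P K)"
    unfolding measure_def using measurable_emeasure_Pair[OF V] by measurable
  then have "{\<omega> \<in> space (P K). \<epsilon> < measure M (Pair \<omega> -` ?V)} \<in> sets (P K)" by measurable
  also have "{\<omega> \<in> space (P K). \<epsilon> < measure M (Pair \<omega> -` ?V)} = exceed \<epsilon> K (argmin_on h)"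
  proof -
    have "Pair \<omega> -` ?V = {\<delta> \<in> space M. 0 < f (argmin_on h (feasible_set X f (\<omega> ` I K))) \<delta>}"
      if "\<omega> \<in> space (P K)" for \<omega>
      using that by (auto simp: space_pair_measure)
    then show ?thesis unfolding exceed_def by auto
  qed
  finally show ?thesis .
qed

lemma exceed_argmin_bound:
  assumes h: "strictly_convex h"
  shows "outer_measure_le (P K) (exceed \<epsilon> K (argmin_on h)) (binomial_tail \<epsilon> (int (DIM('a) - dim L) - 1) K)"
proof -
  let ?b = "binomial_tail \<epsilon> (int (DIM('a) - dim L) - 1) K"
  let ?Q = "PiM (I K) (\<lambda>_. labelled)"
  interpret Z: prob_space labelled by (rule prob_space_labelled)
  interpret Q: prob_space ?Q by (rule prob_space_PiM_const[OF prob_space_labelled])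
  let ?sol = "\<lambda>n \<omega>. argmin_on h (feasible_set X (perturbed n) (\<omega> ` I K))"
  define E where "E n = {\<omega> \<in> space ?Q. \<epsilon> < measure labelled {z \<in> space labelled. 0 < perturbed n (?sol n \<omega>) z}}" for n
  have E: "outer_measure_le ?Q (E n) ?b" for n
  proof -
    interpret G: generic_scenario labelled X h "perturbed n" L snd I by (rule generic_perturbed[OF h])
    show ?thesis unfolding E_def by (rule G.violation_bound[OF K \<epsilon>])
  qed
  \<comment> \<open>\<open>E0\<close> is the target event on labelled samples. \<open>Ef\<close>
    discards the null set of infeasible samples, where the solutions need not converge.\<close>
  define E0 where "E0 = compose (I K) fst -` exceed \<epsilon> K (argmin_on h) \<inter> space ?Q"
  define Ef where "Ef = {\<omega> \<in> E0. feasible_set X f (compose (I K) fst \<omega> ` I K) \<noteq> {}}"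
  have "outer_measure_le ?Q Ef ?b"
  proof (rule Q.outer_measure_le_liminf[of E])
    fix \<omega> assume "\<omega> \<in> Ef"
    then have \<omega>: "\<omega> \<in> space ?Q" "compose (I K) fst \<omega> \<in> exceed \<epsilon> K (argmin_on h)"
      "feasible_set X f (fst ` \<omega> ` I K) \<noteq> {}"
      unfolding Ef_def E0_def compose_fst_image by auto
    have B: "\<omega> ` I K \<subseteq> space labelled" using \<omega>(1) by (auto simp: space_PiM)
    define x0 where "x0 = argmin_on h (feasible_set X f (fst ` \<omega> ` I K))"
    have lim: "(\<lambda>n. ?sol n \<omega>) \<longlonglongrightarrow> x0"
      unfolding x0_def using B \<omega>(3) by (intro perturbed_argmin_tendsto h) auto
    have "\<epsilon> < measure M {\<delta> \<in> space M. 0 < f x0 \<delta>}"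
      using \<omega>(2) by (simp add: exceed_def compose_fst_image x0_def)
    also have "measure M {\<delta> \<in> space M. 0 < f x0 \<delta>} = measure labelled {z \<in> space labelled. 0 < f x0 (fst z)}"
    proof -
      have m: "{\<delta> \<in> space M. 0 < f x0 \<delta>} \<in> sets M" by measurable
      have "measure (distr labelled M fst) {\<delta> \<in> space M. 0 < f x0 \<delta>}
          = measure labelled (fst -` {\<delta> \<in> space M. 0 < f x0 \<delta>} \<inter> space labelled)"
        by (rule measure_distr[OF fst_labelled m])
      also have "fst -` {\<delta> \<in> space M. 0 < f x0 \<delta>} \<inter> space labelled = {z \<in> space labelled. 0 < f x0 (fst z)}"
        by (auto simp: space_labelled)
      finally show ?thesis unfolding distr_fst_labelled .
    qed
    finally have gt: "\<epsilon> < measure labelled {z \<in> space labelled. 0 < f x0 (fst z)}" .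
    have "\<forall>\<^sub>F n in sequentially. \<epsilon> < measure labelled {z \<in> space labelled. 0 < perturbed n (?sol n \<omega>) z}"
    proof (rule Z.eventually_measure_gt[OF _ _ _ gt])
      show "{z \<in> space labelled. 0 < perturbed n (?sol n \<omega>) z} \<in> sets labelled" for n
        unfolding perturbed_def by measurable
      show "{z \<in> space labelled. 0 < f x0 (fst z)} \<in> sets labelled" by measurable
      fix z assume "z \<in> {z \<in> space labelled. 0 < f x0 (fst z)}"
      then have z: "z \<in> space labelled" "0 < f x0 (fst z)" by auto
      have zM: "fst z \<in> space M" using z(1) by (simp add: space_labelled)
      have "(\<lambda>n. f (?sol n \<omega>) (fst z) - 1 / real (Suc n) * snd z) \<longlonglongrightarrow> f x0 (fst z) - 0 * snd z"
        using LIMSEQ_Suc[OF lim_1_over_n]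
          continuous_on_tendsto_compose[OF continuous_f[OF zM, of UNIV] lim]
        by (intro tendsto_intros) auto
      then have "\<forall>\<^sub>F n in sequentially. 0 < perturbed n (?sol n \<omega>) z"
        using z(2) unfolding perturbed_def by (intro order_tendstoD(1)) auto
      then show "\<forall>\<^sub>F n in sequentially. z \<in> {z \<in> space labelled. 0 < perturbed n (?sol n \<omega>) z}"
        using z(1) by simp
    qed
    then show "\<forall>\<^sub>F n in sequentially. \<omega> \<in> E n" using \<omega>(1) by (simp add: E_def)
  qed (rule E)
  moreover have "AE \<omega> in ?Q. feasible_set X f (compose (I K) fst \<omega> ` I K) \<noteq> {}"
    by (rule AE_distrD[OF measurable_compose_fst]) (simp only: distr_compose_fst feasible)
  then have "AE \<omega> in ?Q. \<omega> \<in> E0 \<longrightarrow> \<omega> \<in> Ef"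
    by (rule eventually_mono) (auto simp: Ef_def)
  ultimately have "outer_measure_le ?Q E0 ?b"
    by (rule Q.outer_measure_le_AE) (auto simp: E0_def)
  then obtain A where A: "A \<in> sets ?Q" "E0 \<subseteq> A" "measure ?Q A \<le> ?b"
    by (auto simp: outer_measure_le_def)
  have "measure (P K) (exceed \<epsilon> K (argmin_on h))
      = measure (distr ?Q (P K) (compose (I K) fst)) (exceed \<epsilon> K (argmin_on h))"
    by (simp only: distr_compose_fst)
  also have "\<dots> = measure ?Q E0"
    unfolding E0_def by (rule measure_distr[OF measurable_compose_fst exceed_argmin_measurable[OF h]])
  also have "\<dots> \<le> measure ?Q A" using A by (intro Q.finite_measure_mono) auto
  finally show ?thesis
    using A(3) exceed_argmin_measurable[OF h] unfolding outer_measure_le_def by (intro bexI) auto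
qed

theorem exceed_lex_select_bound:
  assumes "\<forall>g\<in>set hs. convex_on UNIV g" "strictly_convex h"
  shows "outer_measure_le (P K) (exceed \<epsilon> K (lex_select (hs @ [h])))
    (binomial_tail \<epsilon> (int (DIM('a) - dim L) - 1) K)"
  using assms
proof (induction hs arbitrary: h rule: rev_induct)
  case Nil
  then show ?case
    using exceed_argmin_bound[of h] by (simp add: exceed_def lex_select_single)
next
  case (snoc g hs)
  let ?b = "binomial_tail \<epsilon> (int (DIM('a) - dim L) - 1) K"
  let ?s = "\<lambda>n. lex_select (hs @ [\<lambda>x. g x + 1 / real (Suc n) * h x])"
  let ?lim = "lex_select ((hs @ [g]) @ [h])"
  interpret P: prob_space "P K" by (rule prob_space_PiM_const[OF prob_space_axioms])
  interpret U: convex_constraints X h f "space M" L by (rule unperturbed[OF snoc.prems(2)])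
  \<comment> \<open>The merged list is one criterion shorter and still ends in a strictly convex
    one, so the induction hypothesis applies with a bound independent of \<open>n\<close>.\<close>
  have "outer_measure_le (P K) (exceed \<epsilon> K (?s n)) ?b" for n
    using snoc.prems by (intro snoc.IH strictly_convex_add_scaled) auto
  then have "outer_measure_le (P K) {\<omega> \<in> exceed \<epsilon> K ?lim. feasible_set X f (\<omega> ` I K) \<noteq> {}} ?b"
  proof (rule P.outer_measure_le_liminf)
    fix \<omega> assume "\<omega> \<in> {\<omega> \<in> exceed \<epsilon> K ?lim. feasible_set X f (\<omega> ` I K) \<noteq> {}}"
    then have \<omega>: "\<omega> \<in> space (P K)" "feasible_set X f (\<omega> ` I K) \<noteq> {}"
      "\<epsilon> < measure M {\<delta> \<in> space M. 0 < f (?lim (feasible_set X f (\<omega> ` I K))) \<delta>}"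
      by (auto simp: exceed_def)
    have B: "\<omega> ` I K \<subseteq> space M" using \<omega>(1) by (auto simp: space_PiM)
    have "(\<lambda>n. ?s n (feasible_set X f (\<omega> ` I K))) \<longlonglongrightarrow> ?lim (feasible_set X f (\<omega> ` I K))"
      using lex_select_merge_tendsto[of hs g h "feasible_set X f (\<omega> ` I K)"]
        snoc.prems U.compact_feas[OF B] U.convex_feas[OF B] \<omega>(2) by simp
    from eventually_violation_gt[OF this \<omega>(3)]
    show "\<forall>\<^sub>F n in sequentially. \<omega> \<in> exceed \<epsilon> K (?s n)"
      using \<omega>(1) by (simp add: exceed_def)
  qed
  moreover have "AE \<omega> in P K. \<omega> \<in> exceed \<epsilon> K ?lim \<longrightarrow>
      \<omega> \<in> {\<omega> \<in> exceed \<epsilon> K ?lim. feasible_set X f (\<omega> ` I K) \<noteq> {}}"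
    using feasible[of K] by (rule eventually_mono) simp
  ultimately show ?case
    by (rule P.outer_measure_le_AE) (auto simp: exceed_def)
qed

end

end

section \<open>The multiple chance-constrained program\<close>

lemma AE_PiM_merge:
  assumes Z: "prob_space Z" and fin: "finite J" "finite I" "J \<inter> I = {}"
    and AE: "AE \<omega> in PiM (J \<union> I) (\<lambda>_. Z). Q \<omega>"
  shows "AE x in PiM J (\<lambda>_. Z). AE y in PiM I (\<lambda>_. Z). Q (merge J I (x, y))"
proof -
  interpret prod: product_sigma_finite "\<lambda>_. Z" by (rule product_sigma_finite_const[OF Z])
  interpret PJ: prob_space "PiM J (\<lambda>_. Z)" by (rule prob_space_PiM_const[OF Z])
  interpret PI: prob_space "PiM I (\<lambda>_. Z)" by (rule prob_space_PiM_const[OF Z])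
  interpret pair_sigma_finite "PiM J (\<lambda>_. Z)" "PiM I (\<lambda>_. Z)" ..
  have "AE \<omega> in distr (PiM J (\<lambda>_. Z) \<Otimes>\<^sub>M PiM I (\<lambda>_. Z)) (PiM (J \<union> I) (\<lambda>_. Z)) (merge J I). Q \<omega>"
    using AE by (subst prod.distr_merge[OF fin(3,1,2)])
  from AE_distrD[OF measurable_merge this] show ?thesis by (rule AE_pair)
qed

lemma measure_PiM_merge_le:
  assumes Z: "prob_space Z" and fin: "finite J" "finite I" "J \<inter> I = {}"
    and E: "E \<in> sets (PiM (J \<union> I) (\<lambda>_. Z))" and b: "0 \<le> b"
    and AE: "AE x in PiM J (\<lambda>_. Z).
      measure (PiM I (\<lambda>_. Z)) {y \<in> space (PiM I (\<lambda>_. Z)). merge J I (x, y) \<in> E} \<le> b"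
  shows "measure (PiM (J \<union> I) (\<lambda>_. Z)) E \<le> b"
proof -
  interpret prod: product_sigma_finite "\<lambda>_. Z" by (rule product_sigma_finite_const[OF Z])
  interpret PJ: prob_space "PiM J (\<lambda>_. Z)" by (rule prob_space_PiM_const[OF Z])
  interpret PI: prob_space "PiM I (\<lambda>_. Z)" by (rule prob_space_PiM_const[OF Z])
  let ?P = "PiM J (\<lambda>_. Z) \<Otimes>\<^sub>M PiM I (\<lambda>_. Z)"
  let ?E = "merge J I -` E \<inter> space ?P"
  have mE: "?E \<in> sets ?P" by (rule measurable_sets[OF measurable_merge E])
  have "emeasure (PiM (J \<union> I) (\<lambda>_. Z)) E = emeasure (distr ?P (PiM (J \<union> I) (\<lambda>_. Z)) (merge J I)) E"
    by (subst prod.distr_merge[OF fin(3,1,2)]) (rule refl)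
  also have "\<dots> = emeasure ?P ?E" by (rule emeasure_distr[OF measurable_merge E])
  also have "\<dots> = (\<integral>\<^sup>+x. emeasure (PiM I (\<lambda>_. Z)) (Pair x -` ?E) \<partial>PiM J (\<lambda>_. Z))"
    by (rule PI.emeasure_pair_measure_alt[OF mE])
  also have "\<dots> \<le> (\<integral>\<^sup>+x. ennreal b \<partial>PiM J (\<lambda>_. Z))"
  proof (rule nn_integral_mono_AE)
    show "AE x in PiM J (\<lambda>_. Z). emeasure (PiM I (\<lambda>_. Z)) (Pair x -` ?E) \<le> ennreal b"
      using AE AE_space
    proof eventually_elim
      case (elim x)
      have "Pair x -` ?E = {y \<in> space (PiM I (\<lambda>_. Z)). merge J I (x, y) \<in> E}"
        using elim(2) by (auto simp: space_pair_measure)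
      then show ?case using elim(1) by (simp add: PI.emeasure_eq_measure ennreal_leI)
    qed
  qed
  also have "\<dots> = ennreal b" by (simp add: PJ.emeasure_space_1)
  finally show ?thesis using b by (simp add: measure_def enn2real_leI)
qed

lemma lexordp_eq_appendD:
  fixes xs ys xs' ys' :: "real list"
  assumes "length xs = length ys" "lexordp_eq (xs @ xs') (ys @ ys')"
  shows "lexordp_eq xs ys"
  using assms lexordp_eq_append[OF assms(1)] lexordp_eq_refl by metis

text \<open>The linear objective as first criterion fuses optimality and tie-break into one
  lexicographic minimization. The squared norm as last criterion supplies strict convexity and
  leaves the choice unchanged, because \<open>gs\<close> already separates points.\<close>

lemma selected_optimal_eq_lex_select:
  fixes F :: "(real ^ 'n) set"
  assumes gs: "\<forall>g\<in>set gs. convex_on UNIV g" "inj (\<lambda>x. map (\<lambda>g. g x) gs)"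
    and tb: "\<And>x y. tb x y \<longleftrightarrow> lexordp_eq (map (\<lambda>g. g x) gs) (map (\<lambda>g. g y) gs)"
    and F: "compact F" "convex F" "F \<noteq> {}"
  shows "selected tb (optimal_points c F) = lex_select (((\<bullet>) c # gs) @ [\<lambda>x. x \<bullet> x]) F"
    and "\<forall>g\<in>set ((\<bullet>) c # gs). convex_on UNIV g"
proof -
  let ?hs = "((\<bullet>) c # gs) @ [\<lambda>x. x \<bullet> x]"
  have "convex_on UNIV ((\<bullet>) c)" by (auto simp: convex_on_def inner_add_right)
  then show c: "\<forall>g\<in>set ((\<bullet>) c # gs). convex_on UNIV g" using gs(1) by auto
  then have c': "\<forall>g\<in>set ?hs. convex_on UNIV g"
    using strictly_convex_imp_convex[OF strictly_convex_norm_square] by auto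
  define x where "x = lex_select ?hs F"
  have "(\<lambda>x. x \<bullet> x) \<in> set ?hs" by simp
  note sel = lex_select(1,2)[OF c' strictly_convex_norm_square this F, folded x_def]
  have x: "c \<bullet> x < c \<bullet> y \<or> c \<bullet> x = c \<bullet> y \<and> lexordp_eq (map (\<lambda>g. g x) gs) (map (\<lambda>g. g y) gs)"
    if "y \<in> F" for y
    using sel(2)[OF that] lexordp_eq_appendD[of "map (\<lambda>g. g x) gs" "map (\<lambda>g. g y) gs" "[x \<bullet> x]" "[y \<bullet> y]"]
    by auto
  have xo: "x \<in> optimal_points c F"
    using sel(1) x unfolding optimal_points_def by fastforce
  have xt: "tb x y" if y: "y \<in> optimal_points c F" for y
  proof -
    have "y \<in> F" "c \<bullet> y \<le> c \<bullet> x" using y sel(1) by (auto simp: optimal_points_def)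
    then show ?thesis using x[of y] by (auto simp: tb)
  qed
  show "selected tb (optimal_points c F) = lex_select ?hs F"
    unfolding selected_def x_def[symmetric]
  proof (rule the_equality)
    show "x \<in> optimal_points c F \<and> (\<forall>y\<in>optimal_points c F. tb x y)" using xo xt by auto
    fix y assume y: "y \<in> optimal_points c F \<and> (\<forall>z\<in>optimal_points c F. tb y z)"
    then have "tb x y" "tb y x" using xo xt by auto
    then have "map (\<lambda>g. g y) gs = map (\<lambda>g. g x) gs" unfolding tb by (rule lexordp_eq_antisym[rotated])
    then show "y = x" using injD[OF gs(2)] by auto
  qed
qed

lemma AE_PiM_all_components:
  assumes "prob_space Z" "finite J" "AE z in Z. Q z"
  shows "AE \<omega> in PiM J (\<lambda>_. Z). \<forall>j\<in>J. Q (\<omega> j)"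
  using assms by (intro AE_finite_allI AE_PiM_component) auto

lemma unconstrained_subspace_invariant:
  "subspace (unconstrained_subspace M g)"
  "AE \<delta> in M. \<forall>x. unconstrained_subspace M g \<subseteq> invariance_set g x \<delta>"
proof -
  have "unconstrained_subspace M g \<in> invariant_subspaces M g"
    using theI'[OF unconstrained_subspace_unique[of M g]] unfolding unconstrained_subspace_def by (rule conjunct1)
  then show "subspace (unconstrained_subspace M g)"
    "AE \<delta> in M. \<forall>x. unconstrained_subspace M g \<subseteq> invariance_set g x \<delta>"
    unfolding invariant_subspaces_def by auto
qed

theorem theorem4p1:
  fixes M :: "'b measure"
    and X :: "(real ^ 'n) set"
    and c :: "real ^ 'n"
    and N :: nat
    and f :: "nat \<Rightarrow> real ^ 'n \<Rightarrow> 'b \<Rightarrow> real"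
    and \<epsilon> :: "nat \<Rightarrow> real"
    and K :: "nat \<Rightarrow> nat"
    and tb :: "real ^ 'n \<Rightarrow> real ^ 'n \<Rightarrow> bool"
  assumes prob: "prob_space M"
    and X: "compact X" "convex X"
    and eps: "\<forall>i\<in>{1..N}. 0 < \<epsilon> i \<and> \<epsilon> i < 1"
    and measurable_constraints: "\<forall>i\<in>{1..N}. \<forall>x. f i x \<in> borel_measurable M"
    and measurable_violation: "\<forall>i\<in>{1..N}.
      {\<omega> \<in> space (sample_measure M N K). violation_prob M X c tb f N K i \<omega> > \<epsilon> i}
        \<in> sets (sample_measure M N K)"
    and convexity: "\<forall>i\<in>{1..N}. AE \<delta> in M. convex_on UNIV (\<lambda>x. f i x \<delta>)"
    and existence: "mcp_feasible M X f N \<epsilon> \<noteq> {}"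
    and uniqueness: "tie_break_rule tb"
    and feasibility: "\<forall>K'. AE \<omega> in sample_measure M N K'. msp_feasible X f N K' \<omega> \<noteq> {}"
    and sample_size: "\<forall>i\<in>{1..N}. K i \<ge> CARD('n)"
  shows "\<forall>i\<in>{1..N}.
    measure (sample_measure M N K)
      {\<omega> \<in> space (sample_measure M N K). violation_prob M X c tb f N K i \<omega> > \<epsilon> i}
    \<le> binomial_tail (\<epsilon> i) (int (support_rank M (f i)) - 1) (K i)"
proof
  fix i assume i: "i \<in> {1..N}"
  interpret M: prob_space M by (rule prob)
  define L where "L = unconstrained_subspace M (f i)"
  define b where "b = binomial_tail (\<epsilon> i) (int (support_rank M (f i)) - 1) (K i)"
  \<comment> \<open>\<open>I m\<close> indexes the samples of constraint \<open>i\<close> at a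
    variable size \<open>m\<close>, as the moments require; \<open>J\<close> indexes those of the
    other constraints at their given sizes.\<close>
  define I where "I m = Pair i ` {1..m}" for m :: nat
  define J where "J = (SIGMA j:{1..N} - {i}. {1..K j})"
  have fin: "finite J" "finite (I m)" "J \<inter> I m = {}" for m
    by (auto simp: J_def I_def)
  have cardI: "card (I m) = m" for m
    by (simp add: I_def card_image inj_on_def)
  have index: "sample_index N (K(i := m)) = J \<union> I m" for m
    using i unfolding sample_index_def J_def I_def by (auto split: if_splits)
  have indexK: "sample_index N K = J \<union> I (K i)" using index[of "K i"] by simp
  define good where "good \<delta> \<longleftrightarrow> (\<forall>j\<in>{1..N}. convex_on UNIV (\<lambda>x. f j x \<delta>)) \<and>
      (\<forall>x. L \<subseteq> invariance_set (f i) x \<delta>)" for \<delta>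
  have "AE \<delta> in M. \<forall>j\<in>{1..N}. convex_on UNIV (\<lambda>x. f j x \<delta>)"
    using convexity by (intro AE_finite_allI) auto
  then have AE_good: "AE \<delta> in M. good \<delta>"
    using unconstrained_subspace_invariant(2)[of M "f i"] unfolding good_def L_def by eventually_elim auto
  obtain N0 where N0: "{\<delta> \<in> space M. \<not> good \<delta>} \<subseteq> N0" "N0 \<in> null_sets M"
    using AE_good unfolding eventually_ae_filter by blast
  have AE_N0: "AE \<delta> in M. \<delta> \<notin> N0" using N0(2) by (rule AE_not_in)
  have good: "good \<delta>" if "\<delta> \<in> space M" "\<delta> \<notin> N0" for \<delta> using N0(1) that by blast
  \<comment> \<open>On the null set \<open>N0\<close> the constraint becomes the constant -1, which
    is convex, invariant and always satisfied. The conditions of \<open>single_constraint\<close>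
    then hold everywhere without changing the space.\<close>
  define f' where "f' x \<delta> = (if \<delta> \<in> N0 then - 1 else f i x \<delta>)" for x \<delta>
  define X' where "X' x = {q \<in> X. \<forall>p\<in>J. f (fst p) q (x p) \<le> 0}" for x :: "nat \<times> nat \<Rightarrow> 'b"
  have f'_meas: "f' q \<in> borel_measurable M" for q
    using measurable_constraints i N0(2) unfolding f'_def by (auto intro!: measurable_If_set)
  have mergeJ: "merge J (I m) (x, y) p = x p" if "p \<in> J" for m x y p
    using that by (simp add: merge_def)
  have mergeI: "merge J (I m) (x, y) p = y p" if "p \<in> I m" for m p and x y :: "nat \<times> nat \<Rightarrow> 'b"
    using that fin(3)[of m] by (auto simp: merge_def)
  have fst_I: "fst p = i" if "p \<in> I m" for p m using that by (auto simp: I_def)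
  have msp: "msp_feasible X f N (K(i := m)) (merge J (I m) (x, y))
      = {q \<in> X' x. \<forall>p\<in>I m. f i q (y p) \<le> 0}" for m x y
  proof -
    have "msp_feasible X f N (K(i := m)) \<omega> = {q \<in> X. \<forall>p\<in>J \<union> I m. f (fst p) q (\<omega> p) \<le> 0}" for \<omega>
      unfolding msp_feasible_def index[symmetric] sample_index_def by auto
    then show ?thesis
      by (simp add: X'_def ball_Un mergeJ mergeI fst_I conj_assoc cong: ball_cong)
  qed
  obtain gs where gs: "\<forall>g\<in>set gs. convex_on UNIV g" "inj (\<lambda>x. map (\<lambda>g. g x) gs)"
    "\<And>x y. tb x y \<longleftrightarrow> lexordp_eq (map (\<lambda>g. g x) gs) (map (\<lambda>g. g y) gs)"
    using uniqueness unfolding tie_break_rule_def by blast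
  let ?s = "lex_select (((\<bullet>) c # gs) @ [\<lambda>x. x \<bullet> x])"
  define E where "E = {\<omega> \<in> space (sample_measure M N K). violation_prob M X c tb f N K i \<omega> > \<epsilon> i}"
  have E: "E \<in> sets (PiM (J \<union> I (K i)) (\<lambda>_. M))"
    using measurable_violation i unfolding E_def by (auto simp: sample_measure_def indexK)
  \<comment> \<open>One exceptional null set of \<open>x\<close> must serve all sizes
    \<open>m\<close> at once, which is possible because there are countably many.\<close>
  have "AE x in PiM J (\<lambda>_. M). \<forall>m. AE y in PiM (I m) (\<lambda>_. M).
      msp_feasible X f N (K(i := m)) (merge J (I m) (x, y)) \<noteq> {}"
    unfolding AE_all_countable
  proof
    fix m
    have "AE \<omega> in PiM (J \<union> I m) (\<lambda>_. M). msp_feasible X f N (K(i := m)) \<omega> \<noteq> {}"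
      using feasibility[rule_format, of "K(i := m)"] by (simp only: sample_measure_def index)
    then show "AE x in PiM J (\<lambda>_. M). AE y in PiM (I m) (\<lambda>_. M).
        msp_feasible X f N (K(i := m)) (merge J (I m) (x, y)) \<noteq> {}"
      by (rule AE_PiM_merge[OF prob fin])
  qed
  then have "AE x in PiM J (\<lambda>_. M).
    measure (PiM (I (K i)) (\<lambda>_. M)) {y \<in> space (PiM (I (K i)) (\<lambda>_. M)). merge J (I (K i)) (x, y) \<in> E} \<le> b"
    using AE_PiM_all_components[OF prob fin(1) AE_N0] AE_space
  proof eventually_elim
    case (elim x)
    let ?P = "PiM (I (K i)) (\<lambda>_. M)"
    interpret PI: prob_space ?P by (rule prob_space_PiM_const[OF prob])
    have gx: "convex_on UNIV (\<lambda>q. f (fst p) q (x p))" if p: "p \<in> J" for p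
    proof -
      have "x p \<in> space M" using elim(3) p by (auto simp: space_PiM)
      then have "good (x p)" using elim(2) p good by blast
      then show ?thesis using p by (auto simp: good_def J_def)
    qed
    have X'_eq: "X' x = X \<inter> (\<Inter>p\<in>J. {q. f (fst p) q (x p) \<le> 0})" by (auto simp: X'_def)
    \<comment> \<open>With \<open>x\<close> fixed, the sampled constraints of the other indices are
      absorbed into the compact convex set \<open>X' x\<close>.\<close>
    have "single_constraint M (X' x) f' L I"
    proof
      show "compact (X' x)" unfolding X'_eq
        using gx by (intro compact_Int_closed X closed_INT ballI closed_Collect_le
          convex_on_UNIV_continuous continuous_on_const)
      show "convex (X' x)" unfolding X'_eq
        using gx by (intro convex_Int X convex_INT convex_sublevel)
      show "convex_on UNIV (\<lambda>q. f' q \<delta>)" if "\<delta> \<in> space M" for \<delta>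
        using good[OF that] i by (auto simp: f'_def good_def convex_on_def)
      show "f' (q + \<xi>) \<delta> = f' q \<delta>" if "\<delta> \<in> space M" "\<xi> \<in> L" for \<delta> \<xi> q
        using good[OF that(1)] that(2) by (auto simp: f'_def good_def invariance_set_def)
      show "AE y in PiM (I m) (\<lambda>_. M). feasible_set (X' x) f' (y ` I m) \<noteq> {}" for m
        using elim(1)[rule_format, of m]
      proof (rule eventually_mono)
        fix y assume "msp_feasible X f N (K(i := m)) (merge J (I m) (x, y)) \<noteq> {}"
        then show "feasible_set (X' x) f' (y ` I m) \<noteq> {}"
          unfolding msp feasible_set_def f'_def by auto
      qed
    qed (use f'_meas fin cardI in \<open>auto simp: L_def unconstrained_subspace_invariant\<close>)
    then interpret S: single_constraint M "X' x" f' L I .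
    have rank: "DIM(real ^ 'n) - dim L = support_rank M (f i)"
      by (simp add: support_rank_def L_def)
    have rK: "DIM(real ^ 'n) - dim L \<le> K i"
      using sample_size i by (auto intro: le_trans[OF diff_le_self])
    have "0 < \<epsilon> i" "\<epsilon> i < 1" using eps i by auto
    note bound = S.exceed_lex_select_bound[OF rK this]
    let ?E = "{y \<in> space ?P. merge J (I (K i)) (x, y) \<in> E}"
    have mE: "?E \<in> sets ?P"
    proof -
      have "(\<lambda>y. merge J (I (K i)) (x, y)) \<in> measurable ?P (PiM (J \<union> I (K i)) (\<lambda>_. M))"
        by (rule measurable_compose[OF measurable_Pair1'[OF elim(3)] measurable_merge])
      from measurable_sets[OF this E] show ?thesis by (simp add: vimage_def Int_def conj_commute)
    qed
    have "outer_measure_le ?P (S.exceed (\<epsilon> i) (K i) ?s) b"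
      using bound[of "(\<bullet>) c # gs" "\<lambda>x. x \<bullet> x"] strictly_convex_norm_square gs(1)
      unfolding rank b_def by (auto simp: convex_on_def inner_add_right)
    \<comment> \<open>Outside \<open>N0\<close> the functions \<open>f'\<close> and
      \<open>f i\<close> coincide, so for almost every \<open>y\<close> the feasible set, the
      selected point and the violation probability are those of the original program.\<close>
    moreover have "AE y in ?P. y \<in> ?E \<longrightarrow> y \<in> S.exceed (\<epsilon> i) (K i) ?s"
      using S.feasible[of "K i"] AE_PiM_all_components[OF prob fin(2) AE_N0]
    proof eventually_elim
      case (elim y)
      show ?case
      proof
        assume "y \<in> ?E"
        then have y: "y \<in> space ?P" "\<epsilon> i < violation_prob M X c tb f N K i (merge J (I (K i)) (x, y))"
          by (auto simp: E_def)
        let ?F = "feasible_set (X' x) f' (y ` I (K i))"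
        have "msp_feasible X f N K (merge J (I (K i)) (x, y)) = ?F"
          using msp[of "K i" x y] elim(2) by (auto simp: feasible_set_def f'_def)
        moreover have "compact ?F" "convex ?F"
        proof -
          interpret U: convex_constraints "X' x" "\<lambda>x. x \<bullet> x" f' "space M" L
            by (rule S.unperturbed[OF strictly_convex_norm_square])
          have "y ` I (K i) \<subseteq> space M" using y(1) by (auto simp: space_PiM)
          then show "compact ?F" "convex ?F" by (rule U.compact_feas, rule U.convex_feas)
        qed
        ultimately have sol: "scenario_solution X c tb f N K (merge J (I (K i)) (x, y)) = ?s ?F"
          unfolding scenario_solution_def
          using selected_optimal_eq_lex_select(1)[OF gs] elim(1) by simp
        have "measure M {\<delta> \<in> space M. 0 < f i (?s ?F) \<delta>} = measure M {\<delta> \<in> space M. 0 < f' (?s ?F) \<delta>}"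
        proof (rule M.finite_measure_eq_AE)
          show "AE \<delta> in M. (\<delta> \<in> {\<delta> \<in> space M. 0 < f i (?s ?F) \<delta>}) = (\<delta> \<in> {\<delta> \<in> space M. 0 < f' (?s ?F) \<delta>})"
            using AE_N0 by eventually_elim (simp add: f'_def)
          have [measurable]: "f i (?s ?F) \<in> borel_measurable M" using measurable_constraints i by blast
          show "{\<delta> \<in> space M. 0 < f i (?s ?F) \<delta>} \<in> sets M" by measurable
        qed (use f'_meas in measurable)
        then show "y \<in> S.exceed (\<epsilon> i) (K i) ?s"
          using y by (simp add: S.exceed_def violation_prob_def sol)
      qed
    qed
    ultimately have "outer_measure_le ?P ?E b"
      by (rule PI.outer_measure_le_AE) auto
    then obtain A where "A \<in> sets ?P" "?E \<subseteq> A" "measure ?P A \<le> b" by (auto simp: outer_measure_le_def)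
    then show ?case using PI.finite_measure_mono[of ?E A] by simp
  qed
  then have "measure (PiM (J \<union> I (K i)) (\<lambda>_. M)) E \<le> b"
    using eps[rule_format, OF i] unfolding b_def
    by (intro measure_PiM_merge_le[OF prob fin E] binomial_tail_nonneg) auto
  then show "measure (sample_measure M N K)
      {\<omega> \<in> space (sample_measure M N K). violation_prob M X c tb f N K i \<omega> > \<epsilon> i}
      \<le> binomial_tail (\<epsilon> i) (int (support_rank M (f i)) - 1) (K i)"
    unfolding E_def b_def by (simp add: sample_measure_def indexK)
qed

end
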